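(* For every $q_0,q_1\in\mathcal Q_1$ and $\lambda\in[0,1]$, we have $$\psi_\circ((1-\lambda)q_0+\lambda q_1)\le(1-\lambda)\psi_\circ(q_0)+\lambda\psi_\circ(q_1).$$
   Context: $\mathcal Q$ is the set of right-continuous nondecreasing paths $q:[0,1)\to\mathbb R_+$, and $\mathcal Q_1=\mathcal Q\cap L^1[0,1)$. The function $\psi_\circ:\mathcal Q_1\to\mathbb R$ is defined as follows. Let $(B_t)_{t\ge0}$ be a standard Brownian motion. For $m,t\ge0$, let $T_{m,t}f(x)=\frac1m\log\mathbb E\,e^{mf(x+B_{2t})}$ if $m>0$, and $T_{0,t}f(x)=\mathbb Ef(x+B_{2t})$. For a path $q=\sum_{i=0}^kq_i\mathbf 1_{[m_i,m_{i+1})}$ taking finitely many values, with $0=m_0<m_1<\dots<m_k<m_{k+1}=1$ and $0=q_{-1}\le q_0\le q_1\le\dots\le q_k$, set $f_{k+1}(x)=\log\cosh x$, recursively $f_i=T_{m_i,\,q_i-q_{i-1}}f_{i+1}$ for $i=k,k-1,\dots,0$, and $\psi_\circ(q)=q_k-f_0(0)$. The value does not depend on the chosen representation of $q$ (since $T_{m,0}$ is the identity and $T_{m,a}T_{m,b}=T_{m,a+b}$). On paths with finitely many values, $|\psi_\circ(q)-\psi_\circ(q')|\le|q-q'|_{L^1}$, and $\psi_\circ$ is extended to $\mathcal Q_1$ by continuity. *)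

theory Defs
  imports "HOL-Probability.Probability"
begin

text \<open>
  A path \<open>[0,1) \<rightarrow> \<real>\<^sub>+\<close> is represented by a function on all of \<open>\<real>\<close>; nothing below depends on
  its values outside \<open>{0..<1}\<close>.
\<close>

definition paths :: "(real \<Rightarrow> real) set" where
  "paths = {q. mono_on {0..<1} q \<and> (\<forall>s\<in>{0..<1}. 0 \<le> q s \<and> continuous (at_right s) q)}"

definition paths1 :: "(real \<Rightarrow> real) set" where
  "paths1 = {q \<in> paths. set_integrable lborel {0..<1} q}"

definition L1_dist :: "(real \<Rightarrow> real) \<Rightarrow> (real \<Rightarrow> real) \<Rightarrow> real" where
  "L1_dist p q = (LINT s:{0..<1}|lborel. \<bar>p s - q s\<bar>)"

text \<open>
  Law of \<open>B\<^sub>s\<close>, a centred Gaussian of variance \<open>s\<close>. It is the image of the standard Gaussian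
  under scaling, rather than a density, so that \<open>s = 0\<close> gives the point mass at \<open>0\<close>.
\<close>

definition brownian_law :: "real \<Rightarrow> real measure" where
  "brownian_law s = distr std_normal_distribution borel (\<lambda>z. sqrt s * z)"

definition T_op :: "real \<Rightarrow> real \<Rightarrow> (real \<Rightarrow> real) \<Rightarrow> real \<Rightarrow> real" where
  "T_op m t f x =
     (if m = 0 then (LINT y|brownian_law (2 * t). f (x + y))
      else (1 / m) * ln (LINT y|brownian_law (2 * t). exp (m * f (x + y))))"

text \<open>
  The path \<open>p\<close> is \<open>\<Sum>i\<le>k. a i * 1[m i, m (i+1))\<close>. Only \<open>m 0, \<dots>, m (k+1)\<close> and
  \<open>a 0, \<dots>, a k\<close> are relevant.
\<close>

definition step_rep :: "(real \<Rightarrow> real) \<Rightarrow> nat \<Rightarrow> (nat \<Rightarrow> real) \<Rightarrow> (nat \<Rightarrow> real) \<Rightarrow> bool" where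
  "step_rep p k m a \<longleftrightarrow>
     m 0 = 0 \<and> m (k + 1) = 1 \<and> (\<forall>i\<le>k. m i < m (i + 1)) \<and>
     0 \<le> a 0 \<and> (\<forall>i<k. a i \<le> a (i + 1)) \<and>
     (\<forall>s\<in>{0..<1}. p s = (\<Sum>i\<le>k. a i * indicator {m i..<m (i + 1)} s))"

definition step_paths :: "(real \<Rightarrow> real) set" where
  "step_paths = {p. \<exists>k m a. step_rep p k m a}"

text \<open>The functions \<open>f\<^sub>i\<close>; the value \<open>0\<close> used at \<open>i = 0\<close> is the convention \<open>q\<^sub>-\<^sub>1 = 0\<close>.\<close>

function parisi_f :: "nat \<Rightarrow> (nat \<Rightarrow> real) \<Rightarrow> (nat \<Rightarrow> real) \<Rightarrow> nat \<Rightarrow> real \<Rightarrow> real" where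
  "parisi_f k m a i =
     (if k < i then (\<lambda>x. ln (cosh x))
      else T_op (m i) (a i - (if i = 0 then 0 else a (i - 1))) (parisi_f k m a (i + 1)))"
  by auto
termination by (relation "Wellfounded.measure (\<lambda>(k, m, a, i). Suc k - i)") auto

declare parisi_f.simps [simp del]

definition psi_step :: "(real \<Rightarrow> real) \<Rightarrow> real" where
  "psi_step p = (THE v. \<exists>k m a. step_rep p k m a \<and> v = a k - parisi_f k m a 0 0)"

text \<open>
  The extension by continuity: the limit of \<open>psi_step p\<close> as \<open>p\<close> tends to \<open>q\<close> in \<open>L\<^sup>1[0,1)\<close> along
  step paths.
\<close>

definition psi_circ :: "(real \<Rightarrow> real) \<Rightarrow> real" where
  "psi_circ q =
     Lim (inf (filtercomap (\<lambda>p. L1_dist p q) (nhds 0)) (principal step_paths)) psi_step"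

end

theory Submission
  imports Defs
begin

text \<open>
  In the variable of the Brownian motion, \<open>f\<^sub>0(0)\<close> is obtained by composing infinitesimal
  operators \<open>T\<^bsub>m, dt\<^esub>\<close> backwards in time, the exponent at time \<open>\<tau>\<close> being the measure of
  \<open>{s. q s \<le> \<tau>}\<close>. As \<open>T\<^bsub>1,t\<^esub>\<close> adds the constant \<open>t\<close> to \<open>ln \<circ> cosh\<close>, the functional is \<open>T - f\<^sub>0(0)\<close> for every
  horizon \<open>T\<close> above the path. Its convexity is not convexity of the individual operators. It comes
  from a lattice inequality, submodularity up to translations,
  \<open>\<psi>(max (p - \<beta>) q) + \<psi>(min p (q + \<beta>)) \<le> \<psi>(p) + \<psi>(q)\<close> for \<open>\<beta> \<ge> 0\<close>. In terms of a Hessian it says that off-diagonal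
  entries are nonpositive and row sums nonnegative, so that the Hessian is diagonally dominant.

  The inequality rests on symmetry: all functions in the recursion are even and convex. Seen from \<open>x\<close>, a Gaussian
  mean of an even function is a mean under a symmetric measure with weight \<open>cosh (c z)\<close>, and functions of \<open>z\<close>
  that are nondecreasing in \<open>\<bar>z\<bar>\<close> are positively correlated (\<open>chebyshev_association\<close>). It follows that raising the
  exponents makes the difference of two recursions nondecreasing in \<open>\<bar>x\<bar>\<close> (\<open>tilted_slope_mono\<close>). Consequently, adding
  such a difference has a greater effect on the larger recursion than on the smaller one
  (\<open>T_op_supermodular_step\<close>), and the recursion is supermodular in its exponents (\<open>T_chain_supermodular\<close>).
  Maxima and minima of paths correspond to minima and maxima of exponents because sublevel sets of
  monotone paths are nested. A translation is a delay, and here it matters that the difference of two recursions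
  is smallest at the starting point \<open>0\<close> (\<open>T_chain_translation_supermodular\<close>).

  The argument is carried out on a time grid of mesh \<open>h\<close>, with a functional \<open>grid_psi\<close> that is defined by the path
  itself. It is Lipschitz in \<open>L\<^sup>1\<close> uniformly in \<open>h\<close>, up to an error of order \<open>h\<close>, and on step paths it approaches the
  recursive definition as \<open>h\<close> tends to zero. This shows at once that the recursive definition does not depend on the
  representation of the path, that the extension by continuity exists, and that the inequality passes to the
  extension.

  The inequality replaces \<open>p, q\<close> by a pair with the same sum and no larger value. With \<open>\<beta>\<close> half the supremum
  of \<open>\<bar>p - q\<bar>\<close>, doing so twice halves that supremum (\<open>fold_twice_halves\<close>). Iteration moves both
  paths to their midpoint, which gives midpoint convexity, and continuity gives convexity.
\<close>

section \<open>Gaussian integrals\<close>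

abbreviation gauss :: "real measure" where
  "gauss \<equiv> std_normal_distribution"

lemma prob_space_gauss: "prob_space gauss"
  by (rule prob_space_normal_density) simp

interpretation gauss: prob_space gauss
  by (rule prob_space_gauss)

text \<open>
  The class in which all Gaussian integrals below are taken: it contains every
  \<open>exp (m * F)\<close> with \<open>F\<close> Lipschitz, is closed under products, and consists of
  integrable functions, so that integrability never has to be argued separately.
\<close>

definition exp_growth :: "(real \<Rightarrow> real) \<Rightarrow> bool" where
  "exp_growth f \<longleftrightarrow> f \<in> borel_measurable borel \<and> (\<exists>C c. \<forall>y. \<bar>f y\<bar> \<le> C * exp (c * \<bar>y\<bar>))"

lemma exp_growth_measurable [measurable_dest]: "exp_growth f \<Longrightarrow> f \<in> borel_measurable borel"
  by (simp add: exp_growth_def)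

lemma exp_growthI:
  "f \<in> borel_measurable borel \<Longrightarrow> (\<And>y. \<bar>f y\<bar> \<le> C * exp (c * \<bar>y\<bar>)) \<Longrightarrow> exp_growth f"
  by (auto simp: exp_growth_def)

lemma exp_growthE:
  assumes "exp_growth f"
  obtains C c where "C \<ge> 0" "c \<ge> 0" "\<And>y. \<bar>f y\<bar> \<le> C * exp (c * \<bar>y\<bar>)"
proof -
  obtain C c where *: "\<And>y. \<bar>f y\<bar> \<le> C * exp (c * \<bar>y\<bar>)"
    using assms by (auto simp: exp_growth_def)
  show ?thesis
  proof (rule that[of "\<bar>C\<bar>" "\<bar>c\<bar>"])
    fix y
    have "\<bar>f y\<bar> \<le> C * exp (c * \<bar>y\<bar>)" by (rule *)
    also have "\<dots> \<le> \<bar>C\<bar> * exp (\<bar>c\<bar> * \<bar>y\<bar>)"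
      by (intro mult_mono) (auto intro: mult_right_mono)
    finally show "\<bar>f y\<bar> \<le> \<bar>C\<bar> * exp (\<bar>c\<bar> * \<bar>y\<bar>)" .
  qed auto
qed

lemma exp_growth_const [intro]: "exp_growth (\<lambda>_. c)"
  by (rule exp_growthI[of _ "\<bar>c\<bar>" 0]) auto

lemma exp_growth_add [intro]:
  assumes "exp_growth f" "exp_growth g"
  shows "exp_growth (\<lambda>x. f x + g x)"
proof -
  obtain C c D d where b: "C \<ge> 0" "c \<ge> 0" "\<And>y. \<bar>f y\<bar> \<le> C * exp (c * \<bar>y\<bar>)"
     "D \<ge> 0" "d \<ge> 0" "\<And>y. \<bar>g y\<bar> \<le> D * exp (d * \<bar>y\<bar>)"
    using assms by (meson exp_growthE)
  have [measurable]: "f \<in> borel_measurable borel" "g \<in> borel_measurable borel"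
    using assms by (auto simp: exp_growth_def)
  show ?thesis
  proof (rule exp_growthI[of _ "C + D" "max c d"])
    fix y
    have "\<bar>f y + g y\<bar> \<le> C * exp (c * \<bar>y\<bar>) + D * exp (d * \<bar>y\<bar>)"
      using b(3)[of y] b(6)[of y] by linarith
    also have "\<dots> \<le> C * exp (max c d * \<bar>y\<bar>) + D * exp (max c d * \<bar>y\<bar>)"
      using b by (intro add_mono mult_left_mono) (auto intro: mult_right_mono)
    finally show "\<bar>f y + g y\<bar> \<le> (C + D) * exp (max c d * \<bar>y\<bar>)" by (simp add: algebra_simps)
  qed auto
qed

lemma exp_growth_mult [intro]:
  assumes "exp_growth f" "exp_growth g"
  shows "exp_growth (\<lambda>x. f x * g x)"
proof -
  obtain C c D d where b: "C \<ge> 0" "c \<ge> 0" "\<And>y. \<bar>f y\<bar> \<le> C * exp (c * \<bar>y\<bar>)"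
     "D \<ge> 0" "d \<ge> 0" "\<And>y. \<bar>g y\<bar> \<le> D * exp (d * \<bar>y\<bar>)"
    using assms by (meson exp_growthE)
  have [measurable]: "f \<in> borel_measurable borel" "g \<in> borel_measurable borel"
    using assms by (auto simp: exp_growth_def)
  show ?thesis
  proof (rule exp_growthI[of _ "C * D" "c + d"])
    fix y
    have "\<bar>f y * g y\<bar> \<le> (C * exp (c * \<bar>y\<bar>)) * (D * exp (d * \<bar>y\<bar>))"
      unfolding abs_mult by (intro mult_mono b) (use b in auto)
    also have "\<dots> = C * D * exp ((c + d) * \<bar>y\<bar>)" by (simp add: exp_add algebra_simps)
    finally show "\<bar>f y * g y\<bar> \<le> C * D * exp ((c + d) * \<bar>y\<bar>)" .
  qed auto
qed

lemma exp_growth_minus [intro]: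
  "exp_growth f \<Longrightarrow> exp_growth (\<lambda>x. - f x)"
  using exp_growth_mult[OF exp_growth_const[of "-1"], of f] by simp

lemma exp_growth_diff [intro]:
  "exp_growth f \<Longrightarrow> exp_growth g \<Longrightarrow> exp_growth (\<lambda>x. f x - g x)"
  using exp_growth_add[of f "\<lambda>x. - g x"] exp_growth_minus[of g] by simp

lemma exp_growth_affine:
  assumes "exp_growth f"
  shows "exp_growth (\<lambda>z. f (x + s * z))"
proof -
  obtain C c where b: "C \<ge> 0" "c \<ge> 0" "\<And>y. \<bar>f y\<bar> \<le> C * exp (c * \<bar>y\<bar>)"
    using assms by (meson exp_growthE)
  have [measurable]: "f \<in> borel_measurable borel"
    using assms by (auto simp: exp_growth_def)
  show ?thesis
  proof (rule exp_growthI[of _ "C * exp (c * \<bar>x\<bar>)" "c * \<bar>s\<bar>"])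
    fix z
    have "\<bar>f (x + s * z)\<bar> \<le> C * exp (c * \<bar>x + s * z\<bar>)" by (rule b)
    also have "\<dots> \<le> C * exp (c * (\<bar>x\<bar> + \<bar>s\<bar> * \<bar>z\<bar>))"
      using b abs_triangle_ineq[of x "s * z"] by (auto simp: abs_mult intro!: mult_left_mono)
    finally show "\<bar>f (x + s * z)\<bar> \<le> C * exp (c * \<bar>x\<bar>) * exp (c * \<bar>s\<bar> * \<bar>z\<bar>)"
      by (simp add: exp_add algebra_simps)
  qed auto
qed

lemma exp_growth_scale: "exp_growth f \<Longrightarrow> exp_growth (\<lambda>z. f (s * z))"
  using exp_growth_affine[of f 0 s] by simp

lemma exp_growth_exp [intro]: "exp_growth (\<lambda>z. exp (c * z))"
  by (rule exp_growthI[of _ 1 "\<bar>c\<bar>"]) (auto simp flip: abs_mult)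

lemma exp_growth_exp_abs [intro]: "exp_growth (\<lambda>z. exp (c * \<bar>z\<bar>))"
  by (rule exp_growthI[of _ 1 "c"]) (auto simp flip: abs_mult)

lemma exp_growth_cosh [intro]: "exp_growth (\<lambda>z. cosh (c * z))"
proof -
  have "exp_growth (\<lambda>z. (1/2) * (exp (c * z) + exp ((-c) * z)))"
    by (intro exp_growth_mult exp_growth_add exp_growth_const exp_growth_exp)
  then show ?thesis by (simp add: cosh_def)
qed

lemma exp_growth_bounded:
  assumes "f \<in> borel_measurable borel" "\<And>x. \<bar>f x\<bar> \<le> B"
  shows "exp_growth f"
  using assms by (intro exp_growthI[of _ B 0]) auto

lemma exp_growth_abs_id: "exp_growth (\<lambda>z. \<bar>z\<bar>)"
proof (rule exp_growthI[of _ 1 1])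
  fix y :: real
  show "\<bar>\<bar>y\<bar>\<bar> \<le> 1 * exp (1 * \<bar>y\<bar>)" using exp_ge_add_one_self[of "\<bar>y\<bar>"] unfolding mult_1 abs_abs by linarith
qed simp

text \<open>Completing the square; this is the Cameron--Martin formula at the level of densities.\<close>

lemma normal_density_shift:
  "std_normal_density (z - c) = exp (- (c\<^sup>2 / 2)) * (std_normal_density z * exp (c * z))"
proof -
  have "- (z - c)\<^sup>2 / 2 = - (c\<^sup>2 / 2) + (- z\<^sup>2 / 2 + c * z)"
    by (simp add: power2_eq_square field_simps)
  then have "exp (- (z - c)\<^sup>2 / 2) = exp (- (c\<^sup>2 / 2)) * (exp (- z\<^sup>2 / 2) * exp (c * z))"
    by (simp only: exp_add)
  then show ?thesis by (simp add: normal_density_def)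
qed

lemma integrable_gauss_iff:
  fixes f :: "real \<Rightarrow> real"
  assumes [measurable]: "f \<in> borel_measurable borel"
  shows "integrable gauss f \<longleftrightarrow> integrable lborel (\<lambda>z. std_normal_density z * f z)"
  by (subst integrable_density) auto

lemma integral_gauss_eq:
  fixes f :: "real \<Rightarrow> real"
  assumes [measurable]: "f \<in> borel_measurable borel"
  shows "(LINT z|gauss. f z) = (LINT z|lborel. std_normal_density z * f z)"
  by (subst integral_density) auto

lemma integrable_gauss_exp: "integrable gauss (\<lambda>z. exp (c * z))"
proof -
  have "integrable lborel (\<lambda>z. std_normal_density (- c + 1 * z))"
    by (rule lborel_integrable_real_affine) auto
  then have "integrable lborel (\<lambda>z. std_normal_density (z - c))" by simp
  then have "integrable lborel (\<lambda>z. exp (c\<^sup>2 / 2) * std_normal_density (z - c))"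
    by (rule integrable_mult_right)
  also have "(\<lambda>z. exp (c\<^sup>2 / 2) * std_normal_density (z - c)) = (\<lambda>z. std_normal_density z * exp (c * z))"
    unfolding normal_density_shift by (simp add: exp_minus field_simps)
  finally show ?thesis by (simp add: integrable_gauss_iff)
qed

lemma integrable_gauss_exp_growth [intro]:
  assumes "exp_growth f"
  shows "integrable gauss f"
proof -
  obtain C c where b: "C \<ge> 0" "c \<ge> 0" "\<And>y. \<bar>f y\<bar> \<le> C * exp (c * \<bar>y\<bar>)"
    using assms by (meson exp_growthE)
  have [measurable]: "f \<in> borel_measurable borel"
    using assms by (auto simp: exp_growth_def)
  have "integrable gauss (\<lambda>z. C * (exp (c * z) + exp ((-c) * z)))"
    by (intro integrable_mult_right Bochner_Integration.integrable_add integrable_gauss_exp)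
  then show ?thesis
  proof (rule Bochner_Integration.integrable_bound)
    have "\<bar>f z\<bar> \<le> \<bar>C * (exp (c * z) + exp ((-c) * z))\<bar>" for z
    proof -
      have "exp (c * \<bar>z\<bar>) \<le> exp (c * z) + exp ((-c) * z)"
        by (cases "z \<ge> 0") auto
      then have "C * exp (c * \<bar>z\<bar>) \<le> C * (exp (c * z) + exp ((-c) * z))"
        using b by (intro mult_left_mono) auto
      with b(3)[of z] show ?thesis by linarith
    qed
    then show "AE x in gauss. norm (f x) \<le> norm (C * (exp (c * x) + exp ((-c) * x)))" by auto
  qed simp
qed

lemma cameron_martin:
  fixes f :: "real \<Rightarrow> real"
  assumes f[measurable]: "f \<in> borel_measurable borel"
  shows "(LINT z|gauss. f (z + c)) = exp (- (c\<^sup>2 / 2)) * (LINT z|gauss. exp (c * z) * f z)"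
proof -
  have "(LINT z|gauss. f (z + c)) = (LINT z|lborel. std_normal_density z * f (z + c))"
    by (rule integral_gauss_eq) simp
  also have "\<dots> = \<bar>1\<bar> *\<^sub>R (LINT z|lborel. std_normal_density (- c + 1 * z) * f (- c + 1 * z + c))"
    by (rule lborel_integral_real_affine) simp
  also have "\<dots> = (LINT z|lborel. std_normal_density (z - c) * f z)"
    by simp
  also have "\<dots> = (LINT z|lborel. exp (- (c\<^sup>2 / 2)) * (std_normal_density z * (exp (c * z) * f z)))"
    unfolding normal_density_shift by (simp add: algebra_simps)
  also have "\<dots> = exp (- (c\<^sup>2 / 2)) * (LINT z|lborel. std_normal_density z * (exp (c * z) * f z))"
    by (rule integral_mult_right_zero)
  also have "(LINT z|lborel. std_normal_density z * (exp (c * z) * f z)) = (LINT z|gauss. exp (c * z) * f z)"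
    by (rule integral_gauss_eq[symmetric]) simp
  finally show ?thesis .
qed

lemma gauss_symmetric:
  fixes f :: "real \<Rightarrow> real"
  assumes f[measurable]: "f \<in> borel_measurable borel"
  shows "(LINT z|gauss. f (- z)) = (LINT z|gauss. f z)"
proof -
  have "(LINT z|gauss. f z) = (LINT z|lborel. std_normal_density z * f z)"
    by (rule integral_gauss_eq) simp
  also have "\<dots> = \<bar>-1\<bar> *\<^sub>R (LINT z|lborel. std_normal_density (0 + -1 * z) * f (0 + -1 * z))"
    by (rule lborel_integral_real_affine) simp
  also have "\<dots> = (LINT z|lborel. std_normal_density z * f (-z))"
    by (simp add: normal_density_def)
  also have "\<dots> = (LINT z|gauss. f (- z))"
    by (rule integral_gauss_eq[symmetric]) simp
  finally show ?thesis by simp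
qed

lemma gauss_tilt:
  assumes f: "exp_growth f" and s: "s > 0"
  shows "(LINT z|gauss. f (x + s * z)) =
    exp (- ((x / s)\<^sup>2 / 2)) * (LINT z|gauss. exp (x / s * z) * f (s * z))"
proof -
  have [measurable]: "f \<in> borel_measurable borel" using f by (rule exp_growth_measurable)
  have "(LINT z|gauss. f (x + s * z)) = (LINT z|gauss. (\<lambda>z. f (s * z)) (z + x / s))"
    using s by (simp add: algebra_simps)
  also have "\<dots> = exp (- ((x / s)\<^sup>2 / 2)) * (LINT z|gauss. exp (x / s * z) * f (s * z))"
    by (rule cameron_martin) simp
  finally show ?thesis .
qed

text \<open>
  A Gaussian centred at \<open>x\<close> is the centred one reweighted by \<open>exp (c z)\<close>. Averaging over
  \<open>z\<close> and \<open>- z\<close> turns the weight into \<open>cosh (c z)\<close> for an even integrand, and the reference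
  measure becomes symmetric. It is this form that makes monotonicity in \<open>\<bar>z\<bar>\<close> usable at a starting
  point \<open>x \<noteq> 0\<close>.
\<close>

lemma gauss_tilt_even:
  assumes f: "exp_growth f" and s: "s > 0" and even: "\<And>z. f (- z) = f z"
  shows "(LINT z|gauss. f (x + s * z)) =
    exp (- ((x / s)\<^sup>2 / 2)) * (LINT z|gauss. cosh (x / s * z) * f (s * z))"
proof -
  let ?g = "\<lambda>c z. exp (c * z) * f (s * z)"
  have g: "exp_growth (?g c)" for c
    by (intro exp_growth_mult exp_growth_exp exp_growth_scale f)
  have "(LINT z|gauss. ?g (- (x/s)) z) = (LINT z|gauss. ?g (x/s) (- z))"
    using even by simp
  also have "\<dots> = (LINT z|gauss. ?g (x/s) z)"
    by (rule gauss_symmetric) (rule exp_growth_measurable[OF g])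
  finally have sym: "(LINT z|gauss. ?g (- (x/s)) z) = (LINT z|gauss. ?g (x/s) z)" .
  have "(LINT z|gauss. cosh (x / s * z) * f (s * z)) = (LINT z|gauss. (1/2) * (?g (x/s) z + ?g (-(x/s)) z))"
    by (intro Bochner_Integration.integral_cong) (auto simp: cosh_def algebra_simps)
  also have "\<dots> = (1/2) * ((LINT z|gauss. ?g (x/s) z) + (LINT z|gauss. ?g (-(x/s)) z))"
    by (simp only: integral_mult_right_zero Bochner_Integration.integral_add[OF integrable_gauss_exp_growth[OF g] integrable_gauss_exp_growth[OF g]])
  finally show ?thesis using gauss_tilt[OF f s, of x] sym by simp
qed

text \<open>
  The weight for an odd integrand is \<open>sinh (c z)\<close>, written as \<open>cosh (c z) * tanh (c z)\<close> so that even
  and odd integrands refer to the same tilted measure: under it an odd \<open>f\<close> contributes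
  the even function \<open>tanh (c z) * f\<close>.
\<close>

lemma gauss_tilt_odd:
  assumes f: "exp_growth f" and s: "s > 0" and odd: "\<And>z. f (- z) = - f z"
  shows "(LINT z|gauss. f (x + s * z)) =
    exp (- ((x / s)\<^sup>2 / 2)) * (LINT z|gauss. cosh (x / s * z) * (tanh (x / s * z) * f (s * z)))"
proof -
  let ?g = "\<lambda>c z. exp (c * z) * f (s * z)"
  have g: "exp_growth (?g c)" for c
    by (intro exp_growth_mult exp_growth_exp exp_growth_scale f)
  have "(LINT z|gauss. ?g (- (x/s)) z) = - (LINT z|gauss. ?g (x/s) (- z))"
    using odd by simp
  also have "(LINT z|gauss. ?g (x/s) (- z)) = (LINT z|gauss. ?g (x/s) z)"
    by (rule gauss_symmetric) (rule exp_growth_measurable[OF g])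
  finally have sym: "(LINT z|gauss. ?g (- (x/s)) z) = - (LINT z|gauss. ?g (x/s) z)" .
  have *: "cosh t * (tanh t * v) = (exp t * v - exp (- t) * v) / 2" for t v :: real
  proof -
    have "cosh t * tanh t = sinh t" by (simp add: tanh_def)
    then have "cosh t * (tanh t * v) = sinh t * v" by (simp flip: mult.assoc)
    then show ?thesis by (simp add: sinh_def algebra_simps)
  qed
  have "(LINT z|gauss. cosh (x / s * z) * (tanh (x / s * z) * f (s * z))) = (LINT z|gauss. (1/2) * (?g (x/s) z - ?g (-(x/s)) z))"
    unfolding * by (intro Bochner_Integration.integral_cong) (auto simp: field_simps)
  also have "\<dots> = (1/2) * ((LINT z|gauss. ?g (x/s) z) - (LINT z|gauss. ?g (-(x/s)) z))"
    by (simp only: integral_mult_right_zero Bochner_Integration.integral_diff[OF integrable_gauss_exp_growth[OF g] integrable_gauss_exp_growth[OF g]])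
  finally show ?thesis using gauss_tilt[OF f s, of x] sym by simp
qed

section \<open>Correlation of even monotone functions\<close>

text \<open>
  Integrate \<open>w y * w z * (f y - f z) * (g y - g z) \<ge> 0\<close> in both variables. The two integrations are done
  one after the other, the inner one being explicit, so no product measure is involved.
\<close>

lemma chebyshev_association:
  fixes w f g :: "'a \<Rightarrow> real"
  assumes w: "\<And>z. w z \<ge> 0"
    and co: "\<And>y z. (f y - f z) * (g y - g z) \<ge> 0"
    and int: "integrable M w" "integrable M (\<lambda>z. w z * f z)" "integrable M (\<lambda>z. w z * g z)"
       "integrable M (\<lambda>z. w z * (f z * g z))"
  shows "(LINT z|M. w z * f z) * (LINT z|M. w z * g z) \<le> (LINT z|M. w z) * (LINT z|M. w z * (f z * g z))"
proof -
  define W where "W = (LINT z|M. w z)"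
  define A where "A = (LINT z|M. w z * f z)"
  define B where "B = (LINT z|M. w z * g z)"
  define C where "C = (LINT z|M. w z * (f z * g z))"
  have inner: "0 \<le> f y * g y * W - f y * B - g y * A + C" for y
  proof -
    have "0 \<le> (LINT z|M. w z * ((f y - f z) * (g y - g z)))"
      by (rule Bochner_Integration.integral_nonneg) (use w co in auto)
    also have "\<dots> = (LINT z|M. f y * g y * w z - f y * (w z * g z) - g y * (w z * f z) + w z * (f z * g z))"
      by (intro Bochner_Integration.integral_cong) (auto simp: algebra_simps)
    also have "\<dots> = f y * g y * W - f y * B - g y * A + C"
      unfolding W_def A_def B_def C_def using int by simp
    finally show ?thesis .
  qed
  have "0 \<le> (LINT y|M. w y * (f y * g y * W - f y * B - g y * A + C))"
    by (rule Bochner_Integration.integral_nonneg) (use w inner in auto)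
  also have "\<dots> = (LINT y|M. W * (w y * (f y * g y)) - B * (w y * f y) - A * (w y * g y) + C * w y)"
    by (intro Bochner_Integration.integral_cong) (auto simp: algebra_simps)
  also have "\<dots> = W * C - B * A - A * B + C * W"
    using int by (simp add: W_def[symmetric] A_def[symmetric] B_def[symmetric] C_def[symmetric])
  finally have "A * B \<le> W * C" by (simp add: algebra_simps)
  then show ?thesis unfolding W_def A_def B_def C_def .
qed

text \<open>Any two such functions are comonotone, hence positively correlated under every nonnegative weight.\<close>

definition evmono :: "(real \<Rightarrow> real) \<Rightarrow> bool" where
  "evmono f \<longleftrightarrow> (\<forall>x y. \<bar>x\<bar> \<le> \<bar>y\<bar> \<longrightarrow> f x \<le> f y)"

lemma evmonoD: "evmono f \<Longrightarrow> \<bar>x\<bar> \<le> \<bar>y\<bar> \<Longrightarrow> f x \<le> f y"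
  by (auto simp: evmono_def)

lemma evmono_even: "evmono f \<Longrightarrow> f (- x) = f x"
  using evmonoD[of f x "- x"] evmonoD[of f "- x" x] by simp

lemma evmonoI:
  assumes even: "\<And>x. f (- x) = f x" and mono: "\<And>x y. 0 \<le> x \<Longrightarrow> x \<le> y \<Longrightarrow> f x \<le> f y"
  shows "evmono f"
  unfolding evmono_def
proof (intro allI impI)
  fix x y :: real assume "\<bar>x\<bar> \<le> \<bar>y\<bar>"
  then have "f \<bar>x\<bar> \<le> f \<bar>y\<bar>" by (intro mono) auto
  then show "f x \<le> f y" using even by (metis abs_if)
qed

lemma evmono_scale: "evmono f \<Longrightarrow> evmono (\<lambda>z. f (s * z))"
  unfolding evmono_def by (auto simp: abs_mult mult_left_mono)

lemma evmono_comonotone: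
  assumes "evmono f" "evmono g"
  shows "(f y - f z) * (g y - g z) \<ge> 0"
proof (cases "\<bar>y\<bar> \<le> \<bar>z\<bar>")
  case True
  then show ?thesis using assms evmonoD[of f y z] evmonoD[of g y z] by (simp add: mult_nonpos_nonpos)
next
  case False
  then show ?thesis using assms evmonoD[of f z y] evmonoD[of g z y] by simp
qed

lemma evmono_exp: "evmono f \<Longrightarrow> evmono (\<lambda>z. exp (f z))"
  unfolding evmono_def by auto

lemma evmono_chebyshev:
  assumes "\<And>z. w z \<ge> 0" "evmono f" "evmono g" "exp_growth w" "exp_growth f" "exp_growth g"
  shows "(LINT z|gauss. w z * f z) * (LINT z|gauss. w z * g z)
      \<le> (LINT z|gauss. w z) * (LINT z|gauss. w z * (f z * g z))"
  by (intro chebyshev_association assms evmono_comonotone integrable_gauss_exp_growth exp_growth_mult)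

lemma gauss_integral_pos:
  assumes "exp_growth f" "\<And>z. f z > 0"
  shows "(LINT z|gauss. f z) > 0"
proof -
  have int: "integrable gauss f" using assms by auto
  have "(LINT z|gauss. f z) \<noteq> 0"
  proof
    assume "(LINT z|gauss. f z) = 0"
    then have "AE z in gauss. f z = 0"
      using integral_nonneg_eq_0_iff_AE[OF int] assms(2) by (simp add: less_imp_le)
    then have "AE z in gauss. False"
      by eventually_elim (metis assms(2) less_irrefl)
    then show False by simp
  qed
  moreover have "(LINT z|gauss. f z) \<ge> 0"
    using assms(2) by (intro Bochner_Integration.integral_nonneg) (simp add: less_imp_le)
  ultimately show ?thesis by linarith
qed

section \<open>Even convex functions\<close>

text \<open>
  The functions met along the Parisi recursion: even, convex, \<open>C\<^sup>1\<close> and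
  \<open>1\<close>-Lipschitz. Convexity is kept in the form of a monotone derivative because the order
  between members is tracked through their derivatives on the positive half line.
\<close>

definition tame :: "(real \<Rightarrow> real) \<Rightarrow> bool" where
  "tame F \<longleftrightarrow> (\<forall>x. F (- x) = F x) \<and> (\<forall>x. (F has_real_derivative deriv F x) (at x)) \<and>
     mono (deriv F) \<and> (\<forall>x. \<bar>deriv F x\<bar> \<le> 1)"

lemma tameD:
  assumes "tame F"
  shows tame_even: "F (- x) = F x"
    and tame_deriv: "(F has_real_derivative deriv F x) (at x)"
    and tame_mono: "x \<le> y \<Longrightarrow> deriv F x \<le> deriv F y"
    and tame_bound: "\<bar>deriv F x\<bar> \<le> 1"
  using assms by (auto simp: tame_def mono_def)

lemma tame_lipschitz:
  assumes "tame F"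
  shows "\<bar>F x - F y\<bar> \<le> \<bar>x - y\<bar>"
  using field_differentiable_bound[of UNIV F "deriv F" 1 x y] tameD[OF assms] by auto

lemma tame_measurable:
  assumes "tame F"
  shows "F \<in> borel_measurable borel"
proof (rule borel_measurable_continuous_onI)
  show "continuous_on UNIV F"
    using tame_deriv[OF assms] by (meson DERIV_isCont continuous_at_imp_continuous_on)
qed

lemma tame_deriv_measurable: "tame F \<Longrightarrow> deriv F \<in> borel_measurable borel"
  by (intro borel_measurable_mono) (simp add: tame_def)

lemma even_imp_deriv_odd:
  assumes even: "\<And>x. F (- x) = F x" and d: "\<And>x. (F has_real_derivative F' x) (at x)"
  shows "F' (- x) = - F' x"
proof -
  have "((\<lambda>x. F (- x)) has_real_derivative F' (- x) * (- 1)) (at x)"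
    by (rule DERIV_chain2[where g = "\<lambda>x. - x"]) (auto intro!: d derivative_eq_intros)
  then have "(F has_real_derivative - F' (- x)) (at x)"
    by (simp add: even)
  from DERIV_unique[OF this d] show ?thesis by simp
qed

lemma tame_deriv_odd: "tame F \<Longrightarrow> deriv F (- x) = - deriv F x"
  using even_imp_deriv_odd[of F "deriv F" x] tame_even[of F] tame_deriv[of F] by blast

lemma tame_deriv_nonneg: "tame F \<Longrightarrow> 0 \<le> x \<Longrightarrow> 0 \<le> deriv F x"
  using tame_mono[of F "- x" x] tame_deriv_odd[of F x] by auto

text \<open>The mean value theorem on the positive half line; evenness does the rest.\<close>

lemma evmono_lincomb:
  assumes "tame G" "tame H" "\<And>y. 0 \<le> y \<Longrightarrow> a * deriv G y \<le> b * deriv H y"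
  shows "evmono (\<lambda>y. b * H y - a * G y)"
proof (rule evmonoI)
  show "b * H (- x) - a * G (- x) = b * H x - a * G x" for x
    using assms by (simp add: tame_even)
  fix x y :: real assume xy: "0 \<le> x" "x \<le> y"
  show "b * H x - a * G x \<le> b * H y - a * G y"
  proof (rule DERIV_nonneg_imp_nondecreasing[OF xy(2)])
    fix z assume "x \<le> z" "z \<le> y"
    then show "\<exists>D. ((\<lambda>y. b * H y - a * G y) has_real_derivative D) (at z) \<and> 0 \<le> D"
      using xy assms(3)[of z]
      by (intro exI[of _ "b * deriv H z - a * deriv G z"] conjI)
         (auto intro!: DERIV_diff DERIV_cmult tame_deriv assms)
  qed
qed

lemma evmono_diff:
  assumes "tame G" "tame H" "\<And>y. 0 \<le> y \<Longrightarrow> deriv G y \<le> deriv H y"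
  shows "evmono (\<lambda>y. H y - G y)"
  using evmono_lincomb[of G H 1 1] assms by simp

lemma tame_exp_growth:
  assumes "tame F"
  shows "exp_growth F"
proof (rule exp_growthI[of _ "\<bar>F 0\<bar> + 1" 1])
  show "F \<in> borel_measurable borel" by (rule tame_measurable) fact
  fix y
  have "\<bar>F y\<bar> \<le> \<bar>F 0\<bar> + \<bar>y\<bar>" using tame_lipschitz[OF assms, of y 0] by auto
  also have "\<dots> \<le> \<bar>F 0\<bar> * exp \<bar>y\<bar> + 1 * exp \<bar>y\<bar>"
  proof (rule add_mono)
    show "\<bar>F 0\<bar> \<le> \<bar>F 0\<bar> * exp \<bar>y\<bar>"
      using mult_left_mono[of 1 "exp \<bar>y\<bar>" "\<bar>F 0\<bar>"] by simp
    show "\<bar>y\<bar> \<le> 1 * exp \<bar>y\<bar>"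
      using exp_ge_add_one_self[of "\<bar>y\<bar>"] unfolding mult_1 by linarith
  qed
  finally show "\<bar>F y\<bar> \<le> (\<bar>F 0\<bar> + 1) * exp (1 * \<bar>y\<bar>)" by (simp add: algebra_simps)
qed

lemma exp_growth_exp_tame:
  assumes "tame F"
  shows "exp_growth (\<lambda>y. exp (m * F y))"
proof (rule exp_growthI[of _ "exp (\<bar>m\<bar> * \<bar>F 0\<bar>)" "\<bar>m\<bar>"])
  have [measurable]: "F \<in> borel_measurable borel" by (rule tame_measurable) fact
  show "(\<lambda>y. exp (m * F y)) \<in> borel_measurable borel" by measurable
  fix y
  have "m * F y \<le> \<bar>m\<bar> * \<bar>F y\<bar>" by (metis abs_ge_self abs_mult)
  also have "\<dots> \<le> \<bar>m\<bar> * (\<bar>F 0\<bar> + \<bar>y\<bar>)"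
    using tame_lipschitz[OF assms, of y 0] by (intro mult_left_mono) auto
  finally show "\<bar>exp (m * F y)\<bar> \<le> exp (\<bar>m\<bar> * \<bar>F 0\<bar>) * exp (\<bar>m\<bar> * \<bar>y\<bar>)"
    by (simp add: algebra_simps flip: exp_add)
qed

lemma exp_growth_deriv_tame: "tame F \<Longrightarrow> exp_growth (deriv F)"
  by (rule exp_growth_bounded[of _ 1]) (auto intro: tame_deriv_measurable tame_bound)

text \<open>Dominated convergence of difference quotients, the domination coming from the mean value bound.\<close>

lemma gauss_integral_has_derivative:
  fixes f f' :: "real \<Rightarrow> real"
  assumes d: "\<And>y. (f has_real_derivative f' y) (at y)" and f: "exp_growth f" and f': "exp_growth f'"
  shows "((\<lambda>x. LINT z|gauss. f (x + s * z)) has_real_derivative (LINT z|gauss. f' (x + s * z))) (at x)"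
proof -
  have [measurable]: "f \<in> borel_measurable borel" "f' \<in> borel_measurable borel"
    using f f' by (auto intro: exp_growth_measurable)
  obtain C c where b: "C \<ge> 0" "c \<ge> 0" "\<And>y. \<bar>f' y\<bar> \<le> C * exp (c * \<bar>y\<bar>)"
    using f' by (meson exp_growthE)
  let ?I = "\<lambda>x. LINT z|gauss. f (x + s * z)"
  have int: "integrable gauss (\<lambda>z. f (x + s * z))" for x
    by (intro integrable_gauss_exp_growth exp_growth_affine f)
  have "((\<lambda>h. (?I (x + h) - ?I x) / h) \<longlongrightarrow> (LINT z|gauss. f' (x + s * z))) (at 0)"
    unfolding tendsto_at_iff_sequentially o_def
  proof (intro allI impI)
    fix h :: "nat \<Rightarrow> real"
    assume nz: "\<forall>i. h i \<in> UNIV - {0}" and lim: "h \<longlonglongrightarrow> 0"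
    obtain B where B: "\<And>i. \<bar>h i\<bar> \<le> B"
      using convergent_imp_Bseq[of h] lim by (auto simp: convergent_def Bseq_def)
    define q where "q i z = (f (x + h i + s * z) - f (x + s * z)) / h i" for i z
    have eq: "(?I (x + h i) - ?I x) / h i = (LINT z|gauss. q i z)" for i
      unfolding q_def using int[of x] int[of "x + h i"] by simp
    have "(\<lambda>i. LINT z|gauss. q i z) \<longlonglongrightarrow> (LINT z|gauss. f' (x + s * z))"
    proof (rule integral_dominated_convergence)
      show "integrable gauss (\<lambda>z. C * exp (c * (\<bar>x\<bar> + B)) * exp (c * \<bar>s\<bar> * \<bar>z\<bar>))"
        by (intro integrable_gauss_exp_growth exp_growth_mult exp_growth_const exp_growth_exp_abs)
      show "AE z in gauss. (\<lambda>i. q i z) \<longlonglongrightarrow> f' (x + s * z)"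
      proof (rule AE_I2)
        fix z
        have "((\<lambda>h. (f (x + s * z + h) - f (x + s * z)) / h) \<longlongrightarrow> f' (x + s * z)) (at 0)"
          using d[of "x + s * z"] by (simp add: DERIV_def)
        then have "((\<lambda>h. (f (x + s * z + h) - f (x + s * z)) / h) \<circ> h) \<longlonglongrightarrow> f' (x + s * z)"
          using nz lim unfolding tendsto_at_iff_sequentially by blast
        then show "(\<lambda>i. q i z) \<longlonglongrightarrow> f' (x + s * z)"
          by (simp add: q_def o_def algebra_simps)
      qed
      show "AE z in gauss. norm (q i z) \<le> C * exp (c * (\<bar>x\<bar> + B)) * exp (c * \<bar>s\<bar> * \<bar>z\<bar>)" for i
      proof (rule AE_I2)
        fix z
        let ?K = "C * exp (c * (\<bar>x\<bar> + B)) * exp (c * \<bar>s\<bar> * \<bar>z\<bar>)"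
        let ?y = "x + s * z"
        have "norm (f (?y + h i) - f ?y) \<le> ?K * norm (?y + h i - ?y)"
        proof (rule field_differentiable_bound[of "{?y - B..?y + B}" f f'])
          show "norm (f' w) \<le> ?K" if "w \<in> {?y - B..?y + B}" for w
          proof -
            have "\<bar>w\<bar> \<le> \<bar>?y\<bar> + B" using that by auto
            also have "\<bar>?y\<bar> \<le> \<bar>x\<bar> + \<bar>s\<bar> * \<bar>z\<bar>"
              using abs_triangle_ineq[of x "s * z"] by (simp add: abs_mult)
            finally have w: "\<bar>w\<bar> \<le> \<bar>x\<bar> + B + \<bar>s\<bar> * \<bar>z\<bar>" by simp
            have "\<bar>f' w\<bar> \<le> C * exp (c * \<bar>w\<bar>)" by (rule b)
            also have "\<dots> \<le> C * exp (c * (\<bar>x\<bar> + B + \<bar>s\<bar> * \<bar>z\<bar>))"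
              using b w by (intro mult_left_mono) (auto intro: mult_left_mono)
            also have "\<dots> = ?K" by (simp add: exp_add algebra_simps)
            finally show ?thesis by simp
          qed
          show "?y + h i \<in> {?y - B..?y + B}" using B[of i] by (auto simp: abs_le_iff)
          show "?y \<in> {?y - B..?y + B}" using B[of i] by auto
        qed (auto intro: DERIV_subset d)
        then have "norm (f (?y + h i) - f ?y) / \<bar>h i\<bar> \<le> ?K"
          using nz by (simp add: divide_le_eq)
        then show "norm (q i z) \<le> ?K"
          by (simp add: q_def algebra_simps)
      qed
    qed (auto simp: q_def)
    then show "(\<lambda>i. (?I (x + h i) - ?I x) / h i) \<longlonglongrightarrow> (LINT z|gauss. f' (x + s * z))"
      unfolding eq .
  qed
  then show ?thesis by (simp add: DERIV_def)
qed

section \<open>The Parisi operator and its derivative\<close>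

text \<open>The heat semigroup, indexed by the standard deviation.\<close>

definition gmean :: "real \<Rightarrow> (real \<Rightarrow> real) \<Rightarrow> real \<Rightarrow> real" where
  "gmean s f x = (LINT z|gauss. f (x + s * z))"

lemma prob_gauss_UNIV [simp]: "gauss.prob UNIV = 1"
  using gauss.prob_space by simp

lemma gmean_const [simp]: "gmean s (\<lambda>_. c) x = c"
  by (simp add: gmean_def)

lemma gmean_0 [simp]: "gmean 0 f x = f x"
  by (simp add: gmean_def)

lemma gmean_integrable: "exp_growth f \<Longrightarrow> integrable gauss (\<lambda>z. f (x + s * z))"
  by (intro integrable_gauss_exp_growth exp_growth_affine)

lemma gmean_add: "exp_growth f \<Longrightarrow> exp_growth g \<Longrightarrow> gmean s (\<lambda>y. f y + g y) x = gmean s f x + gmean s g x"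
  unfolding gmean_def by (intro Bochner_Integration.integral_add gmean_integrable)

lemma gmean_diff: "exp_growth f \<Longrightarrow> exp_growth g \<Longrightarrow> gmean s (\<lambda>y. f y - g y) x = gmean s f x - gmean s g x"
  unfolding gmean_def by (intro Bochner_Integration.integral_diff gmean_integrable)

lemma gmean_cmult: "gmean s (\<lambda>y. c * f y) x = c * gmean s f x"
  unfolding gmean_def by simp

lemma gmean_mono:
  assumes "exp_growth f" "exp_growth g" "\<And>y. f y \<le> g y"
  shows "gmean s f x \<le> gmean s g x"
  unfolding gmean_def using assms by (intro integral_mono gmean_integrable) auto

lemma gmean_pos: "exp_growth f \<Longrightarrow> (\<And>y. f y > 0) \<Longrightarrow> gmean s f x > 0"
  unfolding gmean_def by (rule gauss_integral_pos[OF exp_growth_affine]) auto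

lemma gmean_even:
  assumes "exp_growth f" "\<And>y. f (- y) = f y"
  shows "gmean s f (- x) = gmean s f x"
proof -
  have "gmean s f (- x) = (LINT z|gauss. f (x + s * (- z)))"
    unfolding gmean_def
  proof (intro Bochner_Integration.integral_cong refl)
    show "f (- x + s * z) = f (x + s * (- z))" for z
      using assms(2)[of "x + s * (- z)"] by (simp add: algebra_simps)
  qed
  also have "\<dots> = (LINT z|gauss. f (x + s * z))"
    by (rule gauss_symmetric[where f = "\<lambda>z. f (x + s * z)"]) (intro exp_growth_measurable exp_growth_affine assms)
  finally show ?thesis by (simp add: gmean_def)
qed

lemma T_op_eq:
  assumes "F \<in> borel_measurable borel"
  shows "T_op m t F x = (if m = 0 then gmean (sqrt (2 * t)) F x
     else (1 / m) * ln (gmean (sqrt (2 * t)) (\<lambda>y. exp (m * F y)) x))"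
proof -
  have [measurable]: "F \<in> borel_measurable borel" by fact
  have "(LINT y|brownian_law (2 * t). f (x + y)) = gmean (sqrt (2 * t)) f x"
    if [measurable]: "f \<in> borel_measurable borel" for f :: "real \<Rightarrow> real"
    unfolding brownian_law_def gmean_def by (subst integral_distr) auto
  from this[of F] this[of "\<lambda>y. exp (m * F y)"] show ?thesis
    by (simp add: T_op_def)
qed

lemma T_op_0: "tame F \<Longrightarrow> T_op 0 t F x = gmean (sqrt (2 * t)) F x"
  by (simp add: T_op_eq tame_measurable)

lemma T_op_pos:
  "tame F \<Longrightarrow> m \<noteq> 0 \<Longrightarrow> T_op m t F x = (1 / m) * ln (gmean (sqrt (2 * t)) (\<lambda>y. exp (m * F y)) x)"
  by (simp add: T_op_eq tame_measurable)

lemma exp_T_op: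
  "tame F \<Longrightarrow> m \<noteq> 0 \<Longrightarrow> exp (m * T_op m t F x) = gmean (sqrt (2 * t)) (\<lambda>y. exp (m * F y)) x"
  by (simp add: T_op_pos gmean_pos exp_growth_exp_tame)

lemma T_op_refl: "tame F \<Longrightarrow> T_op m 0 F = F"
  by (rule ext) (simp add: T_op_eq tame_measurable)

text \<open>
  The derivative of \<open>T_op m t F\<close> is the mean of \<open>F'\<close> under the Gaussian at \<open>x\<close> tilted by \<open>exp (m * F)\<close>.
  The formula also covers \<open>m = 0\<close>.
\<close>

definition tilted_slope :: "real \<Rightarrow> real \<Rightarrow> (real \<Rightarrow> real) \<Rightarrow> real \<Rightarrow> real" where
  "tilted_slope s m F x = gmean s (\<lambda>y. exp (m * F y) * deriv F y) x / gmean s (\<lambda>y. exp (m * F y)) x"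

lemma T_op_has_derivative:
  assumes F: "tame F"
  shows "(T_op m t F has_real_derivative tilted_slope (sqrt (2 * t)) m F x) (at x)"
proof (cases "m = 0")
  case True
  have "(gmean (sqrt (2 * t)) F has_real_derivative gmean (sqrt (2 * t)) (deriv F) x) (at x)"
    unfolding gmean_def
    by (rule gauss_integral_has_derivative) (auto intro: tame_deriv tame_exp_growth exp_growth_deriv_tame F)
  moreover have "T_op m t F = gmean (sqrt (2 * t)) F"
    using True F by (auto simp: T_op_0)
  ultimately show ?thesis using True by (simp add: tilted_slope_def)
next
  case False
  let ?s = "sqrt (2 * t)"
  let ?e = "\<lambda>y. exp (m * F y)"
  have d: "(?e has_real_derivative m * (exp (m * F y) * deriv F y)) (at y)" for y
    by (rule derivative_eq_intros tame_deriv[OF F] refl)+ simp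
  have g: "(gmean ?s ?e has_real_derivative gmean ?s (\<lambda>y. m * (exp (m * F y) * deriv F y)) x) (at x)"
    unfolding gmean_def
    by (rule gauss_integral_has_derivative[OF d])
       (intro exp_growth_mult exp_growth_const exp_growth_exp_tame exp_growth_deriv_tame F)+
  have pos: "gmean ?s ?e x > 0" for x
    by (intro gmean_pos exp_growth_exp_tame F) auto
  have "((\<lambda>x. (1 / m) * ln (gmean ?s ?e x)) has_real_derivative
      (1 / m) * (1 / gmean ?s ?e x * gmean ?s (\<lambda>y. m * (exp (m * F y) * deriv F y)) x)) (at x)"
    by (intro DERIV_cmult DERIV_chain2[OF DERIV_ln_divide[OF pos] g])
  moreover have "T_op m t F = (\<lambda>x. (1 / m) * ln (gmean ?s ?e x))"
    using False F by (auto simp: T_op_pos)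
  ultimately show ?thesis using False by (simp add: tilted_slope_def gmean_cmult)
qed

text \<open>
  The likelihood ratio \<open>cosh (c' z) / cosh (c z)\<close> increases in \<open>\<bar>z\<bar>\<close>: the law of \<open>\<bar>x + s Z\<bar>\<close> is
  stochastically increasing in \<open>\<bar>x\<bar>\<close>.
\<close>

lemma cosh_mult_mono:
  fixes c c' y z :: real
  assumes "0 \<le> c" "c \<le> c'" "0 \<le> y" "y \<le> z"
  shows "cosh (c' * y) * cosh (c * z) \<le> cosh (c' * z) * cosh (c * y)"
proof -
  have prod: "cosh a * cosh b = (cosh (a + b) + cosh (a - b)) / 2" for a b :: real
    by (simp add: cosh_add cosh_diff)
  have mono: "cosh a \<le> cosh b" if "\<bar>a\<bar> \<le> \<bar>b\<bar>" for a b :: real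
    using cosh_real_nonneg_le_iff[of "\<bar>a\<bar>" "\<bar>b\<bar>"] that by simp
  have 0: "0 \<le> c' * y" "0 \<le> c' * z" "0 \<le> c * y" "0 \<le> c * z" using assms by auto
  have 1: "0 \<le> (c' - c) * (z - y)" "0 \<le> (c' + c) * (z - y)" "0 \<le> (c' - c) * (z + y)"
    using assms by auto
  have "cosh (c' * y + c * z) \<le> cosh (c' * z + c * y)"
    using 0 1 by (intro mono) (auto simp: algebra_simps)
  moreover have "cosh (c' * y - c * z) \<le> cosh (c' * z - c * y)"
    using 0 1 by (intro mono) (auto simp: algebra_simps abs_if)
  ultimately show ?thesis by (simp add: prod)
qed

text \<open>
  As \<open>F'\<close> is odd, the tilted slope is the mean of the even function \<open>tanh (c z) * F'\<close>, nondecreasing in \<open>\<bar>z\<bar>\<close>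
  when \<open>F\<close> is convex, under the symmetric weight \<open>cosh (c z) * exp (m * F)\<close>.
\<close>

lemma tilted_slope_centred:
  assumes F: "tame F" and s: "s > 0"
  shows "tilted_slope s m F x =
    (LINT z|gauss. (cosh (x / s * z) * exp (m * F (s * z))) * (tanh (x / s * z) * deriv F (s * z)))
     / (LINT z|gauss. cosh (x / s * z) * exp (m * F (s * z)))"
proof -
  have "gmean s (\<lambda>y. exp (m * F y) * deriv F y) x = exp (- ((x / s)\<^sup>2 / 2)) *
      (LINT z|gauss. cosh (x / s * z) * (tanh (x / s * z) * (exp (m * F (s * z)) * deriv F (s * z))))"
    unfolding gmean_def using F
    by (intro gauss_tilt_odd exp_growth_mult exp_growth_exp_tame exp_growth_deriv_tame s)
       (simp_all add: tame_even tame_deriv_odd)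
  moreover have "gmean s (\<lambda>y. exp (m * F y)) x = exp (- ((x / s)\<^sup>2 / 2)) *
      (LINT z|gauss. cosh (x / s * z) * exp (m * F (s * z)))"
    unfolding gmean_def using F
    by (intro gauss_tilt_even exp_growth_exp_tame s) (simp_all add: tame_even)
  ultimately show ?thesis by (simp add: tilted_slope_def mult_ac)
qed

text \<open>
  Passing from \<open>(m, G, x)\<close> to \<open>(m', H, x')\<close> multiplies the symmetric weight by a function that is
  nondecreasing in \<open>\<bar>z\<bar>\<close>, and increases the averaged function; both raise the mean, the first by
  Chebyshev's inequality. With \<open>G = H\<close> this says that convexity is preserved, with \<open>x = x'\<close> that
  the order between derivatives is.
\<close>

lemma tilted_slope_mono:
  assumes G: "tame G" and H: "tame H" and le: "\<And>y. 0 \<le> y \<Longrightarrow> deriv G y \<le> deriv H y"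
    and m: "0 \<le> m" "m \<le> m'" and x: "0 \<le> x" "x \<le> x'" and s: "0 \<le> s"
  shows "tilted_slope s m G x \<le> tilted_slope s m' H x'"
proof (cases "s = 0")
  case True
  have "deriv G x \<le> deriv G x'" using tame_mono[OF G x(2)] .
  also have "\<dots> \<le> deriv H x'" using le x by auto
  finally show ?thesis using True by (simp add: tilted_slope_def)
next
  case False
  with s have s: "s > 0" by simp
  define c c' where "c = x / s" and "c' = x' / s"
  have c: "0 \<le> c" "c \<le> c'" unfolding c_def c'_def using x s by (auto intro: divide_right_mono)
  define w where "w z = cosh (c * z) * exp (m * G (s * z))" for z
  define f where "f z = tanh (c * z) * deriv G (s * z)" for z
  define f' where "f' z = tanh (c' * z) * deriv H (s * z)" for z
  \<comment> \<open>The ratio of the two symmetric weights.\<close>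
  define g where "g z = (cosh (c' * z) / cosh (c * z)) * exp (m' * H (s * z) - m * G (s * z))" for z
  have wg: "w z * g z = cosh (c' * z) * exp (m' * H (s * z))" for z
    unfolding w_def g_def by (simp add: exp_diff)
  have w_pos: "w z > 0" and g_pos: "g z > 0" for z unfolding w_def g_def by auto
  have tanh_growth: "exp_growth (\<lambda>z. tanh (a * z))" for a :: real
  proof (rule exp_growth_bounded[of _ 1])
    show "(\<lambda>z. tanh (a * z)) \<in> borel_measurable borel"
      by (intro borel_measurable_continuous_onI continuous_intros) auto
    show "\<bar>tanh (a * z)\<bar> \<le> 1" for z using tanh_real_lt_1[of "a * z"] tanh_real_gt_neg1[of "a * z"] by auto
  qed
  have w: "exp_growth w" unfolding w_def
    by (intro exp_growth_mult exp_growth_cosh exp_growth_scale[where f = "\<lambda>y. exp (m * G y)"] exp_growth_exp_tame G)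
  have f: "exp_growth f" unfolding f_def
    by (intro exp_growth_mult tanh_growth exp_growth_scale exp_growth_deriv_tame G)
  have f': "exp_growth f'" unfolding f'_def
    by (intro exp_growth_mult tanh_growth exp_growth_scale exp_growth_deriv_tame H)
  have wg_growth: "exp_growth (\<lambda>z. w z * g z)" unfolding wg
    by (intro exp_growth_mult exp_growth_cosh exp_growth_scale[where f = "\<lambda>y. exp (m' * H y)"] exp_growth_exp_tame H)
  have f_ev: "evmono f"
  proof (rule evmonoI)
    show "f (- z) = f z" for z by (simp add: f_def tame_deriv_odd[OF G])
    fix y z :: real assume yz: "0 \<le> y" "y \<le> z"
    show "f y \<le> f z" unfolding f_def
      using yz c s
      by (intro mult_mono) (auto intro!: mult_left_mono tame_mono[OF G] tame_deriv_nonneg[OF G])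
  qed
  have g_ev: "evmono g"
  proof (rule evmonoI)
    show "g (- z) = g z" for z by (simp add: g_def tame_even G H)
    fix y z :: real assume yz: "0 \<le> y" "y \<le> z"
    have "evmono (\<lambda>y. m' * H y - m * G y)"
    proof (rule evmono_lincomb[OF G H])
      fix y :: real assume y: "0 \<le> y"
      show "m * deriv G y \<le> m' * deriv H y"
        using m le[OF y] tame_deriv_nonneg[OF G y] by (intro mult_mono) auto
    qed
    then have "m' * H (s * y) - m * G (s * y) \<le> m' * H (s * z) - m * G (s * z)"
      by (rule evmonoD) (use yz s in \<open>auto simp: abs_mult\<close>)
    moreover have "cosh (c' * y) / cosh (c * y) \<le> cosh (c' * z) / cosh (c * z)"
      using cosh_mult_mono[OF c yz] by (simp add: divide_simps)
    ultimately show "g y \<le> g z" unfolding g_def by (intro mult_mono) auto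
  qed
  have f_le: "f z \<le> f' z" for z
  proof -
    have pos: "f z \<le> f' z" if "0 \<le> z" for z
      unfolding f_def f'_def
      using that c s le by (intro mult_mono) (auto intro!: mult_right_mono tame_deriv_nonneg[OF G])
    have "f (- z) = f z" "f' (- z) = f' z"
      by (auto simp: f_def f'_def tame_deriv_odd[OF G] tame_deriv_odd[OF H])
    then show ?thesis using pos[of z] pos[of "- z"] by (cases "0 \<le> z") auto
  qed
  define W A B C where "W = (LINT z|gauss. w z)" and "A = (LINT z|gauss. w z * f z)"
    and "B = (LINT z|gauss. w z * g z)" and "C = (LINT z|gauss. w z * (f z * g z))"
  have "A * B \<le> W * C" unfolding W_def A_def B_def C_def
  proof (rule chebyshev_association)
    show "integrable gauss w" "integrable gauss (\<lambda>z. w z * f z)" "integrable gauss (\<lambda>z. w z * g z)"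
      by (intro integrable_gauss_exp_growth exp_growth_mult w f wg_growth)+
    have "exp_growth (\<lambda>z. (w z * g z) * f z)" by (intro exp_growth_mult[OF wg_growth f])
    then show "integrable gauss (\<lambda>z. w z * (f z * g z))"
      by (auto simp: mult_ac intro: integrable_gauss_exp_growth)
  qed (use w_pos f_ev g_ev in \<open>auto intro: evmono_comonotone less_imp_le\<close>)
  moreover have "C \<le> (LINT z|gauss. (w z * g z) * f' z)" (is "_ \<le> ?C'")
    unfolding C_def
  proof (rule integral_mono)
    have "exp_growth (\<lambda>z. (w z * g z) * f z)" by (intro exp_growth_mult[OF wg_growth f])
    then show "integrable gauss (\<lambda>z. w z * (f z * g z))"
      by (auto simp: mult_ac intro: integrable_gauss_exp_growth)
    show "integrable gauss (\<lambda>z. (w z * g z) * f' z)"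
      by (intro integrable_gauss_exp_growth exp_growth_mult[OF wg_growth f'])
    show "w z * (f z * g z) \<le> (w z * g z) * f' z" for z
      using f_le[of z] w_pos[of z] g_pos[of z] by (simp add: mult_ac mult_left_mono)
  qed
  moreover have WB: "W > 0" "B > 0" unfolding W_def B_def
    by (intro gauss_integral_pos w wg_growth mult_pos_pos w_pos g_pos)+
  ultimately have "A * B \<le> W * ?C'"
    by (smt (verit) mult_left_mono)
  then have "A / W \<le> ?C' / B"
    using WB by (simp add: divide_simps mult_ac)
  moreover have "tilted_slope s m G x = A / W"
    unfolding tilted_slope_centred[OF G s] A_def W_def w_def f_def c_def ..
  moreover have "tilted_slope s m' H x' = ?C' / B"
    unfolding tilted_slope_centred[OF H s] B_def wg f'_def c'_def ..
  ultimately show ?thesis by simp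
qed

lemma T_op_even: "tame F \<Longrightarrow> T_op m t F (- x) = T_op m t F x"
  by (simp add: T_op_eq tame_measurable gmean_even tame_exp_growth exp_growth_exp_tame tame_even)

lemma deriv_T_op: "tame F \<Longrightarrow> deriv (T_op m t F) x = tilted_slope (sqrt (2 * t)) m F x"
  by (rule DERIV_imp_deriv) (rule T_op_has_derivative)

lemma abs_tilted_slope_le:
  assumes F: "tame F"
  shows "\<bar>tilted_slope s m F x\<bar> \<le> 1"
proof -
  let ?e = "\<lambda>y. exp (m * F y)" and ?d = "\<lambda>y. exp (m * F y) * deriv F y"
  have g: "exp_growth ?e" "exp_growth ?d"
    by (intro exp_growth_mult exp_growth_exp_tame exp_growth_deriv_tame F)+
  have b: "\<bar>deriv F y\<bar> \<le> 1" for y by (rule tame_bound[OF F])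
  have "gmean s ?d x \<le> gmean s ?e x"
    using b by (intro gmean_mono g) (auto simp: abs_le_iff)
  moreover have "gmean s (\<lambda>y. - 1 * exp (m * F y)) x \<le> gmean s ?d x"
  proof (intro gmean_mono g exp_growth_mult exp_growth_const)
    fix y show "- 1 * exp (m * F y) \<le> exp (m * F y) * deriv F y"
      using mult_left_mono[of "-1" "deriv F y" "exp (m * F y)"] b[of y] by (simp add: abs_le_iff)
  qed
  then have "- gmean s ?e x \<le> gmean s ?d x" unfolding gmean_cmult by simp
  moreover have "gmean s ?e x > 0" by (intro gmean_pos g) auto
  ultimately show ?thesis by (simp add: tilted_slope_def abs_le_iff divide_simps)
qed

text \<open>Only monotonicity of the derivative needs an argument; by oddness the positive half line suffices.\<close>

lemma tame_T_op:
  assumes F: "tame F" and m: "0 \<le> m" and t: "0 \<le> t"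
  shows "tame (T_op m t F)"
  unfolding tame_def
proof (intro conjI allI)
  let ?T = "T_op m t F"
  show even: "?T (- x) = ?T x" for x by (rule T_op_even[OF F])
  show d: "(?T has_real_derivative deriv ?T x) (at x)" for x
    using T_op_has_derivative[OF F] by (simp add: deriv_T_op[OF F])
  show "\<bar>deriv ?T x\<bar> \<le> 1" for x
    by (simp add: deriv_T_op[OF F] abs_tilted_slope_le[OF F])
  have odd: "deriv ?T (- x) = - deriv ?T x" for x
    using even_imp_deriv_odd[of ?T "deriv ?T", OF even d] .
  have pos: "deriv ?T x \<le> deriv ?T y" if "0 \<le> x" "x \<le> y" for x y
    unfolding deriv_T_op[OF F] using that m t by (intro tilted_slope_mono F) auto
  have "deriv ?T 0 = 0" using odd[of 0] by simp
  then have nonneg: "0 \<le> deriv ?T x" if "0 \<le> x" for x using pos[of 0 x] that by simp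
  show "mono (deriv ?T)"
  proof (rule monoI)
    fix x y :: real assume xy: "x \<le> y"
    consider "0 \<le> x" | "y \<le> 0" | "x < 0" "0 < y" by linarith
    then show "deriv ?T x \<le> deriv ?T y"
    proof cases
      case 1 then show ?thesis using pos xy by auto
    next
      case 2
      then have "deriv ?T (- y) \<le> deriv ?T (- x)" using pos[of "- y" "- x"] xy by simp
      then show ?thesis using odd by simp
    next
      case 3
      then have "deriv ?T x \<le> 0" using nonneg[of "- x"] odd[of x] by simp
      also have "0 \<le> deriv ?T y" using nonneg 3 by simp
      finally show ?thesis .
    qed
  qed
qed

lemma deriv_T_op_mono:
  assumes "tame G" "tame H" "\<And>y. 0 \<le> y \<Longrightarrow> deriv G y \<le> deriv H y"
    "0 \<le> m" "m \<le> m'" "0 \<le> t" "0 \<le> x"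
  shows "deriv (T_op m t G) x \<le> deriv (T_op m' t H) x"
  using assms by (simp add: deriv_T_op tilted_slope_mono)

lemma T_op_mono:
  assumes F: "tame F" and G: "tame G" and le: "\<And>y. F y \<le> G y" and m: "0 \<le> m"
  shows "T_op m t F x \<le> T_op m t G x"
proof (cases "m = 0")
  case True
  then show ?thesis using le by (simp add: T_op_0 F G gmean_mono tame_exp_growth)
next
  case False
  have "gmean (sqrt (2*t)) (\<lambda>y. exp (m * F y)) x \<le> gmean (sqrt (2*t)) (\<lambda>y. exp (m * G y)) x"
    using le m by (intro gmean_mono exp_growth_exp_tame F G) (auto intro: mult_left_mono)
  moreover have "0 < gmean (sqrt (2*t)) (\<lambda>y. exp (m * F y)) x"
    by (intro gmean_pos exp_growth_exp_tame F) auto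
  ultimately show ?thesis using False m by (simp add: T_op_pos F G divide_right_mono)
qed

lemma tame_add_const:
  assumes F: "tame F"
  shows "tame (\<lambda>y. F y + c)"
proof -
  have "((\<lambda>y. F y + c) has_real_derivative deriv F x) (at x)" for x
    using DERIV_add[OF tame_deriv[OF F] DERIV_const] by simp
  then have "deriv (\<lambda>y. F y + c) = deriv F" "\<forall>x. ((\<lambda>y. F y + c) has_real_derivative deriv F x) (at x)"
    by (auto intro: DERIV_imp_deriv)
  then show ?thesis using F by (simp add: tame_def)
qed

lemma T_op_add_const:
  assumes F: "tame F"
  shows "T_op m t (\<lambda>y. F y + c) x = T_op m t F x + c"
proof (cases "m = 0")
  case True
  then show ?thesis
    by (simp add: T_op_0 F tame_add_const gmean_add tame_exp_growth exp_growth_const)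
next
  case False
  define g where "g = gmean (sqrt (2 * t)) (\<lambda>y. exp (m * F y)) x"
  have "gmean (sqrt (2 * t)) (\<lambda>y. exp (m * (F y + c))) x = exp (m * c) * g"
    unfolding g_def gmean_cmult[symmetric] by (simp add: algebra_simps exp_add)
  then have "T_op m t (\<lambda>y. F y + c) x = (1 / m) * ln (exp (m * c) * g)"
    by (simp only: T_op_pos[OF tame_add_const[OF F] False])
  moreover have "T_op m t F x = (1 / m) * ln g"
    unfolding g_def by (rule T_op_pos[OF F False])
  moreover have "g > 0"
    unfolding g_def by (intro gmean_pos exp_growth_exp_tame F) auto
  ultimately show ?thesis using False by (simp add: ln_mult_pos algebra_simps)
qed

lemma T_op_nonexpansive:
  assumes F: "tame F" and G: "tame G" and le: "\<And>y. \<bar>F y - G y\<bar> \<le> e" and m: "0 \<le> m"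
  shows "\<bar>T_op m t F x - T_op m t G x\<bar> \<le> e"
proof -
  have "T_op m t F x \<le> T_op m t (\<lambda>y. G y + e) x"
    using le by (intro T_op_mono F tame_add_const G m) (simp add: abs_le_iff algebra_simps)
  moreover have "T_op m t G x \<le> T_op m t (\<lambda>y. F y + e) x"
    using le by (intro T_op_mono F tame_add_const G m) (simp add: abs_le_iff algebra_simps)
  ultimately show ?thesis by (simp add: T_op_add_const F G abs_le_iff)
qed

section \<open>The supermodular step\<close>

text \<open>Bernoulli's inequality for \<open>y = exp (l * t)\<close> and the power \<open>u / l \<ge> 1\<close>, from convexity of \<open>exp\<close>.\<close>

lemma exp_bernoulli:
  fixes l u t :: real
  assumes "0 < l" "l \<le> u"
  shows "(u / l) * (exp (l * t) - 1) \<le> exp (u * t) - 1"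
proof -
  have "exp ((1 - l / u) *\<^sub>R 0 + (l / u) *\<^sub>R (u * t)) \<le> (1 - l / u) * exp 0 + (l / u) * exp (u * t)"
    by (rule convex_onD[OF exp_convex]) (use assms in auto)
  then have "exp (l * t) \<le> 1 + (l / u) * (exp (u * t) - 1)"
    using assms by (simp add: algebra_simps)
  then have "(u / l) * (exp (l * t) - 1) \<le> (u / l) * ((l / u) * (exp (u * t) - 1))"
    using assms by (intro mult_left_mono) auto
  then show ?thesis using assms by simp
qed

text \<open>
  One step of the supermodularity argument. Write \<open>D = B - L\<close>, which is nondecreasing in \<open>\<bar>y\<bar>\<close>, and
  let \<open>c\<close> be the increment \<open>T_op l t B x - T_op l t L x\<close>. By definition \<open>exp (l * (D - c)) - 1\<close>, or
  \<open>D - c\<close> if \<open>l = 0\<close>, has mean zero under the Gaussian tilted by \<open>exp (l * L)\<close>. The density \<open>exp (u * A - l * L)\<close> is nondecreasing in \<open>\<bar>y\<bar>\<close>, so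
  under the tilt by \<open>exp (u * A)\<close> the mean is nonnegative. Raising the exponent from
  \<open>l\<close> to \<open>u\<close> (Bernoulli) and \<open>D\<close> to \<open>U - A\<close> only increases it, which is the claim.
\<close>

lemma T_op_supermodular_step:
  assumes U: "tame U" and A: "tame A" and B: "tame B" and L: "tame L"
    and m: "0 \<le> l" "l \<le> u" and t: "0 \<le> t"
    and LB: "\<And>y. 0 \<le> y \<Longrightarrow> deriv L y \<le> deriv B y"
    and LA: "\<And>y. 0 \<le> y \<Longrightarrow> deriv L y \<le> deriv A y"
    and le: "\<And>y. B y - L y \<le> U y - A y"
  shows "T_op l t B x - T_op l t L x \<le> T_op u t U x - T_op u t A x"
proof -
  define s where "s = sqrt (2 * t)"
  have s0: "0 \<le> s" using t by (simp add: s_def)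
  define c where "c = T_op l t B x - T_op l t L x"
  define f where "f y = (if l = 0 then B y - L y - c else exp (l * (B y - L y - c)) - 1)" for y
  have exp_diff_growth: "exp_growth (\<lambda>y. exp (a * G y - b * H y))" if "tame G" "tame H" for a b G H
  proof -
    have "exp_growth (\<lambda>y. exp (a * G y) * exp ((- b) * H y))"
      by (intro exp_growth_mult exp_growth_exp_tame that)
    then show ?thesis by (simp add: exp_diff exp_minus field_simps)
  qed
  have f_growth: "exp_growth f"
  proof (cases "l = 0")
    case True
    then show ?thesis unfolding f_def
      by (simp, intro exp_growth_diff tame_exp_growth exp_growth_const B L)
  next
    case False
    have "exp_growth (\<lambda>y. exp (- l * c) * exp (l * B y - l * L y) - 1)"
      by (intro exp_growth_mult exp_growth_diff exp_growth_const exp_diff_growth B L)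
    moreover have "f = (\<lambda>y. exp (- l * c) * exp (l * B y - l * L y) - 1)"
      using False by (auto simp: f_def algebra_simps simp flip: exp_add)
    ultimately show ?thesis by simp
  qed
  have "evmono (\<lambda>y. B y - L y)" by (rule evmono_diff[OF L B LB])
  then have f_ev: "evmono f"
    unfolding evmono_def f_def using m by (auto intro!: mult_left_mono)
  \<comment> \<open>The choice of \<open>c\<close> is the normalisation under the smaller tilt.\<close>
  have zero: "gmean s (\<lambda>y. exp (l * L y) * f y) x = 0"
  proof (cases "l = 0")
    case True
    then show ?thesis
      by (simp add: f_def c_def T_op_0 B L s_def gmean_diff tame_exp_growth exp_growth_diff exp_growth_const)
  next
    case False
    have "(\<lambda>y. exp (l * L y) * f y) = (\<lambda>y. exp (- l * c) * exp (l * B y) - exp (l * L y))"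
      using False by (auto simp: f_def algebra_simps simp flip: exp_add)
    then have "gmean s (\<lambda>y. exp (l * L y) * f y) x
        = exp (- l * c) * exp (l * T_op l t B x) - exp (l * T_op l t L x)"
      using False
      by (simp add: gmean_diff exp_growth_mult exp_growth_const exp_growth_exp_tame B L gmean_cmult
           exp_T_op s_def)
    also have "\<dots> = 0" by (simp add: c_def algebra_simps flip: exp_add)
    finally show ?thesis .
  qed
  \<comment> \<open>Chebyshev's inequality carries it to the larger tilt with the right sign.\<close>
  have tilt: "0 \<le> gmean s (\<lambda>y. exp (u * A y) * f y) x"
  proof (cases "s = 0")
    case True
    then have "f x = 0" using zero by simp
    then show ?thesis using True by simp
  next
    case False
    with s0 have s: "s > 0" by simp
    define w where "w z = cosh (x / s * z) * exp (l * L (s * z))" for z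
    define g where "g z = exp (u * A (s * z) - l * L (s * z))" for z
    have f_even: "f (- z) = f z" for z by (rule evmono_even[OF f_ev])
    have w_growth: "exp_growth w" unfolding w_def
      by (intro exp_growth_mult exp_growth_cosh exp_growth_scale[where f = "\<lambda>y. exp (l * L y)"] exp_growth_exp_tame L)
    have g_growth: "exp_growth g" unfolding g_def
      by (rule exp_growth_scale[where f = "\<lambda>y. exp (u * A y - l * L y)"]) (rule exp_diff_growth[OF A L])
    have "evmono (\<lambda>y. u * A y - l * L y)"
    proof (rule evmono_lincomb[OF L A])
      fix y :: real assume y: "0 \<le> y"
      show "l * deriv L y \<le> u * deriv A y"
        using m LA[OF y] tame_deriv_nonneg[OF L y] by (intro mult_mono) auto
    qed
    then have g_ev: "evmono g"
      unfolding g_def by (intro evmono_exp evmono_scale[where f = "\<lambda>y. u * A y - l * L y"])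
    have wf: "(LINT z|gauss. w z * f (s * z)) = 0"
    proof -
      have "gmean s (\<lambda>y. exp (l * L y) * f y) x = exp (- ((x / s)\<^sup>2 / 2)) *
          (LINT z|gauss. cosh (x / s * z) * (exp (l * L (s * z)) * f (s * z)))"
        unfolding gmean_def
        by (intro gauss_tilt_even exp_growth_mult exp_growth_exp_tame f_growth L s)
           (simp add: tame_even L f_even)
      then show ?thesis using zero by (simp add: w_def mult_ac)
    qed
    have "(LINT z|gauss. w z * f (s * z)) * (LINT z|gauss. w z * g z)
        \<le> (LINT z|gauss. w z) * (LINT z|gauss. w z * (f (s * z) * g z))"
    proof (rule evmono_chebyshev[where f = "\<lambda>z. f (s * z)"])
      show "0 \<le> w z" for z by (simp add: w_def)
    qed (intro w_growth g_growth g_ev evmono_scale f_ev exp_growth_scale f_growth)+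
    moreover have "(LINT z|gauss. w z) > 0"
      by (intro gauss_integral_pos w_growth) (simp add: w_def)
    ultimately have "0 \<le> (LINT z|gauss. w z * (f (s * z) * g z))"
      by (simp add: wf zero_le_mult_iff)
    moreover have "gmean s (\<lambda>y. exp (u * A y) * f y) x = exp (- ((x / s)\<^sup>2 / 2)) *
        (LINT z|gauss. cosh (x / s * z) * (exp (u * A (s * z)) * f (s * z)))"
      unfolding gmean_def
      by (intro gauss_tilt_even exp_growth_mult exp_growth_exp_tame f_growth A s)
         (simp add: tame_even A f_even)
    moreover have "w z * (f (s * z) * g z) = cosh (x / s * z) * (exp (u * A (s * z)) * f (s * z))" for z
      by (simp add: w_def g_def exp_diff)
    ultimately show ?thesis by simp
  qed
  show ?thesis
  proof (cases "u = 0")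
    case True
    then have l: "l = 0" using m by simp
    have "0 \<le> gmean s (\<lambda>y. B y - L y - c) x" using tilt True l by (simp add: f_def)
    also have "\<dots> \<le> gmean s (\<lambda>y. U y - A y - c) x"
      using le by (intro gmean_mono exp_growth_diff exp_growth_const tame_exp_growth U A B L) auto
    also have "\<dots> = gmean s U x - gmean s A x - c"
      by (simp add: gmean_diff tame_exp_growth exp_growth_diff exp_growth_const U A)
    finally show ?thesis using True by (simp add: T_op_0 U A s_def c_def)
  next
    case False
    with m have u: "u > 0" by simp
    define K where "K = (if l = 0 then u else u / l)"
    have K: "0 \<le> K" using u m by (simp add: K_def)
    have bern: "K * f y \<le> exp (u * (U y - A y - c)) - 1" for y
    proof -
      have "K * f y \<le> exp (u * (B y - L y - c)) - 1"
      proof (cases "l = 0")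
        case True
        then have "K * f y = u * (B y - L y - c)" by (simp add: K_def f_def)
        then show ?thesis using exp_ge_add_one_self[of "u * (B y - L y - c)"] by linarith
      next
        case False
        then show ?thesis using exp_bernoulli[of l u "B y - L y - c"] m by (simp add: K_def f_def)
      qed
      also have "\<dots> \<le> exp (u * (U y - A y - c)) - 1"
        using le[of y] u by (simp add: mult_left_mono)
      finally show ?thesis .
    qed
    have "0 \<le> K * gmean s (\<lambda>y. exp (u * A y) * f y) x" using K tilt by simp
    also have "\<dots> = gmean s (\<lambda>y. K * (exp (u * A y) * f y)) x" by (simp add: gmean_cmult)
    also have "\<dots> \<le> gmean s (\<lambda>y. exp (- u * c) * exp (u * U y) - exp (u * A y)) x"
    proof (intro gmean_mono exp_growth_mult exp_growth_diff exp_growth_const exp_growth_exp_tame f_growth U A)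
      fix y
      have "K * (exp (u * A y) * f y) \<le> exp (u * A y) * (exp (u * (U y - A y - c)) - 1)"
        using mult_left_mono[OF bern[of y], of "exp (u * A y)"] by (simp add: mult_ac)
      also have "\<dots> = exp (- u * c) * exp (u * U y) - exp (u * A y)"
        by (simp add: algebra_simps flip: exp_add)
      finally show "K * (exp (u * A y) * f y) \<le> exp (- u * c) * exp (u * U y) - exp (u * A y)" .
    qed
    also have "\<dots> = exp (- u * c) * exp (u * T_op u t U x) - exp (u * T_op u t A x)"
      using u by (simp add: gmean_diff exp_growth_mult exp_growth_const exp_growth_exp_tame U A gmean_cmult
           exp_T_op s_def)
    finally have "exp (u * T_op u t A x) \<le> exp (u * (T_op u t U x - c))"
      by (simp add: algebra_simps flip: exp_add)
    then show ?thesis using u by (simp add: c_def)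
  qed
qed

section \<open>Semigroup property and perturbation bounds\<close>

lemma gmean_normal_density:
  assumes f[measurable]: "f \<in> borel_measurable borel" and s: "s > 0"
  shows "gmean s f x = (LINT y|density lborel (normal_density 0 s). f (x + y))"
proof -
  have "(LINT y|density lborel (normal_density 0 s). f (x + y))
      = (LINT y|lborel. normal_density 0 s y * f (x + y))"
    by (subst integral_density) auto
  also have "\<dots> = \<bar>s\<bar> *\<^sub>R (LINT z|lborel. normal_density 0 s (0 + s * z) * f (x + (0 + s * z)))"
    by (rule lborel_integral_real_affine) (use s in auto)
  also have "\<dots> = (LINT z|lborel. s * (normal_density 0 s (s * z) * f (x + s * z)))"
    using s by simp
  also have "\<dots> = (LINT z|lborel. std_normal_density z * f (x + s * z))"
  proof (intro Bochner_Integration.integral_cong refl)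
    fix z
    have "s * normal_density 0 s (s * z) = std_normal_density z"
      using s by (simp add: normal_density_def power_mult_distrib real_sqrt_mult)
    then show "s * (normal_density 0 s (s * z) * f (x + s * z)) = std_normal_density z * f (x + s * z)"
      by (simp flip: mult.assoc)
  qed
  also have "\<dots> = gmean s f x" unfolding gmean_def by (rule integral_gauss_eq[symmetric]) simp
  finally show ?thesis ..
qed

text \<open>The semigroup property: independent Gaussians add, and so do their variances.\<close>

lemma gmean_gmean:
  assumes f: "exp_growth f" and a: "0 \<le> a" and b: "0 \<le> b"
  shows "gmean a (gmean b f) x = gmean (sqrt (a\<^sup>2 + b\<^sup>2)) f x"
proof (cases "a = 0 \<or> b = 0")
  case True
  then show ?thesis using a b by (auto simp: gmean_0[abs_def])
next
  case False
  with a b have ab: "a > 0" "b > 0" by auto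
  define M N where "M = density lborel (normal_density 0 a)" and "N = density lborel (normal_density 0 b)"
  define s where "s = sqrt (a\<^sup>2 + b\<^sup>2)"
  have s: "s > 0" using ab by (simp add: s_def add_pos_pos)
  have [measurable]: "f \<in> borel_measurable borel" using f by (rule exp_growth_measurable)
  have sets[measurable_cong]: "sets M = sets borel" "sets N = sets borel" by (simp_all add: M_def N_def)
  interpret M: prob_space M unfolding M_def by (rule prob_space_normal_density) fact
  interpret N: prob_space N unfolding N_def by (rule prob_space_normal_density) fact
  interpret MN: pair_prob_space M N ..
  have conv: "distr (M \<Otimes>\<^sub>M N) borel (\<lambda>(x, y). x + y) = density lborel (normal_density 0 s)"
  proof -
    have "M \<star> N = density lborel (\<lambda>x. \<integral>\<^sup>+y. ennreal (normal_density 0 a (x - y)) * ennreal (normal_density 0 b y) \<partial>lborel)"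
      unfolding M_def N_def
      by (rule convolution_density) (auto simp: M_def[symmetric] N_def[symmetric] M.finite_measure_axioms N.finite_measure_axioms)
    also have "\<dots> = density lborel (normal_density 0 s)"
      unfolding s_def conv_normal_density_zero_mean[OF ab, symmetric]
      by (simp add: ennreal_mult)
    finally show ?thesis by (simp add: convolution_def)
  qed
  have "gmean s f x = (LINT y|(distr (M \<Otimes>\<^sub>M N) borel (\<lambda>(x, y). x + y)). f (x + y))"
    unfolding conv using s by (intro gmean_normal_density) auto
  also have "\<dots> = (LINT p|(M \<Otimes>\<^sub>M N). f (x + (fst p + snd p)))"
    by (subst integral_distr) (auto simp: case_prod_beta)
  also have "\<dots> = (LINT u|M. LINT v|N. f (x + (u + v)))"
  proof -
    have "integrable (distr (M \<Otimes>\<^sub>M N) borel (\<lambda>(x, y). x + y)) (\<lambda>y. f (x + y))"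
    proof -
      have "integrable gauss (\<lambda>z. f (x + s * z))" by (rule gmean_integrable[OF f])
      then have "integrable lborel (\<lambda>z. std_normal_density z * f (x + s * z))"
        by (simp add: integrable_gauss_iff)
      also have "(\<lambda>z. std_normal_density z * f (x + s * z)) = (\<lambda>z. s * (normal_density 0 s (0 + s * z) * f (x + (0 + s * z))))"
      proof (rule ext)
        fix z
        have "s * normal_density 0 s (s * z) = std_normal_density z"
          using s by (simp add: normal_density_def power_mult_distrib real_sqrt_mult)
        then show "std_normal_density z * f (x + s * z) = s * (normal_density 0 s (0 + s * z) * f (x + (0 + s * z)))"
          by (simp flip: mult.assoc)
      qed
      finally have "integrable lborel (\<lambda>z. normal_density 0 s (0 + s * z) * f (x + (0 + s * z)))"
        using s by simp
      then have "integrable lborel (\<lambda>y. normal_density 0 s y * f (x + y))"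
        using lborel_integrable_real_affine_iff[of s "\<lambda>y. normal_density 0 s y * f (x + y)" 0] s by simp
      then show ?thesis unfolding conv by (subst integrable_density) auto
    qed
    then have "integrable (M \<Otimes>\<^sub>M N) (\<lambda>p. f (x + (fst p + snd p)))"
      by (subst (asm) integrable_distr_eq) (auto simp: case_prod_beta)
    from MN.integral_fst'[OF this] show ?thesis by simp
  qed
  also have "\<dots> = (LINT u|M. gmean b f (x + u))"
    unfolding N_def by (subst gmean_normal_density) (auto simp: ab add.assoc)
  also have "\<dots> = gmean a (gmean b f) x"
    unfolding M_def
  proof (rule gmean_normal_density[symmetric])
    show "gmean b f \<in> borel_measurable borel" unfolding gmean_def by measurable
  qed fact
  finally show ?thesis by (simp add: s_def)
qed

lemma T_op_semigroup:
  assumes F: "tame F" and m: "0 \<le> m" and t: "0 \<le> t" "0 \<le> t'"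
  shows "T_op m t (T_op m t' F) = T_op m (t + t') F"
proof (rule ext)
  fix x
  have s: "sqrt ((sqrt (2 * t))\<^sup>2 + (sqrt (2 * t'))\<^sup>2) = sqrt (2 * (t + t'))"
    using t by (simp add: algebra_simps)
  have G: "tame (T_op m t' F)" by (rule tame_T_op[OF F m t(2)])
  show "T_op m t (T_op m t' F) x = T_op m (t + t') F x"
  proof (cases "m = 0")
    case True
    have "T_op 0 t' F = gmean (sqrt (2 * t')) F" by (rule ext) (rule T_op_0[OF F])
    then show ?thesis using T_op_0[OF G[unfolded True]] gmean_gmean[of F "sqrt (2*t)" "sqrt (2 * t')" x] s t
      unfolding True by (simp add: T_op_0[OF F] tame_exp_growth[OF F])
  next
    case False
    have "(\<lambda>y. exp (m * T_op m t' F y)) = gmean (sqrt (2 * t')) (\<lambda>y. exp (m * F y))"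
      by (rule ext) (rule exp_T_op[OF F False])
    then show ?thesis
      unfolding T_op_pos[OF G False] T_op_pos[OF F False]
      using gmean_gmean[of "\<lambda>y. exp (m * F y)" "sqrt (2*t)" "sqrt (2 * t')" x] s t
      by (simp add: exp_growth_exp_tame[OF F])
  qed
qed

abbreviation lncosh :: "real \<Rightarrow> real" where
  "lncosh \<equiv> \<lambda>x. ln (cosh x)"

lemma tame_lncosh: "tame lncosh"
proof -
  have d: "(lncosh has_real_derivative tanh x) (at x)" for x
    by (rule derivative_eq_intros refl | simp add: tanh_def)+
  then have "deriv lncosh = tanh" by (auto intro: DERIV_imp_deriv)
  moreover have "mono (tanh :: real \<Rightarrow> real)" by (simp add: mono_def)
  moreover have "\<bar>tanh x\<bar> \<le> 1" for x :: real
    using tanh_real_lt_1[of x] tanh_real_gt_neg1[of x] by auto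
  ultimately show ?thesis using d by (simp add: tame_def)
qed

lemma gmean_exp: "gmean s (\<lambda>y. exp (c * y)) x = exp (c * x) * exp ((c * s)\<^sup>2 / 2)"
proof -
  have "1 = exp (- ((c * s)\<^sup>2 / 2)) * (LINT z|gauss. exp (c * s * z))"
    using cameron_martin[of "\<lambda>_. 1" "c * s"] by simp
  then have "(LINT z|gauss. exp (c * s * z)) = exp ((c * s)\<^sup>2 / 2)"
    by (simp add: exp_minus field_simps)
  moreover have "gmean s (\<lambda>y. exp (c * y)) x = exp (c * x) * (LINT z|gauss. exp (c * s * z))"
    unfolding gmean_def by (simp add: algebra_simps exp_add)
  ultimately show ?thesis by simp
qed

text \<open>
  The exponent \<open>1\<close> acts on \<open>ln \<circ> cosh\<close> by adding a constant. Hence \<open>a k\<close> minus the recursion started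
  at time \<open>a k\<close> may be replaced by any later horizon \<open>T\<close> minus the recursion started at
  time \<open>T\<close>, with exponent \<open>1\<close> after \<open>a k\<close>.
\<close>

lemma T_op_1_lncosh:
  assumes "0 \<le> t"
  shows "T_op 1 t lncosh x = lncosh x + t"
proof -
  let ?s = "sqrt (2 * t)"
  have "gmean ?s cosh x = gmean ?s (\<lambda>y. (1/2) * (exp (1 * y) + exp ((-1) * y))) x"
    by (simp add: cosh_def[abs_def] algebra_simps)
  also have "\<dots> = (1/2) * (gmean ?s (\<lambda>y. exp (1 * y)) x + gmean ?s (\<lambda>y. exp ((-1) * y)) x)"
    unfolding gmean_cmult by (subst gmean_add[OF exp_growth_exp exp_growth_exp]) (rule refl)
  also have "\<dots> = cosh x * exp t"
    unfolding gmean_exp using assms by (simp add: cosh_def algebra_simps)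
  finally have "gmean ?s cosh x = cosh x * exp t" .
  then show ?thesis using T_op_pos[OF tame_lncosh, of 1 t x] by (simp add: ln_mult_pos)
qed

lemma T_op_zero: "T_op m t (\<lambda>_. 0) x = 0"
  by (simp add: T_op_eq)

lemma tame_zero: "tame (\<lambda>_. 0)"
  by (simp add: tame_def mono_def)

text \<open>The supermodular step with two of its four functions equal to zero.\<close>

lemma T_op_mono_exponent:
  assumes F: "tame F" and m: "0 \<le> m" "m \<le> m'" and t: "0 \<le> t"
  shows "T_op m t F x \<le> T_op m' t F x"
  using T_op_supermodular_step[OF F tame_zero F tame_zero m t, of x]
  by (simp add: T_op_zero tame_deriv_nonneg[OF F])

lemma exp_minus_one_bound: "\<bar>exp u - 1\<bar> \<le> \<bar>u\<bar> * exp \<bar>u\<bar>" for u :: real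
proof (cases "u \<ge> 0")
  case True
  have "exp u * (1 - u) \<le> exp u * exp (- u)"
    using exp_ge_add_one_self[of "- u"] by (intro mult_left_mono) auto
  then have "exp u - 1 \<le> u * exp u" by (simp add: algebra_simps flip: exp_add)
  then show ?thesis using True by simp
next
  case False
  then have "1 - exp u \<le> - u" "exp u \<le> 1" using exp_ge_add_one_self[of u] by (auto simp del: exp_ge_add_one_self)
  moreover have "- u \<le> (- u) * exp (- u)" using False mult_left_mono[of 1 "exp (- u)" "- u"] by simp
  moreover have "\<bar>u\<bar> = - u" using False by simp
  ultimately show ?thesis by (simp only:)
qed

lemma exp_taylor2_bound: "exp u \<le> 1 + u + u\<^sup>2 * exp \<bar>u\<bar>" for u :: real
proof (cases "u \<ge> 0")
  case True
  have 1: "exp u - 1 \<le> u * exp u" using exp_minus_one_bound[of u] True by simp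
  then have 2: "exp u - 1 - u \<le> u * (exp u - 1)" by (simp add: algebra_simps)
  also have "\<dots> \<le> u * (u * exp u)" using True 1 by (intro mult_left_mono) auto
  finally show ?thesis using True by (simp add: power2_eq_square algebra_simps)
next
  case False
  define v where "v = - u"
  have v: "v > 0" using False by (simp add: v_def)
  have "exp (- v) * (1 + v) \<le> exp (- v) * exp v"
    using exp_ge_add_one_self[of v] by (intro mult_left_mono) auto
  then have "exp (- v) * (1 + v) \<le> 1" by (simp flip: exp_add)
  also have "1 \<le> (1 - v + v\<^sup>2) * (1 + v)" using v by (simp add: power2_eq_square algebra_simps)
  finally have "exp (- v) \<le> 1 - v + v\<^sup>2" using v by (simp add: mult_le_cancel_right_pos)
  also have "\<dots> \<le> 1 - v + v\<^sup>2 * exp v" using v mult_left_mono[of 1 "exp v" "v\<^sup>2"] by simp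
  finally show ?thesis using v by (simp add: v_def)
qed

lemma exp_growth_tame_diff_const:
  assumes "tame F" shows "exp_growth (\<lambda>y. F y - c)"
  by (intro exp_growth_diff exp_growth_const tame_exp_growth assms)

text \<open>
  A step of variance \<open>2 * t\<close> moves a \<open>1\<close>-Lipschitz function by a multiple of the standard deviation. The lower bound
  reduces to exponent \<open>0\<close> by monotonicity in \<open>m\<close>.
\<close>

lemma T_op_close:
  obtains C where "C \<ge> 0"
    "\<And>F m t x. tame F \<Longrightarrow> 0 \<le> m \<Longrightarrow> m \<le> 1 \<Longrightarrow> 0 \<le> t \<Longrightarrow> t \<le> 1 \<Longrightarrow>
       \<bar>T_op m t F x - F x\<bar> \<le> C * sqrt (2 * t)"
proof
  define C where "C = (LINT z|gauss. \<bar>z\<bar> * exp (2 * \<bar>z\<bar>))"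
  show "C \<ge> 0" unfolding C_def by simp
  fix F :: "real \<Rightarrow> real" and m t x :: real
  assume F: "tame F" and m: "0 \<le> m" "m \<le> 1" and t: "0 \<le> t" "t \<le> 1"
  define s where "s = sqrt (2 * t)"
  have s: "0 \<le> s" "s \<le> 2" using t by (auto simp: s_def real_le_lsqrt)
  let ?D = "\<lambda>z. F (x + s * z) - F x"
  have D: "\<bar>?D z\<bar> \<le> s * \<bar>z\<bar>" for z
    using tame_lipschitz[OF F, of "x + s * z" x] s by (simp add: abs_mult)
  have D2: "\<bar>?D z\<bar> * exp \<bar>?D z\<bar> \<le> s * (\<bar>z\<bar> * exp (2 * \<bar>z\<bar>))" for z
  proof -
    have "\<bar>?D z\<bar> \<le> 2 * \<bar>z\<bar>" using D[of z] s mult_right_mono[of s 2 "\<bar>z\<bar>"] by simp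
    then have "\<bar>?D z\<bar> * exp \<bar>?D z\<bar> \<le> (s * \<bar>z\<bar>) * exp (2 * \<bar>z\<bar>)"
      using s by (intro mult_mono D) auto
    then show ?thesis by (simp add: mult_ac)
  qed
  have up: "\<bar>F y - F x\<bar> * exp \<bar>F y - F x\<bar> \<ge> \<bar>F y - F x\<bar>" for y
    using mult_left_mono[of 1 "exp \<bar>F y - F x\<bar>" "\<bar>F y - F x\<bar>"] by simp
  have int2: "integrable gauss (\<lambda>z. s * (\<bar>z\<bar> * exp (2 * \<bar>z\<bar>)))"
    by (intro integrable_gauss_exp_growth exp_growth_mult exp_growth_const exp_growth_abs_id exp_growth_exp_abs)
  have sC: "(LINT z|gauss. s * (\<bar>z\<bar> * exp (2 * \<bar>z\<bar>))) = s * C" by (simp add: C_def)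
  have meas: "exp_growth (\<lambda>z. ?D z)"
    using exp_growth_affine[OF exp_growth_tame_diff_const[OF F, of "F x"], of x s] by simp
  have lin: "gmean s F x - F x = (LINT z|gauss. ?D z)"
    unfolding gmean_def using gmean_integrable[OF tame_exp_growth[OF F], of x s] by simp
  have absD: "\<bar>LINT z|gauss. ?D z\<bar> \<le> s * C"
  proof -
    have "\<bar>LINT z|gauss. ?D z\<bar> \<le> (LINT z|gauss. s * (\<bar>z\<bar> * exp (2 * \<bar>z\<bar>)))"
      by (rule order_trans[OF integral_abs_bound], rule integral_mono)
         (use int2 integrable_gauss_exp_growth[OF meas] order_trans[OF up D2] in auto)
    then show ?thesis unfolding sC .
  qed
  show "\<bar>T_op m t F x - F x\<bar> \<le> C * sqrt (2 * t)"
  proof (cases "m = 0")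
    case True
    then show ?thesis using absD lin by (simp add: T_op_0 F s_def mult.commute)
  next
    case False
    with m have mpos: "m > 0" by simp
    have "T_op 0 t F x \<le> T_op m t F x" by (intro T_op_mono_exponent F m t) simp
    then have low: "- (s * C) \<le> T_op m t F x - F x"
      using absD lin by (simp add: T_op_0 F s_def)
    define E where "E = gmean s (\<lambda>y. exp (m * (F y - F x))) x"
    have e_growth: "exp_growth (\<lambda>y. exp (m * (F y - F x)))"
    proof -
      have "exp_growth (\<lambda>y. exp (- m * F x) * exp (m * F y))"
        by (intro exp_growth_mult exp_growth_const exp_growth_exp_tame F)
      then show ?thesis by (simp add: algebra_simps flip: exp_add)
    qed
    have E: "E > 0" unfolding E_def by (intro gmean_pos e_growth) auto
    have "T_op m t F x - F x = (1 / m) * ln E"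
    proof -
      have "E = exp (- m * F x) * gmean s (\<lambda>y. exp (m * F y)) x"
        unfolding E_def gmean_cmult[symmetric] by (simp add: algebra_simps flip: exp_add)
      also have "\<dots> = exp (m * (T_op m t F x - F x))"
        unfolding s_def exp_T_op[OF F False, symmetric] by (simp add: algebra_simps flip: exp_add)
      finally show ?thesis using False by simp
    qed
    also have "\<dots> \<le> (1 / m) * (E - 1)"
      using mpos E by (intro mult_left_mono ln_le_minus_one) auto
    also have "E - 1 = (LINT z|gauss. exp (m * ?D z) - 1)"
      unfolding E_def gmean_def using gmean_integrable[OF e_growth, of x s] by simp
    also have "\<dots> \<le> (LINT z|gauss. m * (s * (\<bar>z\<bar> * exp (2 * \<bar>z\<bar>))))"
    proof (rule integral_mono)
      show "integrable gauss (\<lambda>z. exp (m * ?D z) - 1)"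
        using gmean_integrable[OF e_growth, of x s] by simp
      show "integrable gauss (\<lambda>z. m * (s * (\<bar>z\<bar> * exp (2 * \<bar>z\<bar>))))" using int2 by simp
      fix z
      have "exp (m * ?D z) - 1 \<le> \<bar>m * ?D z\<bar> * exp \<bar>m * ?D z\<bar>"
        using exp_minus_one_bound[of "m * ?D z"] by simp
      also have "\<dots> \<le> (m * \<bar>?D z\<bar>) * exp \<bar>?D z\<bar>"
        using m mult_right_mono[of m 1 "\<bar>?D z\<bar>"] by (intro mult_mono) (auto simp: abs_mult)
      also have "\<dots> \<le> m * (s * (\<bar>z\<bar> * exp (2 * \<bar>z\<bar>)))"
        using mult_left_mono[OF D2[of z] m(1)] by (simp add: mult_ac)
      finally show "exp (m * ?D z) - 1 \<le> m * (s * (\<bar>z\<bar> * exp (2 * \<bar>z\<bar>)))" .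
    qed
    also have "\<dots> = m * (s * C)" by (simp add: C_def)
    finally have "T_op m t F x - F x \<le> s * C" using mpos by (simp add: divide_simps mult_ac)
    with low show ?thesis by (simp add: abs_le_iff s_def mult.commute)
  qed
qed

text \<open>
  Normalise \<open>d = F - c\<close> with \<open>c = T_op m t F x\<close>. Then \<open>exp (m * d)\<close> has mean one and \<open>d\<close> has mean at most zero, so
  in the expansion of \<open>exp (m' * d)\<close> around \<open>m\<close> the terms of first order in \<open>d\<close> cannot raise the mean. What remains
  is quadratic in \<open>d\<close>, that is of order \<open>t\<close> and not \<open>sqrt t\<close>. This is what makes
  the functional Lipschitz for the \<open>L\<^sup>1\<close> distance.
\<close>

lemma T_op_lipschitz_exponent:
  obtains K where "K \<ge> 0"
    "\<And>F m m' t x. tame F \<Longrightarrow> 0 \<le> m \<Longrightarrow> m \<le> 1 \<Longrightarrow> 0 \<le> m' \<Longrightarrow> m' \<le> 1 \<Longrightarrow> 0 \<le> t \<Longrightarrow> t \<le> 1 \<Longrightarrow>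
       \<bar>T_op m t F x - T_op m' t F x\<bar> \<le> K * \<bar>m - m'\<bar> * t"
proof -
  obtain C where C: "C \<ge> 0"
    "\<And>F m t x. tame F \<Longrightarrow> 0 \<le> m \<Longrightarrow> m \<le> 1 \<Longrightarrow> 0 \<le> t \<Longrightarrow> t \<le> 1 \<Longrightarrow>
       \<bar>T_op m t F x - F x\<bar> \<le> C * sqrt (2 * t)"
    using T_op_close by blast
  define V where "V = (LINT z|gauss. (\<bar>z\<bar> + C) * (\<bar>z\<bar> + C) * (exp (2 * C) * exp (2 * \<bar>z\<bar>)))"
  have V0: "V \<ge> 0" unfolding V_def by simp
  have main: "T_op m' t F x - T_op m t F x \<le> (2 * V) * (m' - m) * t"
    if F: "tame F" and m: "0 \<le> m" "m \<le> m'" "m' \<le> 1" and t: "0 \<le> t" "t \<le> 1" for F m m' t x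
  proof (cases "m' = 0")
    case True
    then show ?thesis using m by simp
  next
    case False
    with m have m': "m' > 0" by simp
    define s where "s = sqrt (2 * t)"
    have s: "0 \<le> s" "s \<le> 2" using t by (auto simp: s_def real_le_lsqrt)
    have s2: "s * s = 2 * t" using t by (simp add: s_def)
    define c where "c = T_op m t F x"
    define d where "d y = F y - c" for y
    define v where "v y = d y * d y * exp \<bar>d y\<bar>" for y
    have d_growth: "exp_growth d" unfolding d_def by (rule exp_growth_tame_diff_const[OF F])
    have e_growth: "exp_growth (\<lambda>y. exp (a * d y))" for a
    proof -
      have "exp_growth (\<lambda>y. exp (- a * c) * exp (a * F y))"
        by (intro exp_growth_mult exp_growth_const exp_growth_exp_tame F)
      then show ?thesis by (simp add: d_def algebra_simps flip: exp_add)
    qed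
    have v_growth: "exp_growth v"
    proof -
      have "exp_growth (\<lambda>y. exp \<bar>d y\<bar>)"
      proof (rule exp_growthI[of _ "exp (\<bar>F 0\<bar> + \<bar>c\<bar>)" 1])
        have [measurable]: "d \<in> borel_measurable borel" by (rule exp_growth_measurable[OF d_growth])
        show "(\<lambda>y. exp \<bar>d y\<bar>) \<in> borel_measurable borel" by measurable
        fix y
        have "\<bar>d y\<bar> \<le> \<bar>F 0\<bar> + \<bar>c\<bar> + \<bar>y\<bar>" using tame_lipschitz[OF F, of y 0] by (simp add: d_def)
        then show "\<bar>exp \<bar>d y\<bar>\<bar> \<le> exp (\<bar>F 0\<bar> + \<bar>c\<bar>) * exp (1 * \<bar>y\<bar>)" by (simp flip: exp_add)
      qed
      then show ?thesis unfolding v_def by (intro exp_growth_mult d_growth)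
    qed
    have E: "gmean s (\<lambda>y. exp (a * d y)) x = exp (a * (T_op a t F x - c))" if "a \<noteq> 0" for a
    proof -
      have "gmean s (\<lambda>y. exp (a * d y)) x = exp (- a * c) * gmean s (\<lambda>y. exp (a * F y)) x"
        unfolding gmean_cmult[symmetric] by (simp add: d_def algebra_simps flip: exp_add)
      also have "\<dots> = exp (a * (T_op a t F x - c))"
        unfolding s_def exp_T_op[OF F that, symmetric] by (simp add: algebra_simps flip: exp_add)
      finally show ?thesis .
    qed
    have norm: "gmean s (\<lambda>y. exp (m * d y)) x = 1"
      using E[of m] by (cases "m = 0") (auto simp: c_def)
    have mean: "gmean s d x \<le> 0"
    proof (cases "m = 0")
      case True
      have "gmean s d x = gmean s F x - c"
        unfolding d_def by (simp add: gmean_diff tame_exp_growth F exp_growth_const)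
      then show ?thesis using True by (simp add: c_def T_op_0 F s_def)
    next
      case False
      have "gmean s (\<lambda>y. 1 + m * d y) x \<le> gmean s (\<lambda>y. exp (m * d y)) x"
        by (intro gmean_mono exp_growth_add exp_growth_const exp_growth_mult d_growth e_growth) auto
      then have "m * gmean s d x \<le> 0"
        by (simp add: norm gmean_add gmean_cmult exp_growth_const exp_growth_mult d_growth)
      then show ?thesis using False m by (simp add: mult_le_0_iff)
    qed
    \<comment> \<open>The remainder carries a factor \<open>m'\<close>, which cancels the \<open>1 / m'\<close> in the operator and keeps the bound uniform as \<open>m'\<close> tends to \<open>0\<close>.\<close>
    have pt: "exp (m' * d y) \<le> exp (m * d y) + (m' - m) * d y + ((m' - m) * m') * v y" for y
    proof -
      define e where "e = m' - m"
      define r where "r = d y"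
      have e: "0 \<le> e" "m' = m + e" using m by (auto simp: e_def)
      have b1: "exp (e * r) \<le> 1 + e * r + (e * r)\<^sup>2 * exp \<bar>e * r\<bar>" by (rule exp_taylor2_bound)
      have b2: "r * (exp (m * r) - 1) \<le> \<bar>r\<bar> * (\<bar>m * r\<bar> * exp \<bar>m * r\<bar>)"
      proof -
        have "r * (exp (m * r) - 1) \<le> \<bar>r\<bar> * \<bar>exp (m * r) - 1\<bar>" by (metis abs_ge_self abs_mult)
        also have "\<dots> \<le> \<bar>r\<bar> * (\<bar>m * r\<bar> * exp \<bar>m * r\<bar>)" by (intro mult_left_mono exp_minus_one_bound) auto
        finally show ?thesis .
      qed
      also have "\<dots> = m * (r * r) * exp (m * \<bar>r\<bar>)" using m by (simp add: abs_mult)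
      also have "\<dots> \<le> m * (r * r) * exp \<bar>r\<bar>"
        using m mult_right_mono[of m 1 "\<bar>r\<bar>"] by (intro mult_left_mono) auto
      finally have b3: "r * exp (m * r) \<le> r + m * (r * r * exp \<bar>r\<bar>)" by (simp add: algebra_simps)
      have b4: "exp (m * r) * ((e * r)\<^sup>2 * exp \<bar>e * r\<bar>) \<le> e * e * (r * r * exp \<bar>r\<bar>)"
      proof -
        have "m * r + \<bar>e * r\<bar> \<le> m * \<bar>r\<bar> + e * \<bar>r\<bar>"
          using e m by (auto simp: abs_mult intro!: mult_left_mono)
        also have "\<dots> \<le> \<bar>r\<bar>" using e m mult_right_mono[of "m + e" 1 "\<bar>r\<bar>"] by (simp add: algebra_simps)
        finally have "exp (m * r) * exp \<bar>e * r\<bar> \<le> exp \<bar>r\<bar>" by (simp flip: exp_add)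
        then have "(e * r)\<^sup>2 * (exp (m * r) * exp \<bar>e * r\<bar>) \<le> (e * r)\<^sup>2 * exp \<bar>r\<bar>"
          by (intro mult_left_mono) auto
        then show ?thesis by (simp add: power2_eq_square algebra_simps)
      qed
      have "exp (m' * r) = exp (m * r) * exp (e * r)" by (simp add: e algebra_simps flip: exp_add)
      also have "\<dots> \<le> exp (m * r) * (1 + e * r + (e * r)\<^sup>2 * exp \<bar>e * r\<bar>)" by (intro mult_left_mono b1) auto
      also have "\<dots> = exp (m * r) + e * (r * exp (m * r)) + exp (m * r) * ((e * r)\<^sup>2 * exp \<bar>e * r\<bar>)"
        by (simp add: algebra_simps)
      also have "\<dots> \<le> exp (m * r) + e * (r + m * (r * r * exp \<bar>r\<bar>)) + e * e * (r * r * exp \<bar>r\<bar>)"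
        using b3 b4 e by (intro add_mono mult_left_mono) auto
      also have "\<dots> = exp (m * r) + e * r + (e * m') * (r * r * exp \<bar>r\<bar>)"
        by (simp add: e algebra_simps)
      finally show ?thesis by (simp add: r_def e_def v_def)
    qed
    have "exp (m' * (T_op m' t F x - c)) = gmean s (\<lambda>y. exp (m' * d y)) x" using E[of m'] False by simp
    also have "\<dots> \<le> gmean s (\<lambda>y. exp (m * d y) + (m' - m) * d y + ((m' - m) * m') * v y) x"
      by (intro gmean_mono e_growth exp_growth_add exp_growth_mult exp_growth_const d_growth v_growth pt)
    also have "\<dots> = gmean s (\<lambda>y. exp (m * d y)) x + (m' - m) * gmean s d x + ((m' - m) * m') * gmean s v x"
      by (simp add: gmean_add gmean_cmult e_growth exp_growth_add exp_growth_mult exp_growth_const d_growth v_growth)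
    also have "\<dots> \<le> 1 + ((m' - m) * m') * gmean s v x"
      using mean m by (simp add: norm mult_nonneg_nonpos)
    finally have "1 + m' * (T_op m' t F x - c) \<le> 1 + ((m' - m) * m') * gmean s v x"
      using exp_ge_add_one_self[of "m' * (T_op m' t F x - c)"] by linarith
    then have "m' * (T_op m' t F x - c) \<le> m' * ((m' - m) * gmean s v x)" by (simp add: mult_ac)
    then have 1: "T_op m' t F x - c \<le> (m' - m) * gmean s v x" using m' by simp
    have "gmean s v x \<le> (LINT z|gauss. s * s * ((\<bar>z\<bar> + C) * (\<bar>z\<bar> + C) * (exp (2 * C) * exp (2 * \<bar>z\<bar>))))"
      unfolding gmean_def
    proof (rule integral_mono)
      show "integrable gauss (\<lambda>z. v (x + s * z))" by (rule gmean_integrable[OF v_growth])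
      show "integrable gauss (\<lambda>z. s * s * ((\<bar>z\<bar> + C) * (\<bar>z\<bar> + C) * (exp (2 * C) * exp (2 * \<bar>z\<bar>))))"
        by (intro integrable_gauss_exp_growth exp_growth_mult exp_growth_add exp_growth_const
             exp_growth_abs_id exp_growth_exp_abs)
      fix z
      let ?r = "d (x + s * z)"
      have "\<bar>?r\<bar> \<le> \<bar>F (x + s * z) - F x\<bar> + \<bar>c - F x\<bar>" by (simp add: d_def)
      also have "\<dots> \<le> s * \<bar>z\<bar> + s * C"
        using tame_lipschitz[OF F, of "x + s * z" x] C(2)[OF F, of m t x] m t s
        by (intro add_mono) (auto simp: abs_mult c_def s_def mult.commute)
      finally have r: "\<bar>?r\<bar> \<le> s * (\<bar>z\<bar> + C)" by (simp add: algebra_simps)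
      have r2: "\<bar>?r\<bar> \<le> 2 * (\<bar>z\<bar> + C)"
        using r mult_right_mono[OF s(2), of "\<bar>z\<bar> + C"] C(1) by simp
      have "v (x + s * z) = \<bar>?r\<bar> * \<bar>?r\<bar> * exp \<bar>?r\<bar>" by (simp add: v_def)
      also have "\<dots> \<le> (s * (\<bar>z\<bar> + C)) * (s * (\<bar>z\<bar> + C)) * exp (2 * (\<bar>z\<bar> + C))"
        using r r2 s C(1) by (intro mult_mono) auto
      also have "\<dots> = s * s * ((\<bar>z\<bar> + C) * (\<bar>z\<bar> + C) * (exp (2 * C) * exp (2 * \<bar>z\<bar>)))"
        by (simp add: algebra_simps flip: exp_add)
      finally show "v (x + s * z) \<le> s * s * ((\<bar>z\<bar> + C) * (\<bar>z\<bar> + C) * (exp (2 * C) * exp (2 * \<bar>z\<bar>)))" .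
    qed
    also have "\<dots> = 2 * t * V" by (simp add: V_def s2)
    finally have "(m' - m) * gmean s v x \<le> (m' - m) * (2 * t * V)" using m by (intro mult_left_mono) auto
    with 1 show ?thesis by (simp add: c_def mult_ac)
  qed
  show thesis
  proof (rule that[of "2 * V"])
    show "0 \<le> 2 * V" using V0 by simp
    fix F :: "real \<Rightarrow> real" and m m' t x :: real
    assume a: "tame F" "0 \<le> m" "m \<le> 1" "0 \<le> m'" "m' \<le> 1" "0 \<le> t" "t \<le> (1::real)"
    show "\<bar>T_op m t F x - T_op m' t F x\<bar> \<le> 2 * V * \<bar>m - m'\<bar> * t"
    proof (cases "m \<le> m'")
      case True
      then have "\<bar>m - m'\<bar> = m' - m" by simp
      then show ?thesis using main[of F m m' t x] T_op_mono_exponent[of F m m' t x] a True by simp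
    next
      case False
      then have "\<bar>m - m'\<bar> = m - m'" by simp
      then show ?thesis using main[of F m' m t x] T_op_mono_exponent[of F m' m t x] a False by simp
    qed
  qed
qed

section \<open>The recursion on a time grid\<close>

text \<open>
  The Parisi recursion in the time variable: \<open>n\<close> steps of duration \<open>h\<close>, the \<open>j\<close>-th one
  with exponent \<open>w j\<close>. The exponents are listed in the order in which time increases, so \<open>w 0\<close> acts
  last.
\<close>

primrec T_chain :: "real \<Rightarrow> nat \<Rightarrow> (nat \<Rightarrow> real) \<Rightarrow> real \<Rightarrow> real" where
  "T_chain h 0 w = lncosh"
| "T_chain h (Suc n) w = T_op (w 0) h (T_chain h n (\<lambda>j. w (Suc j)))"

lemma tame_T_chain: "0 \<le> h \<Longrightarrow> (\<And>j. 0 \<le> w j) \<Longrightarrow> tame (T_chain h n w)"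
  by (induction n arbitrary: w) (auto intro: tame_lncosh tame_T_op)

text \<open>This provides the order between derivatives that the supermodular step assumes.\<close>

lemma deriv_T_chain_mono:
  assumes "0 \<le> h" "\<And>j. 0 \<le> v j" "\<And>j. v j \<le> w j" "0 \<le> x"
  shows "deriv (T_chain h n v) x \<le> deriv (T_chain h n w) x"
  using assms
proof (induction n arbitrary: v w x)
  case (Suc n)
  have w: "0 \<le> w j" for j using Suc.prems(2,3)[of j] by linarith
  show ?case
    unfolding T_chain.simps
    by (intro deriv_T_op_mono tame_T_chain Suc.IH Suc.prems w)
qed simp

text \<open>
  Induction over the steps. At each time one of the two exponents is the larger one; it is shared by
  the maximum and its own chain, the smaller one is shared by the minimum and the other chain.
\<close>

lemma T_chain_supermodular:
  assumes "0 \<le> h" "\<And>j. 0 \<le> v j" "\<And>j. 0 \<le> w j"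
  shows "T_chain h n v x + T_chain h n w x
    \<le> T_chain h n (\<lambda>j. max (v j) (w j)) x + T_chain h n (\<lambda>j. min (v j) (w j)) x"
  using assms
proof (induction n arbitrary: v w x)
  case (Suc n)
  let ?c = "T_chain h n"
  have step: "T_op (v 0) h (?c (\<lambda>j. v (Suc j))) x + T_op (w 0) h (?c (\<lambda>j. w (Suc j))) x
    \<le> T_op (v 0) h (?c (\<lambda>j. max (v (Suc j)) (w (Suc j)))) x
      + T_op (w 0) h (?c (\<lambda>j. min (v (Suc j)) (w (Suc j)))) x"
    if vw: "\<And>j. 0 \<le> v j" "\<And>j. 0 \<le> w j" "w 0 \<le> v 0" for v w
  proof -
    have "T_op (w 0) h (?c (\<lambda>j. w (Suc j))) x - T_op (w 0) h (?c (\<lambda>j. min (v (Suc j)) (w (Suc j)))) x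
       \<le> T_op (v 0) h (?c (\<lambda>j. max (v (Suc j)) (w (Suc j)))) x - T_op (v 0) h (?c (\<lambda>j. v (Suc j))) x"
    proof (rule T_op_supermodular_step)
      fix y
      show "?c (\<lambda>j. w (Suc j)) y - ?c (\<lambda>j. min (v (Suc j)) (w (Suc j))) y
        \<le> ?c (\<lambda>j. max (v (Suc j)) (w (Suc j))) y - ?c (\<lambda>j. v (Suc j)) y"
        using Suc.IH[of "\<lambda>j. v (Suc j)" "\<lambda>j. w (Suc j)" y] vw Suc.prems(1) by simp
    qed (auto intro!: tame_T_chain deriv_T_chain_mono Suc.prems(1) simp: vw le_max_iff_disj)
    then show ?thesis by linarith
  qed
  show ?case
  proof (cases "w 0 \<le> v 0")
    case True
    then show ?thesis using step[of v w] Suc.prems by (simp add: max_absorb1 min_absorb2)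
  next
    case False
    then have "v 0 \<le> w 0" by simp
    then show ?thesis using step[of w v] Suc.prems
      by (simp add: max_absorb2 min_absorb1 max.commute[of "w _"] min.commute[of "w _"] add.commute)
  qed
qed simp

text \<open>The operator is monotone and commutes with the addition of constants.\<close>

lemma T_chain_gap:
  assumes "0 \<le> h" "\<And>j. 0 \<le> v j" "\<And>j. 0 \<le> w j" "\<And>j. j < b \<Longrightarrow> v j = w j"
    and "\<And>y. T_chain h n (\<lambda>j. v (j + b)) y + c \<le> T_chain h n (\<lambda>j. w (j + b)) y"
  shows "T_chain h (b + n) v x + c \<le> T_chain h (b + n) w x"
  using assms
proof (induction b arbitrary: v w x)
  case (Suc b)
  have IH: "T_chain h (b + n) (\<lambda>j. v (Suc j)) y + c \<le> T_chain h (b + n) (\<lambda>j. w (Suc j)) y" for y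
    by (rule Suc.IH) (use Suc.prems in auto)
  have gv: "tame (T_chain h (b + n) (\<lambda>j. v (Suc j)))" by (intro tame_T_chain Suc.prems)
  have "T_op (v 0) h (T_chain h (b + n) (\<lambda>j. v (Suc j))) x + c
      = T_op (v 0) h (\<lambda>y. T_chain h (b + n) (\<lambda>j. v (Suc j)) y + c) x"
    by (rule T_op_add_const[OF gv, symmetric])
  also have "\<dots> \<le> T_op (v 0) h (T_chain h (b + n) (\<lambda>j. w (Suc j))) x"
    by (intro T_op_mono tame_add_const gv IH tame_T_chain Suc.prems)
  finally show ?case using Suc.prems(4)[of 0] by simp
qed simp

text \<open>
  Supermodularity where the second chain is delayed by \<open>b\<close> steps. Up to the delay the chains of \<open>v\<close> and of the
  maximum use the same exponents, so the gap between them does not fall below its infimum; and the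
  gap between \<open>w\<close> and the minimum is smallest at \<open>0\<close>, where it is evaluated.
\<close>

lemma T_chain_translation_supermodular:
  assumes h: "0 \<le> h" and v: "\<And>j. 0 \<le> v j" and w: "\<And>j. 0 \<le> w j"
  shows "T_chain h (b + n) v 0 + T_chain h n w 0
    \<le> T_chain h n (\<lambda>j. min (v (j + b)) (w j)) 0
      + T_chain h (b + n) (\<lambda>j. if j < b then v j else max (v j) (w (j - b))) 0"
proof -
  define A B U L where "A = T_chain h n (\<lambda>j. v (j + b))" and "B = T_chain h n w"
    and "U = T_chain h n (\<lambda>j. max (v (j + b)) (w j))" and "L = T_chain h n (\<lambda>j. min (v (j + b)) (w j))"
  have "evmono (\<lambda>y. B y - L y)"
    unfolding B_def L_def by (intro evmono_diff tame_T_chain deriv_T_chain_mono h) (auto simp: v w)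
  then have BL: "B 0 - L 0 \<le> B y - L y" for y by (rule evmonoD) simp
  have "A y + B y \<le> U y + L y" for y
    unfolding A_def B_def U_def L_def by (intro T_chain_supermodular h v w)
  with BL have gap: "A y + (B 0 - L 0) \<le> U y" for y by (smt (verit))
  have "T_chain h (b + n) v 0 + (B 0 - L 0)
     \<le> T_chain h (b + n) (\<lambda>j. if j < b then v j else max (v j) (w (j - b))) 0"
    by (rule T_chain_gap) (use gap h v w in \<open>auto simp: A_def U_def le_max_iff_disj\<close>)
  then show ?thesis unfolding B_def L_def by linarith
qed

lemma T_chain_lipschitz:
  obtains K where "K \<ge> 0"
    "\<And>h n v w x. 0 \<le> h \<Longrightarrow> h \<le> 1 \<Longrightarrow> (\<And>j. v j \<in> {0..1}) \<Longrightarrow> (\<And>j. w j \<in> {0..1}) \<Longrightarrow>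
       \<bar>T_chain h n v x - T_chain h n w x\<bar> \<le> K * (\<Sum>j<n. h * \<bar>v j - w j\<bar>)"
proof -
  obtain K where K: "K \<ge> 0"
    "\<And>F m m' t x. tame F \<Longrightarrow> 0 \<le> m \<Longrightarrow> m \<le> 1 \<Longrightarrow> 0 \<le> m' \<Longrightarrow> m' \<le> 1 \<Longrightarrow> 0 \<le> t \<Longrightarrow> t \<le> 1 \<Longrightarrow>
       \<bar>T_op m t F x - T_op m' t F x\<bar> \<le> K * \<bar>m - m'\<bar> * t"
    using T_op_lipschitz_exponent by blast
  have "\<bar>T_chain h n v x - T_chain h n w x\<bar> \<le> K * (\<Sum>j<n. h * \<bar>v j - w j\<bar>)"
    if "0 \<le> h" "h \<le> 1" "\<And>j. v j \<in> {0..1}" "\<And>j. w j \<in> {0..1}" for h n v w x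
    using that(3,4)
  proof (induction n arbitrary: v w x)
    case (Suc n)
    let ?V = "T_chain h n (\<lambda>j. v (Suc j))" and ?W = "T_chain h n (\<lambda>j. w (Suc j))"
    have b: "0 \<le> v j" "v j \<le> 1" "0 \<le> w j" "w j \<le> 1" for j
      using Suc.prems[of j] by auto
    have g: "tame ?V" "tame ?W" by (intro tame_T_chain that b)+
    have "\<bar>T_op (v 0) h ?V x - T_op (v 0) h ?W x\<bar> \<le> K * (\<Sum>j<n. h * \<bar>v (Suc j) - w (Suc j)\<bar>)"
      by (intro T_op_nonexpansive g b Suc.IH) (use Suc.prems in auto)
    moreover have "\<bar>T_op (v 0) h ?W x - T_op (w 0) h ?W x\<bar> \<le> K * \<bar>v 0 - w 0\<bar> * h"
      by (intro K g b that)
    moreover have "(\<Sum>j<Suc n. h * \<bar>v j - w j\<bar>) = h * \<bar>v 0 - w 0\<bar> + (\<Sum>j<n. h * \<bar>v (Suc j) - w (Suc j)\<bar>)"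
      by (rule sum.lessThan_Suc_shift)
    ultimately show ?case by (simp add: algebra_simps)
  qed simp
  with K(1) show thesis using that by blast
qed

text \<open>The semigroup property, iterated.\<close>

lemma T_chain_constant_block:
  assumes "0 \<le> h" "\<And>j. 0 \<le> w j" "0 \<le> m" "\<And>j. j < r \<Longrightarrow> w j = m"
  shows "T_chain h (r + n) w = T_op m (real r * h) (T_chain h n (\<lambda>j. w (j + r)))"
  using assms
proof (induction r arbitrary: w)
  case 0
  then show ?case by (simp add: T_op_refl tame_T_chain)
next
  case (Suc r)
  have "T_chain h (r + n) (\<lambda>j. w (Suc j)) = T_op m (real r * h) (T_chain h n (\<lambda>j. w (Suc (j + r))))"
    by (rule Suc.IH) (use Suc.prems in auto)
  moreover have "T_op m h (T_op m (real r * h) (T_chain h n (\<lambda>j. w (Suc (j + r)))))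
      = T_op m (h + real r * h) (T_chain h n (\<lambda>j. w (Suc (j + r))))"
    by (intro T_op_semigroup tame_T_chain) (use Suc.prems in auto)
  ultimately show ?case using Suc.prems(4)[of 0] by (simp add: algebra_simps)
qed

lemma T_chain_ones:
  assumes "0 \<le> h" "\<And>j. j < n \<Longrightarrow> w j = 1" "\<And>j. 0 \<le> w j"
  shows "T_chain h n w x = lncosh x + real n * h"
  using T_chain_constant_block[of h w 1 n 0] T_op_1_lncosh[of "real n * h" x] assms by simp

section \<open>Distribution functions of monotone paths\<close>

text \<open>
  A class closed under pointwise maxima, minima and convex combinations, in which every sublevel set
  is an initial segment of the unit interval.
\<close>

definition monotone_paths :: "(real \<Rightarrow> real) set" where
  "monotone_paths = {q. mono_on {0..<1} q \<and> (\<forall>s\<in>{0..<1}. 0 \<le> q s) \<and> set_integrable lborel {0..<1} q}"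

definition sublevel :: "(real \<Rightarrow> real) \<Rightarrow> real \<Rightarrow> real set" where
  "sublevel p \<tau> = {s \<in> {0..<1}. p s \<le> \<tau>}"

text \<open>
  The generalised inverse of the path: its value at \<open>\<tau>\<close> is the exponent that the Parisi recursion uses at time
  \<open>\<tau>\<close>.
\<close>

definition path_cdf :: "(real \<Rightarrow> real) \<Rightarrow> real \<Rightarrow> real" where
  "path_cdf p \<tau> = measure lborel (sublevel p \<tau>)"

lemma monotone_pathsD:
  assumes "q \<in> monotone_paths"
  shows "mono_on {0..<1} q" "0 \<le> s \<Longrightarrow> s < 1 \<Longrightarrow> 0 \<le> q s" "set_integrable lborel {0..<1} q"
  using assms by (auto simp: monotone_paths_def)

lemma sublevel_measurable:
  assumes "p \<in> monotone_paths"
  shows "sublevel p \<tau> \<in> sets lborel"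
proof -
  have [measurable]: "(\<lambda>s. indicator {0..<1} s *\<^sub>R p s) \<in> borel_measurable lborel"
    using monotone_pathsD(3)[OF assms] by (auto simp: set_integrable_def)
  have "sublevel p \<tau> = {0..<1} \<inter> {s \<in> space lborel. indicator {0..<1} s *\<^sub>R p s \<le> \<tau>}"
    by (auto simp: sublevel_def)
  also have "\<dots> \<in> sets lborel" by measurable
  finally show ?thesis .
qed

lemma fmeasurable_unit: "{0..<1::real} \<in> fmeasurable lborel"
  by (rule fmeasurableI) auto

lemma sublevel_fmeasurable: "p \<in> monotone_paths \<Longrightarrow> sublevel p \<tau> \<in> fmeasurable lborel"
  by (rule fmeasurableI2[OF fmeasurable_unit _ sublevel_measurable]) (auto simp: sublevel_def)

lemma path_cdf_bounds:
  assumes "p \<in> monotone_paths"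
  shows "path_cdf p \<tau> \<in> {0..1}"
proof -
  have "measure lborel (sublevel p \<tau>) \<le> measure lborel {0..<1::real}"
    by (rule measure_mono_fmeasurable[OF _ sublevel_measurable[OF assms] fmeasurable_unit])
       (auto simp: sublevel_def)
  then show ?thesis by (simp add: path_cdf_def)
qed

text \<open>Sublevel sets of monotone functions are initial segments.\<close>

lemma sublevel_nested:
  assumes "p \<in> monotone_paths" "q \<in> monotone_paths"
  shows "sublevel p \<tau> \<subseteq> sublevel q \<sigma> \<or> sublevel q \<sigma> \<subseteq> sublevel p \<tau>"
proof (rule ccontr)
  assume "\<not> ?thesis"
  then obtain s t where st: "s \<in> sublevel p \<tau>" "s \<notin> sublevel q \<sigma>" "t \<in> sublevel q \<sigma>" "t \<notin> sublevel p \<tau>"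
    by blast
  then have *: "s \<in> {0..<1}" "t \<in> {0..<1}" "p s \<le> \<tau>" "\<tau> < p t" "q t \<le> \<sigma>" "\<sigma> < q s"
    by (auto simp: sublevel_def)
  then have "\<not> t \<le> s" "\<not> s \<le> t"
    using mono_onD[OF monotone_pathsD(1)[OF assms(1)], of t s] mono_onD[OF monotone_pathsD(1)[OF assms(2)], of s t] by force+
  then show False by simp
qed

text \<open>
  Because sublevel sets are nested, the pointwise maximum and minimum of two paths become the
  minimum and maximum of their distribution functions.
\<close>

lemma measure_sublevel_inter:
  assumes "p \<in> monotone_paths" "q \<in> monotone_paths"
  shows "measure lborel (sublevel p \<tau> \<inter> sublevel q \<sigma>) = min (path_cdf p \<tau>) (path_cdf q \<sigma>)"
    and "measure lborel (sublevel p \<tau> \<union> sublevel q \<sigma>) = max (path_cdf p \<tau>) (path_cdf q \<sigma>)"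
proof -
  have "measure lborel (sublevel p \<tau> \<inter> sublevel q \<sigma>) = min (path_cdf p \<tau>) (path_cdf q \<sigma>) \<and>
    measure lborel (sublevel p \<tau> \<union> sublevel q \<sigma>) = max (path_cdf p \<tau>) (path_cdf q \<sigma>)"
    using sublevel_nested[OF assms, of \<tau> \<sigma>]
  proof
    assume sub: "sublevel p \<tau> \<subseteq> sublevel q \<sigma>"
    then have "path_cdf p \<tau> \<le> path_cdf q \<sigma>" unfolding path_cdf_def
      by (intro measure_mono_fmeasurable sublevel_fmeasurable sublevel_measurable assms)
    then show ?thesis using sub by (simp add: path_cdf_def Int_absorb2 Un_absorb1)
  next
    assume sub: "sublevel q \<sigma> \<subseteq> sublevel p \<tau>"
    then have "path_cdf q \<sigma> \<le> path_cdf p \<tau>" unfolding path_cdf_def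
      by (intro measure_mono_fmeasurable sublevel_fmeasurable sublevel_measurable assms)
    then show ?thesis using sub by (simp add: path_cdf_def Int_absorb1 Un_absorb2)
  qed
  then show "measure lborel (sublevel p \<tau> \<inter> sublevel q \<sigma>) = min (path_cdf p \<tau>) (path_cdf q \<sigma>)"
    and "measure lborel (sublevel p \<tau> \<union> sublevel q \<sigma>) = max (path_cdf p \<tau>) (path_cdf q \<sigma>)" by auto
qed

text \<open>
  The functional on the time grid of mesh \<open>h\<close> with horizon \<open>N * h\<close>. It is defined from the path alone
  and for every monotone path, not through a representation.
\<close>

definition grid_psi :: "real \<Rightarrow> nat \<Rightarrow> (real \<Rightarrow> real) \<Rightarrow> real" where
  "grid_psi h N p = real N * h - T_chain h N (\<lambda>j. path_cdf p (real j * h)) 0"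

text \<open>
  Translation submodularity (\<open>L\<close>-natural convexity) on the grid. Raising \<open>q\<close> by \<open>\<beta> = b * h\<close> delays its
  exponents by \<open>b\<close> steps, the exponent being \<open>0\<close> before; the horizons differ by \<open>b\<close> accordingly.
\<close>

lemma grid_psi_translation_submodular:
  assumes p: "p \<in> monotone_paths" and q: "q \<in> monotone_paths" and h: "0 < h" and \<beta>: "\<beta> = real b * h"
  shows "grid_psi h n (\<lambda>s. max (p s - \<beta>) (q s)) + grid_psi h (b + n) (\<lambda>s. min (p s) (q s + \<beta>))
    \<le> grid_psi h (b + n) p + grid_psi h n q"
proof -
  let ?v = "\<lambda>j. path_cdf p (real j * h)" and ?w = "\<lambda>j. path_cdf q (real j * h)"
  have "path_cdf (\<lambda>s. max (p s - \<beta>) (q s)) (real j * h) = min (?v (j + b)) (?w j)" for j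
  proof -
    have "sublevel (\<lambda>s. max (p s - \<beta>) (q s)) (real j * h) = sublevel p (real (j + b) * h) \<inter> sublevel q (real j * h)"
      by (auto simp: sublevel_def \<beta> algebra_simps)
    then show ?thesis by (simp only: path_cdf_def[of "\<lambda>s. max (p s - \<beta>) (q s)"] measure_sublevel_inter[OF p q])
  qed
  moreover have "path_cdf (\<lambda>s. min (p s) (q s + \<beta>)) (real j * h) = (if j < b then ?v j else max (?v j) (?w (j - b)))" for j
  proof (cases "j < b")
    case True
    then have "real j * h < real b * h" using h by simp
    then have "sublevel (\<lambda>s. min (p s) (q s + \<beta>)) (real j * h) = sublevel p (real j * h)"
      using monotone_pathsD(2)[OF q] by (force simp: sublevel_def \<beta> min_le_iff_disj)
    then show ?thesis using True by (simp add: path_cdf_def)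
  next
    case False
    then have "sublevel (\<lambda>s. min (p s) (q s + \<beta>)) (real j * h) = sublevel p (real j * h) \<union> sublevel q (real (j - b) * h)"
      by (auto simp: sublevel_def \<beta> min_le_iff_disj of_nat_diff algebra_simps)
    then show ?thesis using False
      by (simp only: path_cdf_def[of "\<lambda>s. min (p s) (q s + \<beta>)"] measure_sublevel_inter[OF p q]) auto
  qed
  ultimately show ?thesis
    using T_chain_translation_supermodular[of h ?v ?w b n] path_cdf_bounds[OF p] path_cdf_bounds[OF q] h
    unfolding grid_psi_def by simp
qed

section \<open>Dependence on the path in the mean\<close>

lemma nat_ceiling_le_iff:
  assumes "0 < h"
  shows "nat \<lceil>u / h\<rceil> \<le> j \<longleftrightarrow> u \<le> real j * h"
  using assms by (simp add: nat_le_iff ceiling_le_iff divide_le_eq)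

lemma nat_ceiling_grid:
  assumes "0 < h" "0 \<le> x"
  shows "x \<le> real (nat \<lceil>x / h\<rceil>) * h" "real (nat \<lceil>x / h\<rceil>) * h \<le> x + h"
proof -
  show "x \<le> real (nat \<lceil>x / h\<rceil>) * h" using nat_ceiling_le_iff[OF assms(1), of x] by blast
  have "0 \<le> \<lceil>x / h\<rceil>" using assms by (simp add: zero_le_ceiling less_le_trans[of _ 0])
  then have "real (nat \<lceil>x / h\<rceil>) \<le> x / h + 1" by (simp; linarith)
  then show "real (nat \<lceil>x / h\<rceil>) * h \<le> x + h" using assms by (simp add: field_simps)
qed

lemma sum_of_bool_diff_le:
  "(\<Sum>j<n. \<bar>of_bool (a \<le> j) - of_bool (b \<le> j)\<bar>) \<le> \<bar>real a - real b\<bar>"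
proof -
  have main: "(\<Sum>j<n. \<bar>of_bool (a \<le> j) - of_bool (b \<le> j)\<bar> :: real) \<le> real b - real a" if "a \<le> b" for a b :: nat
  proof -
    have "(\<Sum>j<n. \<bar>of_bool (a \<le> j) - of_bool (b \<le> j)\<bar> :: real) = (\<Sum>j<n. of_bool (j \<in> {a..<b}))"
      using that by (intro sum.cong) (auto simp: of_bool_def)
    also have "\<dots> = real (card ({..<n} \<inter> {a..<b}))"
      by (simp add: of_bool_def sum.If_cases atLeastLessThan_def lessThan_def atLeast_def Collect_conj_eq)
    also have "\<dots> \<le> real (card {a..<b})" by (intro of_nat_mono card_mono) auto
    finally show ?thesis using that by (simp add: of_nat_diff)
  qed
  show ?thesis
  proof (cases "a \<le> b")
    case True
    then show ?thesis using main[of a b] by simp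
  next
    case False
    then show ?thesis using main[of b a] by (simp add: abs_minus_commute)
  qed
qed

text \<open>The grid points between \<open>u\<close> and \<open>v\<close> number at most \<open>\<bar>u - v\<bar> / h + 1\<close>.\<close>

lemma sum_threshold_diff_le:
  fixes u v h :: real
  assumes h: "0 < h" and uv: "0 \<le> u" "0 \<le> v"
  shows "(\<Sum>j<n. h * \<bar>of_bool (u \<le> real j * h) - of_bool (v \<le> real j * h)\<bar>) \<le> \<bar>u - v\<bar> + h"
proof -
  define a b where "a = nat \<lceil>u / h\<rceil>" and "b = nat \<lceil>v / h\<rceil>"
  have ab: "u \<le> real a * h" "real a * h \<le> u + h" "v \<le> real b * h" "real b * h \<le> v + h"
    unfolding a_def b_def using nat_ceiling_grid[OF h] uv by auto
  have "(\<Sum>j<n. h * \<bar>of_bool (u \<le> real j * h) - of_bool (v \<le> real j * h)\<bar>)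
    = h * (\<Sum>j<n. \<bar>of_bool (a \<le> j) - of_bool (b \<le> j)\<bar>)"
    unfolding a_def b_def nat_ceiling_le_iff[OF h] by (simp add: sum_distrib_left)
  also have "\<dots> \<le> h * \<bar>real a - real b\<bar>" using h by (intro mult_left_mono sum_of_bool_diff_le) auto
  also have "\<dots> = \<bar>real a * h - real b * h\<bar>" using h by (simp add: abs_mult flip: left_diff_distrib)
  also have "\<dots> \<le> \<bar>u - v\<bar> + h" using ab by (auto simp: abs_if)
  finally show ?thesis .
qed

lemma L1_dist_integrable:
  assumes "p \<in> monotone_paths" "q \<in> monotone_paths"
  shows "set_integrable lborel {0..<1} (\<lambda>s. \<bar>p s - q s\<bar>)"
  by (intro set_integrable_abs set_integral_diff monotone_pathsD assms)

lemma integrable_unit_const: "set_integrable lborel {0..<1::real} (\<lambda>_. c :: real)"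
  by (simp add: set_integrable_def)

text \<open>
  The area between two graphs is the same whether measured along \<open>s\<close> or along \<open>\<tau>\<close>; on the
  grid this costs an extra \<open>h\<close>.
\<close>

lemma sum_path_cdf_diff_le:
  assumes p: "p \<in> monotone_paths" and q: "q \<in> monotone_paths" and h: "0 < h"
  shows "(\<Sum>j<n. h * \<bar>path_cdf p (real j * h) - path_cdf q (real j * h)\<bar>) \<le> L1_dist p q + h"
proof -
  let ?d = "\<lambda>j s. \<bar>indicator (sublevel p (real j * h)) s - indicator (sublevel q (real j * h)) s :: real\<bar>"
  have int: "integrable lborel (indicator (sublevel r \<tau>) :: real \<Rightarrow> real)" if "r \<in> monotone_paths" for r \<tau>
    using sublevel_fmeasurable[OF that, of \<tau>] by (auto simp: fmeasurable_def)
  have dint: "integrable lborel (?d j)" for j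
    by (intro integrable_abs Bochner_Integration.integrable_diff int p q)
  have lev: "\<bar>path_cdf p (real j * h) - path_cdf q (real j * h)\<bar> \<le> (LINT s|lborel. ?d j s)" for j
  proof -
    have "path_cdf p (real j * h) - path_cdf q (real j * h)
      = (LINT s|lborel. indicator (sublevel p (real j * h)) s - indicator (sublevel q (real j * h)) s)"
      using int[OF p] int[OF q] by (simp add: path_cdf_def)
    then show ?thesis by (metis integral_abs_bound)
  qed
  have "(\<Sum>j<n. h * \<bar>path_cdf p (real j * h) - path_cdf q (real j * h)\<bar>) \<le> (\<Sum>j<n. h * (LINT s|lborel. ?d j s))"
    using h by (intro sum_mono mult_left_mono lev) auto
  also have "\<dots> = (LINT s|lborel. (\<Sum>j<n. h * ?d j s))"
    using dint by simp
  also have "\<dots> \<le> (LINT s|lborel. indicator {0..<1} s *\<^sub>R (\<bar>p s - q s\<bar> + h))"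
  proof (rule integral_mono)
    show "integrable lborel (\<lambda>s. \<Sum>j<n. h * ?d j s)" using dint by simp
    show "integrable lborel (\<lambda>s. indicator {0..<1} s *\<^sub>R (\<bar>p s - q s\<bar> + h))"
      using set_integral_add(1)[OF L1_dist_integrable[OF p q] integrable_unit_const[of h]]
      by (simp add: set_integrable_def)
    fix s
    show "(\<Sum>j<n. h * ?d j s) \<le> indicator {0..<1} s *\<^sub>R (\<bar>p s - q s\<bar> + h)"
    proof (cases "s \<in> {0..<1}")
      case True
      then have "?d j s = \<bar>of_bool (p s \<le> real j * h) - of_bool (q s \<le> real j * h)\<bar>" for j
        by (auto simp: sublevel_def indicator_def)
      then show ?thesis using True monotone_pathsD(2)[OF p, of s] monotone_pathsD(2)[OF q, of s]
          sum_threshold_diff_le[OF h, of "p s" "q s" n] by simp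
    next
      case False
      then show ?thesis by (auto simp: sublevel_def indicator_def)
    qed
  qed
  also have "\<dots> = L1_dist p q + h"
    using set_integral_add(2)[OF L1_dist_integrable[OF p q] integrable_unit_const[of h]]
    by (simp add: L1_dist_def set_lebesgue_integral_def)
  finally show ?thesis .
qed

lemma grid_psi_lipschitz:
  obtains K where "K \<ge> 0"
    "\<And>h n p q. 0 < h \<Longrightarrow> h \<le> 1 \<Longrightarrow> p \<in> monotone_paths \<Longrightarrow> q \<in> monotone_paths \<Longrightarrow>
       \<bar>grid_psi h n p - grid_psi h n q\<bar> \<le> K * (L1_dist p q + h)"
proof -
  obtain K where K: "K \<ge> 0"
    "\<And>h n v w x. 0 \<le> h \<Longrightarrow> h \<le> 1 \<Longrightarrow> (\<And>j. v j \<in> {0..1}) \<Longrightarrow> (\<And>j. w j \<in> {0..1}) \<Longrightarrow>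
       \<bar>T_chain h n v x - T_chain h n w x\<bar> \<le> K * (\<Sum>j<n. h * \<bar>v j - w j\<bar>)"
    using T_chain_lipschitz by blast
  show thesis
  proof (rule that[OF K(1)])
    fix h :: real and n p q
    assume h: "0 < h" "h \<le> 1" and pq: "p \<in> monotone_paths" "q \<in> monotone_paths"
    have "\<bar>grid_psi h n p - grid_psi h n q\<bar> \<le> K * (\<Sum>j<n. h * \<bar>path_cdf p (real j * h) - path_cdf q (real j * h)\<bar>)"
      using K(2)[of h "\<lambda>j. path_cdf p (real j * h)" "\<lambda>j. path_cdf q (real j * h)" n 0] h
        path_cdf_bounds[OF pq(1)] path_cdf_bounds[OF pq(2)] by (simp add: grid_psi_def abs_minus_commute)
    also have "\<dots> \<le> K * (L1_dist p q + h)"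
      by (intro mult_left_mono sum_path_cdf_diff_le pq h K)
    finally show "\<bar>grid_psi h n p - grid_psi h n q\<bar> \<le> K * (L1_dist p q + h)" .
  qed
qed

section \<open>Paths with finitely many values\<close>

lemma step_rep_strict:
  assumes "step_rep p k m a" "i < j" "j \<le> k + 1"
  shows "m i < m j"
  using assms(2,3)
proof (induction j)
  case (Suc j)
  have "m j < m (Suc j)" using assms(1) Suc.prems by (auto simp: step_rep_def)
  then show ?case using Suc by (cases "i = j") auto
qed simp

lemma step_rep_le:
  assumes "step_rep p k m a" "i \<le> j" "j \<le> k + 1"
  shows "m i \<le> m j"
  using step_rep_strict[OF assms(1), of i j] assms(2,3) by (cases "i = j") auto

lemma step_rep_weight:
  assumes "step_rep p k m a" "i \<le> k + 1"
  shows "0 \<le> m i" "m i \<le> 1"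
  using step_rep_le[OF assms(1), of 0 i] step_rep_le[OF assms(1), of i "k + 1"] assms
  by (auto simp: step_rep_def)

lemma step_rep_values_mono:
  assumes "step_rep p k m a" "i \<le> j" "j \<le> k"
  shows "a i \<le> a j"
  using assms(2,3)
proof (induction j)
  case (Suc j)
  have "a j \<le> a (Suc j)" using assms(1) Suc.prems by (auto simp: step_rep_def)
  then show ?case using Suc by (cases "i = Suc j") auto
qed simp

lemma step_rep_values_nonneg:
  assumes "step_rep p k m a" "i \<le> k"
  shows "0 \<le> a i"
  using step_rep_values_mono[OF assms(1), of 0 i] assms by (auto simp: step_rep_def)

lemma step_rep_value:
  assumes "step_rep p k m a" "i \<le> k" "m i \<le> s" "s < m (i + 1)"
  shows "p s = a i"
proof -
  have s: "s \<in> {0..<1}"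
    using assms step_rep_weight[OF assms(1), of i] step_rep_weight[OF assms(1), of "i + 1"] by auto
  have "a j * indicator {m j..<m (j + 1)} s = (if j = i then a i else 0)" if "j \<le> k" for j
  proof (cases j i rule: linorder_cases)
    case less
    then have "m (j + 1) \<le> m i" using assms by (intro step_rep_le[OF assms(1)]) auto
    then show ?thesis using less assms by auto
  next
    case greater
    then have "m (i + 1) \<le> m j" using assms that by (intro step_rep_le[OF assms(1)]) auto
    then show ?thesis using greater assms by auto
  next
    case equal
    then show ?thesis using assms by auto
  qed
  then have "(\<Sum>j\<le>k. a j * indicator {m j..<m (j + 1)} s) = (\<Sum>j\<le>k. if j = i then a i else 0)"
    by (intro sum.cong) auto
  also have "\<dots> = a i" using assms(2) by simp
  finally show ?thesis using assms(1) s by (auto simp: step_rep_def)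
qed

lemma step_rep_cover:
  assumes "step_rep p k m a" "0 \<le> s" "s < 1"
  obtains i where "i \<le> k" "m i \<le> s" "s < m (i + 1)"
proof -
  define i where "i = Max {i. i \<le> k \<and> m i \<le> s}"
  have fin: "finite {i. i \<le> k \<and> m i \<le> s}" by simp
  moreover have ne: "0 \<in> {i. i \<le> k \<and> m i \<le> s}" using assms by (auto simp: step_rep_def)
  ultimately have i: "i \<le> k" "m i \<le> s"
    using Max_in[of "{i. i \<le> k \<and> m i \<le> s}"] unfolding i_def by blast+
  have "s < m (i + 1)"
  proof (cases "i = k")
    case True
    then show ?thesis using assms by (auto simp: step_rep_def)
  next
    case False
    show ?thesis
    proof (rule ccontr)
      assume "\<not> s < m (i + 1)"
      then have "i + 1 \<in> {i. i \<le> k \<and> m i \<le> s}" using i False by auto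
      then have "i + 1 \<le> i" using Max_ge[OF fin, of "i + 1"] by (simp add: i_def)
      then show False by simp
    qed
  qed
  with i show ?thesis using that by blast
qed

lemma step_rep_monotone_paths:
  assumes st: "step_rep p k m a"
  shows "p \<in> monotone_paths"
  unfolding monotone_paths_def
proof (intro CollectI conjI ballI mono_onI)
  fix s t :: real assume st': "s \<in> {0..<1}" "t \<in> {0..<1}" "s \<le> t"
  obtain i where i: "i \<le> k" "m i \<le> s" "s < m (i + 1)" using step_rep_cover[OF st, of s] st' by auto
  obtain j where j: "j \<le> k" "m j \<le> t" "t < m (j + 1)" using step_rep_cover[OF st, of t] st' by auto
  have "i \<le> j"
  proof (rule ccontr)
    assume "\<not> i \<le> j"
    then have "m (j + 1) \<le> m i" using i by (intro step_rep_le[OF st]) auto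
    then show False using i j st' by linarith
  qed
  then show "p s \<le> p t"
    using step_rep_value[OF st i] step_rep_value[OF st j] step_rep_values_mono[OF st, of i j] j by simp
next
  fix s :: real assume s: "s \<in> {0..<1}"
  obtain i where i: "i \<le> k" "m i \<le> s" "s < m (i + 1)" using step_rep_cover[OF st, of s] s by auto
  then show "0 \<le> p s" using step_rep_value[OF st i] step_rep_values_nonneg[OF st] by simp
next
  have "set_integrable lborel {0..<1} (\<lambda>s. \<Sum>i\<le>k. a i * indicator {m i..<m (i + 1)} s)"
    unfolding set_integrable_def
  proof (rule integrable_mult_indicator)
    show "integrable lborel (\<lambda>s. \<Sum>i\<le>k. a i * indicator {m i..<m (i + 1)} s)"
      by (intro Bochner_Integration.integrable_sum integrable_mult_right)
         (auto intro!: integrable_real_indicator emeasure_bounded_finite)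
  qed simp
  moreover have "p s = (\<Sum>i\<le>k. a i * indicator {m i..<m (i + 1)} s)" if "s \<in> {0..<1}" for s
    using st that by (auto simp: step_rep_def)
  ultimately show "set_integrable lborel {0..<1} p"
    by (subst set_integrable_cong[OF refl]) auto
qed

text \<open>The sublevel set is the union of the first \<open>i\<close> intervals; \<open>i = k + 1\<close> stands for a level above all values.\<close>

lemma step_rep_path_cdf:
  assumes st: "step_rep p k m a" and i: "i \<le> k + 1"
    and lo: "\<And>l. l < i \<Longrightarrow> a l \<le> \<tau>" and hi: "i \<le> k \<Longrightarrow> \<tau> < a i"
  shows "path_cdf p \<tau> = m i"
proof -
  have mi: "0 \<le> m i" "m i \<le> 1" using step_rep_weight[OF st i] .
  have "sublevel p \<tau> = {0..<m i}"
  proof (intro set_eqI iffI)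
    fix s assume s: "s \<in> sublevel p \<tau>"
    then have s01: "0 \<le> s" "s < 1" "p s \<le> \<tau>" by (auto simp: sublevel_def)
    obtain l where l: "l \<le> k" "m l \<le> s" "s < m (l + 1)" using step_rep_cover[OF st s01(1,2)] .
    have "l < i"
    proof (rule ccontr)
      assume "\<not> l < i"
      then have "a i \<le> a l" using l by (intro step_rep_values_mono[OF st]) auto
      then show False using hi l step_rep_value[OF st l] s01 \<open>\<not> l < i\<close> by auto
    qed
    then have "m (l + 1) \<le> m i" using i by (intro step_rep_le[OF st]) auto
    then show "s \<in> {0..<m i}" using s01 l by auto
  next
    fix s assume s: "s \<in> {0..<m i}"
    then have s01: "0 \<le> s" "s < 1" using mi by auto
    obtain l where l: "l \<le> k" "m l \<le> s" "s < m (l + 1)" using step_rep_cover[OF st s01] .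
    have "l < i"
    proof (rule ccontr)
      assume "\<not> l < i"
      then have "m i \<le> m l" using l by (intro step_rep_le[OF st]) auto
      then show False using l s by auto
    qed
    then show "s \<in> sublevel p \<tau>" using lo[of l] step_rep_value[OF st l] s01 by (auto simp: sublevel_def)
  qed
  then show ?thesis using mi by (simp add: path_cdf_def)
qed

lemma parisi_f_above: "parisi_f k m a (Suc k) = lncosh"
  by (subst parisi_f.simps) simp

lemma parisi_f_step:
  "i \<le> k \<Longrightarrow> parisi_f k m a i = T_op (m i) (a i - (if i = 0 then 0 else a (i - 1))) (parisi_f k m a (i + 1))"
  by (subst parisi_f.simps) simp

lemma tame_parisi_f:
  assumes m: "\<And>i. i \<le> k \<Longrightarrow> 0 \<le> m i"
    and a: "\<And>i. i \<le> k \<Longrightarrow> (if i = 0 then 0 else a (i - 1)) \<le> a i" and i: "i \<le> Suc k"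
  shows "tame (parisi_f k m a i)"
  using i
proof (induction i rule: inc_induct)
  case base
  then show ?case by (simp add: parisi_f_above tame_lncosh)
next
  case (step i)
  then have "i \<le> k" by simp
  then show ?case using step.IH m[of i] a[of i] by (simp add: parisi_f_step tame_T_op)
qed

text \<open>
  On the grid the path with values \<open>a i\<close> has the exponents of the path whose values are rounded up to multiples of
  \<open>h\<close>, and for the latter the chain groups into blocks that are exactly the Parisi recursion.
\<close>

lemma grid_psi_step_rep_grid:
  assumes st: "step_rep p k m a" and h: "0 < h" and c: "\<And>i. c i = nat \<lceil>a i / h\<rceil>" and N: "c k \<le> N"
  shows "grid_psi h N p = real (c k) * h - parisi_f k m (\<lambda>i. real (c i) * h) 0 0"
proof -
  define v where "v j = path_cdf p (real j * h)" for j
  \<comment> \<open>The step at which the \<open>i\<close>-th block starts; the first one starts at time zero, like the convention for the value preceding \<open>a 0\<close>.\<close>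
  define s where "s i = (if i = 0 then 0 else c (i - 1))" for i :: nat
  let ?f = "parisi_f k m (\<lambda>i. real (c i) * h)"
  have v0: "0 \<le> v j" for j using path_cdf_bounds[OF step_rep_monotone_paths[OF st]] by (simp add: v_def)
  have m0: "0 \<le> m i" if "i \<le> k + 1" for i using step_rep_weight[OF st that] by simp
  have c_mono: "c i \<le> c j" if "i \<le> j" "j \<le> k" for i j
    unfolding c using step_rep_values_mono[OF st that] h
    by (intro nat_mono ceiling_mono divide_right_mono) auto
  have sc: "s i \<le> c i" if "i \<le> k" for i using c_mono[of "i - 1" i] that by (simp add: s_def)
  have c_iff: "c i \<le> j \<longleftrightarrow> a i \<le> real j * h" for i j
    unfolding c by (rule nat_ceiling_le_iff[OF h])
  have tame_f: "tame (?f i)" if "i \<le> Suc k" for i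
  proof (rule tame_parisi_f[OF _ _ that])
    fix i assume i: "i \<le> k"
    then show "0 \<le> m i" using m0 by simp
    have "real (s i) * h \<le> real (c i) * h" using sc[OF i] h by (simp add: mult_right_mono)
    then show "(if i = 0 then 0 else real (c (i - 1)) * h) \<le> real (c i) * h" by (simp add: s_def split: if_splits)
  qed
  have v_eq: "v j = m i" if "i \<le> k + 1" "s i \<le> j" "i \<le> k \<Longrightarrow> j < c i" for i j
    unfolding v_def
  proof (rule step_rep_path_cdf[OF st that(1)])
    fix l assume l: "l < i"
    then have "c l \<le> c (i - 1)" using that(1) by (intro c_mono) auto
    then have "c l \<le> j" using that(2) l by (simp add: s_def)
    then show "a l \<le> real j * h" by (simp add: c_iff)
  next
    assume "i \<le> k"
    then show "real j * h < a i" using that(3) c_iff[of i j] by auto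
  qed
  have claim: "T_chain h (N - s i) (\<lambda>j. v (j + s i)) x = ?f i x + real (N - c k) * h" if "i \<le> Suc k" for i x
    using that
  proof (induction i arbitrary: x rule: inc_induct)
    case base
    have "v (j + s (Suc k)) = 1" for j
      using v_eq[of "Suc k" "j + s (Suc k)"] st by (simp add: step_rep_def)
    then have "T_chain h (N - s (Suc k)) (\<lambda>j. v (j + s (Suc k))) x = lncosh x + real (N - s (Suc k)) * h"
      using h by (intro T_chain_ones) auto
    then show ?case by (simp add: parisi_f_above s_def)
  next
    case (step i)
    then have i: "i \<le> k" by simp
    let ?r = "c i - s i"
    have "N - s i = ?r + (N - s (Suc i))"
      using sc[OF i] c_mono[OF i order_refl] N by (simp add: s_def)
    then have "T_chain h (N - s i) (\<lambda>j. v (j + s i)) = T_chain h (?r + (N - s (Suc i))) (\<lambda>j. v (j + s i))" by simp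
    also have "\<dots> = T_op (m i) (real ?r * h) (T_chain h (N - s (Suc i)) (\<lambda>j. v (j + ?r + s i)))"
      using h i by (intro T_chain_constant_block v0 m0 v_eq) auto
    also have "(\<lambda>j. v (j + ?r + s i)) = (\<lambda>j. v (j + s (Suc i)))"
      using sc[OF i] by (simp add: s_def add.assoc)
    also have "T_chain h (N - s (Suc i)) (\<lambda>j. v (j + s (Suc i))) = (\<lambda>y. ?f (Suc i) y + real (N - c k) * h)"
      by (rule ext) (rule step.IH)
    finally have "T_chain h (N - s i) (\<lambda>j. v (j + s i)) x = T_op (m i) (real ?r * h) (?f (Suc i)) x + real (N - c k) * h"
      using i by (simp add: T_op_add_const tame_f)
    moreover have "real ?r * h = real (c i) * h - (if i = 0 then 0 else real (c (i - 1)) * h)"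
      using sc[OF i] by (simp add: s_def of_nat_diff algebra_simps)
    ultimately show ?case using i by (simp add: parisi_f_step)
  qed
  have "T_chain h N v 0 = ?f 0 0 + real (N - c k) * h" using claim[of 0 0] by (simp add: s_def)
  then show ?thesis using N by (simp add: grid_psi_def v_def[abs_def] of_nat_diff algebra_simps)
qed

lemma T_op_time_modulus:
  assumes C: "\<And>F m t x. tame F \<Longrightarrow> 0 \<le> m \<Longrightarrow> m \<le> 1 \<Longrightarrow> 0 \<le> t \<Longrightarrow> t \<le> 1 \<Longrightarrow>
       \<bar>T_op m t F x - F x\<bar> \<le> C * sqrt (2 * t)"
    and F: "tame F" and m: "0 \<le> m" "m \<le> 1" and t: "0 \<le> t" "0 \<le> t'" "\<bar>t - t'\<bar> \<le> 1"
  shows "\<bar>T_op m t F x - T_op m t' F x\<bar> \<le> C * sqrt (2 * \<bar>t - t'\<bar>)"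
proof -
  have main: "\<bar>T_op m t' F x - T_op m t F x\<bar> \<le> C * sqrt (2 * (t' - t))"
    if "0 \<le> t" "t \<le> t'" "t' - t \<le> 1" for t t'
  proof -
    have "T_op m t' F = T_op m t (T_op m (t' - t) F)"
      using T_op_semigroup[OF F m(1) that(1), of "t' - t"] that by simp
    moreover have "\<bar>T_op m t (T_op m (t' - t) F) x - T_op m t F x\<bar> \<le> C * sqrt (2 * (t' - t))"
      by (intro T_op_nonexpansive tame_T_op C F m) (use that in auto)
    ultimately show ?thesis by simp
  qed
  show ?thesis
  proof (cases "t \<le> t'")
    case True
    then show ?thesis using main[of t t'] t by (simp add: abs_minus_commute)
  next
    case False
    then show ?thesis using main[of t' t] t by simp
  qed
qed

text \<open>Rounding the values of the path perturbs each level of the recursion by \<open>O(sqrt h)\<close>.\<close>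

lemma grid_psi_step_rep_close:
  assumes st: "step_rep p k m a"
  obtains C where "\<And>h N. 0 < h \<Longrightarrow> h \<le> 1 \<Longrightarrow> a k + h \<le> real N * h \<Longrightarrow>
    \<bar>grid_psi h N p - (a k - parisi_f k m a 0 0)\<bar> \<le> h + C * sqrt (2 * h)"
proof -
  obtain C where C: "C \<ge> 0"
    "\<And>F m t x. tame F \<Longrightarrow> 0 \<le> m \<Longrightarrow> m \<le> 1 \<Longrightarrow> 0 \<le> t \<Longrightarrow> t \<le> 1 \<Longrightarrow>
       \<bar>T_op m t F x - F x\<bar> \<le> C * sqrt (2 * t)"
    using T_op_close by blast
  show thesis
  proof (rule that[of "real (Suc k) * C"])
    fix h :: real and N :: nat
    assume h: "0 < h" "h \<le> 1" and N: "a k + h \<le> real N * h"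
    define c where "c i = nat \<lceil>a i / h\<rceil>" for i
    define b where "b i = real (c i) * h" for i
    have ab: "a i \<le> b i" "b i \<le> a i + h" if "i \<le> k" for i
      unfolding b_def c_def using nat_ceiling_grid[OF h(1) step_rep_values_nonneg[OF st that]] by auto
    have m: "0 \<le> m i" "m i \<le> 1" if "i \<le> k" for i using step_rep_weight[OF st, of i] that by auto
    define da where "da i = a i - (if i = 0 then 0 else a (i - 1))" for i
    define db where "db i = b i - (if i = 0 then 0 else b (i - 1))" for i
    have da: "0 \<le> da i" if "i \<le> k" for i
      using step_rep_values_mono[OF st, of "i - 1" i] step_rep_values_nonneg[OF st that] that
      by (cases "i = 0") (simp_all add: da_def)
    have b_mono: "b i \<le> b j" if "i \<le> j" "j \<le> k" for i j
      unfolding b_def c_def using step_rep_values_mono[OF st that] h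
      by (intro mult_right_mono of_nat_mono nat_mono ceiling_mono divide_right_mono) auto
    have db: "0 \<le> db i" if "i \<le> k" for i
      using b_mono[of "i - 1" i] that h by (simp add: db_def b_def)
    have dab: "\<bar>da i - db i\<bar> \<le> h" if "i \<le> k" for i
    proof -
      have "i - 1 \<le> k" using that by simp
      from ab[OF this] ab[OF that] h(1) show ?thesis by (cases "i = 0") (simp_all add: da_def db_def abs_le_iff)
    qed
    have tame_a: "tame (parisi_f k m a i)" if "i \<le> Suc k" for i
      using da by (intro tame_parisi_f m that) (auto simp: da_def)
    have tame_b: "tame (parisi_f k m b i)" if "i \<le> Suc k" for i
      using db by (intro tame_parisi_f m that) (auto simp: db_def)
    have close: "\<bar>parisi_f k m a i x - parisi_f k m b i x\<bar> \<le> real (Suc k - i) * (C * sqrt (2 * h))" if "i \<le> Suc k" for i x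
      using that
    proof (induction i arbitrary: x rule: inc_induct)
      case base
      then show ?case by (simp add: parisi_f_above)
    next
      case (step i)
      then have i: "i \<le> k" by simp
      let ?A = "parisi_f k m a (Suc i)" and ?B = "parisi_f k m b (Suc i)"
      have "\<bar>T_op (m i) (da i) ?A x - T_op (m i) (da i) ?B x\<bar> \<le> real (Suc k - Suc i) * (C * sqrt (2 * h))"
        using i by (intro T_op_nonexpansive tame_a tame_b step.IH m) auto
      moreover have "\<bar>T_op (m i) (da i) ?B x - T_op (m i) (db i) ?B x\<bar> \<le> C * sqrt (2 * \<bar>da i - db i\<bar>)"
        using i dab[OF i] h by (intro T_op_time_modulus C(2) tame_b m da db) auto
      moreover have "C * sqrt (2 * \<bar>da i - db i\<bar>) \<le> C * sqrt (2 * h)"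
        using C(1) dab[OF i] by (intro mult_left_mono real_sqrt_le_mono) auto
      moreover have "parisi_f k m a i x = T_op (m i) (da i) ?A x" "parisi_f k m b i x = T_op (m i) (db i) ?B x"
        using i by (simp_all add: parisi_f_step da_def db_def)
      moreover have "real (Suc k - i) = real (Suc k - Suc i) + 1" using i by (simp add: of_nat_diff)
      ultimately show ?case by (simp add: algebra_simps)
    qed
    have "c k \<le> N"
    proof -
      have "real (c k) * h \<le> real N * h" using ab(2)[of k] N by (simp add: b_def)
      then show ?thesis using h by simp
    qed
    then have "grid_psi h N p = b k - parisi_f k m b 0 0"
      using grid_psi_step_rep_grid[OF st h(1), of c N] by (simp add: c_def b_def[abs_def])
    then show "\<bar>grid_psi h N p - (a k - parisi_f k m a 0 0)\<bar> \<le> h + real (Suc k) * C * sqrt (2 * h)"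
      using close[of 0 0] ab[of k] by (simp add: abs_le_iff algebra_simps)
  qed
qed

section \<open>The continuous extension\<close>

text \<open>Mesh tending to zero and horizon tending to infinity; all such limits will agree.\<close>

definition refining :: "(nat \<Rightarrow> real) \<Rightarrow> (nat \<Rightarrow> nat) \<Rightarrow> bool" where
  "refining h N \<longleftrightarrow> (\<forall>n. 0 < h n) \<and> h \<longlonglongrightarrow> 0 \<and> filterlim (\<lambda>n. real (N n) * h n) at_top sequentially"

lemma refining_eventually_le: "refining h N \<Longrightarrow> \<forall>\<^sub>F n in sequentially. h n \<le> 1"
  using order_tendstoD(2)[of h 0 sequentially 1] by (auto simp: refining_def elim: eventually_mono)

text \<open>
  Meshes of which a prescribed shift \<open>\<beta>\<close> is an integer multiple, namely \<open>n + 1\<close> steps, with two horizons that differ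
  by this shift.
\<close>

lemma refining_scaled:
  assumes "\<beta> > 0"
  shows "refining (\<lambda>n. \<beta> / real (Suc n)) (\<lambda>n. Suc n * Suc n)"
    and "refining (\<lambda>n. \<beta> / real (Suc n)) (\<lambda>n. Suc n + Suc n * Suc n)"
proof -
  have lim: "(\<lambda>n. \<beta> / real (Suc n)) \<longlonglongrightarrow> 0"
    using tendsto_mult_right_zero[OF LIMSEQ_inverse_real_of_nat, of \<beta>] by (simp add: divide_inverse)
  have n: "filterlim (\<lambda>n. \<beta> * real (Suc n)) at_top sequentially"
    using assms by (intro filterlim_tendsto_pos_mult_at_top[OF tendsto_const assms]
        filterlim_compose[OF filterlim_real_sequentially filterlim_Suc])
  have "(\<lambda>n. real (Suc n * Suc n) * (\<beta> / real (Suc n))) = (\<lambda>n. \<beta> * real (Suc n))"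
    by (rule ext) (simp only: of_nat_mult, simp del: of_nat_Suc)
  then show "refining (\<lambda>n. \<beta> / real (Suc n)) (\<lambda>n. Suc n * Suc n)"
    using assms lim n by (simp add: refining_def del: of_nat_Suc)
  have "(\<lambda>n. real (Suc n + Suc n * Suc n) * (\<beta> / real (Suc n))) = (\<lambda>n. \<beta> + \<beta> * real (Suc n))"
  proof (rule ext)
    fix n
    have "(x + x * x) * (\<beta> / x) = \<beta> + \<beta> * x" if "x \<noteq> 0" for x
      using that by (simp add: field_simps)
    from this[of "real (Suc n)"] show "real (Suc n + Suc n * Suc n) * (\<beta> / real (Suc n)) = \<beta> + \<beta> * real (Suc n)"
      by (simp only: of_nat_add of_nat_mult)
  qed
  moreover have "filterlim (\<lambda>n. \<beta> + \<beta> * real (Suc n)) at_top sequentially"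
    by (rule filterlim_tendsto_add_at_top[OF tendsto_const n])
  ultimately show "refining (\<lambda>n. \<beta> / real (Suc n)) (\<lambda>n. Suc n + Suc n * Suc n)"
    using assms lim by (simp add: refining_def del: of_nat_Suc)
qed

lemma grid_psi_step_tendsto:
  assumes st: "step_rep p k m a" and r: "refining h N"
  shows "(\<lambda>n. grid_psi (h n) (N n) p) \<longlonglongrightarrow> a k - parisi_f k m a 0 0"
proof -
  obtain C where C: "\<And>h N. 0 < h \<Longrightarrow> h \<le> 1 \<Longrightarrow> a k + h \<le> real N * h \<Longrightarrow>
      \<bar>grid_psi h N p - (a k - parisi_f k m a 0 0)\<bar> \<le> h + C * sqrt (2 * h)"
    using grid_psi_step_rep_close[OF st] by blast
  have h: "h \<longlonglongrightarrow> 0" "\<And>n. 0 < h n" using r by (auto simp: refining_def)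
  have ev1: "\<forall>\<^sub>F n in sequentially. h n \<le> 1" using r by (rule refining_eventually_le)
  moreover have "\<forall>\<^sub>F n in sequentially. a k + 1 \<le> real (N n) * h n"
    using r by (auto simp: refining_def filterlim_at_top)
  ultimately have ev: "\<forall>\<^sub>F n in sequentially.
      norm (grid_psi (h n) (N n) p - (a k - parisi_f k m a 0 0)) \<le> h n + C * sqrt (2 * h n)"
  proof eventually_elim
    case (elim n)
    then show ?case unfolding real_norm_def using h(2)[of n] by (intro C) auto
  qed
  have "(\<lambda>n. h n + C * sqrt (2 * h n)) \<longlonglongrightarrow> 0 + C * sqrt (2 * 0)"
    by (intro tendsto_intros h)
  then have "(\<lambda>n. h n + C * sqrt (2 * h n)) \<longlonglongrightarrow> 0" by simp
  then have "(\<lambda>n. grid_psi (h n) (N n) p - (a k - parisi_f k m a 0 0)) \<longlonglongrightarrow> 0"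
    by (rule Lim_null_comparison[OF ev])
  then show ?thesis by (simp add: LIM_zero_iff)
qed

text \<open>
  Independence of the representation: any two representations give the limit of the same sequence
  \<^const>\<open>grid_psi\<close>, which depends on the path only.
\<close>

lemma psi_step_eq:
  assumes st: "step_rep p k m a"
  shows "psi_step p = a k - parisi_f k m a 0 0"
  unfolding psi_step_def
proof (rule the_equality)
  show "\<exists>k' m' a'. step_rep p k' m' a' \<and> a k - parisi_f k m a 0 0 = a' k' - parisi_f k' m' a' 0 0"
    using st by blast
  fix v assume "\<exists>k m a. step_rep p k m a \<and> v = a k - parisi_f k m a 0 0"
  then obtain k' m' a' where st': "step_rep p k' m' a'" and v: "v = a' k' - parisi_f k' m' a' 0 0" by blast
  show "v = a k - parisi_f k m a 0 0"
    unfolding v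
    using LIMSEQ_unique[OF grid_psi_step_tendsto[OF st' refining_scaled(1)] grid_psi_step_tendsto[OF st refining_scaled(1)], of 1]
    by simp
qed

lemma grid_psi_tendsto_psi_step:
  assumes "p \<in> step_paths" "refining h N"
  shows "(\<lambda>n. grid_psi (h n) (N n) p) \<longlonglongrightarrow> psi_step p"
  using assms grid_psi_step_tendsto psi_step_eq by (fastforce simp: step_paths_def)

lemma step_paths_monotone_paths: "p \<in> step_paths \<Longrightarrow> p \<in> monotone_paths"
  by (auto simp: step_paths_def intro: step_rep_monotone_paths)

lemma step_paths_bounded:
  assumes "p \<in> step_paths"
  obtains B where "\<And>s. s \<in> {0..<1} \<Longrightarrow> p s \<le> B"
proof -
  obtain k m a where st: "step_rep p k m a" using assms by (auto simp: step_paths_def)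
  show thesis
  proof (rule that[of "a k"])
    fix s :: real assume s: "s \<in> {0..<1}"
    obtain i where "i \<le> k" "m i \<le> s" "s < m (i + 1)" using step_rep_cover[OF st, of s] s by auto
    then show "p s \<le> a k" using step_rep_value[OF st] step_rep_values_mono[OF st, of i k] by simp
  qed
qed

lemma L1_dist_nonneg: "0 \<le> L1_dist p q"
  by (simp add: L1_dist_def set_lebesgue_integral_def)

lemma L1_dist_commute: "L1_dist p q = L1_dist q p"
  by (simp add: L1_dist_def abs_minus_commute)

lemma L1_dist_le:
  assumes "p \<in> monotone_paths" "q \<in> monotone_paths" "set_integrable lborel {0..<1} g"
    "\<And>s. s \<in> {0..<1} \<Longrightarrow> \<bar>p s - q s\<bar> \<le> g s"
  shows "L1_dist p q \<le> (LINT s:{0..<1}|lborel. g s)"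
  unfolding L1_dist_def by (intro set_integral_mono L1_dist_integrable assms)

lemma L1_dist_triangle:
  assumes "p \<in> monotone_paths" "q \<in> monotone_paths" "r \<in> monotone_paths"
  shows "L1_dist p r \<le> L1_dist p q + L1_dist q r"
proof -
  have "L1_dist p r \<le> (LINT s:{0..<1}|lborel. \<bar>p s - q s\<bar> + \<bar>q s - r s\<bar>)"
    by (intro L1_dist_le assms set_integral_add(1) L1_dist_integrable) auto
  also have "\<dots> = L1_dist p q + L1_dist q r"
    unfolding L1_dist_def by (intro set_integral_add(2) L1_dist_integrable assms)
  finally show ?thesis .
qed

text \<open>
  Sample \<open>q\<close> at the multiples of \<open>1 / (n + 1)\<close>. The samples stay below \<open>q\<close> and converge at every
  continuity point, and a monotone function has at most countably many discontinuities.
\<close>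

lemma step_paths_dense:
  assumes q: "q \<in> monotone_paths"
  obtains p where "\<And>n. p n \<in> step_paths" "(\<lambda>n. L1_dist (p n) q) \<longlonglongrightarrow> 0"
proof -
  define m where "m n i = real i / real (Suc n)" for n i
  define p where "p n s = (\<Sum>i\<le>n. q (m n i) * indicator {m n i..<m n (i + 1)} s)" for n s
  have m01: "0 \<le> m n i" "i \<le> n \<Longrightarrow> m n i < 1" for n i by (auto simp: m_def)
  have st: "step_rep (p n) n (m n) (\<lambda>i. q (m n i))" for n
    unfolding step_rep_def
  proof (intro conjI allI impI ballI)
    show "m n 0 = 0" "m n (n + 1) = 1" by (auto simp: m_def)
    show "m n i < m n (i + 1)" for i by (simp add: m_def divide_strict_right_mono)
    show "0 \<le> q (m n 0)" using m01 by (intro monotone_pathsD(2)[OF q]) auto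
    show "q (m n i) \<le> q (m n (i + 1))" if "i < n" for i
      using that m01[of n i] m01[of n "i + 1"]
      by (intro mono_onD[OF monotone_pathsD(1)[OF q]]) (auto simp: m_def divide_right_mono)
  qed (simp add: p_def)
  then have sp: "p n \<in> step_paths" for n by (auto simp: step_paths_def)
  define g where "g n s = m n (nat \<lfloor>s * real (Suc n)\<rfloor>)" for n s
  have g: "p n s = q (g n s)" "g n s \<in> {0..<1}" "g n s \<le> s" "s - g n s \<le> 1 / real (Suc n)" if "s \<in> {0..<1}" for n s
  proof -
    let ?i = "nat \<lfloor>s * real (Suc n)\<rfloor>"
    have "0 \<le> s * real (Suc n)" using that by simp
    then have r: "real ?i = of_int \<lfloor>s * real (Suc n)\<rfloor>" by simp
    then have i: "real ?i \<le> s * real (Suc n)" "s * real (Suc n) < real ?i + 1" by linarith+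
    have "s * real (Suc n) < real (Suc n)"
      using that mult_strict_right_mono[of s 1 "real (Suc n)"] by (simp del: of_nat_Suc)
    with i(1) have "real ?i < real (Suc n)" by (rule le_less_trans)
    then have in': "?i \<le> n" by simp
    have lo: "g n s \<le> s" using i(1) by (simp add: g_def m_def divide_le_eq del: of_nat_Suc)
    have hi: "s < m n (?i + 1)" using i(2) by (simp add: m_def less_divide_eq algebra_simps)
    show "g n s \<le> s" by (rule lo)
    show "p n s = q (g n s)" using step_rep_value[OF st in'] lo hi by (simp add: g_def)
    show "g n s \<in> {0..<1}" using m01(1)[of n ?i] m01(2)[OF in'] by (simp add: g_def)
    have "m n (?i + 1) = g n s + 1 / real (Suc n)" by (simp add: m_def g_def add_divide_distrib)
    then show "s - g n s \<le> 1 / real (Suc n)" using hi by simp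
  qed
  have "(\<lambda>n. L1_dist (p n) q) \<longlonglongrightarrow> (LINT s|(lborel :: real measure). (0 :: real))"
    unfolding L1_dist_def set_lebesgue_integral_def
  proof (rule integral_dominated_convergence)
    show "integrable lborel (\<lambda>s. indicator {0..<1} s *\<^sub>R q s)"
      using monotone_pathsD(3)[OF q] by (simp add: set_integrable_def)
    show "(\<lambda>s. indicator {0..<1} s *\<^sub>R \<bar>p n s - q s\<bar>) \<in> borel_measurable lborel" for n
      using L1_dist_integrable[OF step_paths_monotone_paths[OF sp] q] unfolding set_integrable_def
      by (rule borel_measurable_integrable)
    show "AE s in lborel. norm (indicator {0..<1} s *\<^sub>R \<bar>p n s - q s\<bar>) \<le> indicator {0..<1} s *\<^sub>R q s" for n
    proof (rule AE_I2)
      fix s :: real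
      show "norm (indicator {0..<1} s *\<^sub>R \<bar>p n s - q s\<bar>) \<le> indicator {0..<1} s *\<^sub>R q s"
      proof (cases "s \<in> {0..<1}")
        case True
        have "0 \<le> q (g n s)" using g(2)[OF True, of n] by (intro monotone_pathsD(2)[OF q]) auto
        moreover have "q (g n s) \<le> q s"
          by (rule mono_onD[OF monotone_pathsD(1)[OF q] g(2)[OF True] True g(3)[OF True]])
        ultimately show ?thesis using True g(1)[OF True, of n] by simp
      qed simp
    qed
    have "countable {s \<in> {0..<1}. \<not> continuous (at s within {0..<1}) q}"
      by (rule mono_on_ctble_discont[OF monotone_pathsD(1)[OF q]])
    then have "{s \<in> {0..<1}. \<not> continuous (at s within {0..<1}) q} \<in> null_sets lborel"
      by (rule countable_imp_null_set_lborel)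
    then have "AE s in lborel. s \<notin> {s \<in> {0..<1}. \<not> continuous (at s within {0..<1}) q}"
      by (rule AE_not_in)
    then show "AE s in lborel. (\<lambda>n. indicator {0..<1} s *\<^sub>R \<bar>p n s - q s\<bar>) \<longlonglongrightarrow> 0"
    proof eventually_elim
      fix s :: real
      assume nd: "s \<notin> {s \<in> {0..<1}. \<not> continuous (at s within {0..<1}) q}"
      show "(\<lambda>n. indicator {0..<1} s *\<^sub>R \<bar>p n s - q s\<bar>) \<longlonglongrightarrow> 0"
      proof (cases "s \<in> {0..<1}")
        case True
        have "(\<lambda>n. s - g n s) \<longlonglongrightarrow> 0"
        proof (rule Lim_null_comparison)
          show "\<forall>\<^sub>F n in sequentially. norm (s - g n s) \<le> inverse (real (Suc n))"
            using g(3,4)[OF True] by (auto simp: inverse_eq_divide)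
          show "(\<lambda>n. inverse (real (Suc n))) \<longlonglongrightarrow> 0" by (rule LIMSEQ_inverse_real_of_nat)
        qed
        from tendsto_diff[OF tendsto_const[of s] this] have "(\<lambda>n. g n s) \<longlonglongrightarrow> s" by simp
        moreover have "continuous (at s within {0..<1}) q" using nd True by auto
        ultimately have "(\<lambda>n. q (g n s)) \<longlonglongrightarrow> q s"
          using g(2)[OF True] by (auto simp: continuous_within_sequentially o_def)
        then have "(\<lambda>n. \<bar>q (g n s) - q s\<bar>) \<longlonglongrightarrow> 0"
          by (simp add: LIM_zero_iff tendsto_rabs_zero_iff)
        then show ?thesis using True by (simp add: g(1)[OF True])
      qed simp
    qed
  qed simp
  then show thesis using that[of p] sp by simp
qed

lemma psi_step_lipschitz:
  obtains K where "K \<ge> 0"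
    "\<And>p q. p \<in> step_paths \<Longrightarrow> q \<in> step_paths \<Longrightarrow> \<bar>psi_step p - psi_step q\<bar> \<le> K * L1_dist p q"
proof -
  obtain K where K: "K \<ge> 0" "\<And>h n p q. 0 < h \<Longrightarrow> h \<le> 1 \<Longrightarrow> p \<in> monotone_paths \<Longrightarrow> q \<in> monotone_paths \<Longrightarrow>
       \<bar>grid_psi h n p - grid_psi h n q\<bar> \<le> K * (L1_dist p q + h)"
    using grid_psi_lipschitz by blast
  have "\<bar>psi_step p - psi_step q\<bar> \<le> K * L1_dist p q" if "p \<in> step_paths" "q \<in> step_paths" for p q
  proof -
    define h N where "h n = 1 / real (Suc n)" and "N n = Suc n * Suc n" for n
    have r: "refining h N" unfolding h_def N_def using refining_scaled(1)[of 1] by simp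
    then have h: "h \<longlonglongrightarrow> 0" "\<And>n. 0 < h n" by (auto simp: refining_def)
    have "(\<lambda>n. \<bar>grid_psi (h n) (N n) p - grid_psi (h n) (N n) q\<bar>) \<longlonglongrightarrow> \<bar>psi_step p - psi_step q\<bar>"
      by (intro tendsto_intros grid_psi_tendsto_psi_step that r)
    moreover have "(\<lambda>n. K * (L1_dist p q + h n)) \<longlonglongrightarrow> K * (L1_dist p q + 0)"
      by (intro tendsto_intros h)
    moreover have "\<forall>\<^sub>F n in sequentially. \<bar>grid_psi (h n) (N n) p - grid_psi (h n) (N n) q\<bar> \<le> K * (L1_dist p q + h n)"
      using refining_eventually_le[OF r]
      by eventually_elim (intro K h step_paths_monotone_paths that)
    ultimately show ?thesis
      using tendsto_le[OF sequentially_bot] by fastforce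
  qed
  with K show thesis using that by blast
qed

text \<open>
  The Lipschitz bound makes \<^const>\<open>psi_step\<close> Cauchy along approximating step paths. Density makes the filter in the definition
  of \<^const>\<open>psi_circ\<close> proper, so the limit there is unique.
\<close>

lemma psi_circ_close:
  obtains K where "K \<ge> 0"
    "\<And>p q. p \<in> step_paths \<Longrightarrow> q \<in> monotone_paths \<Longrightarrow> \<bar>psi_step p - psi_circ q\<bar> \<le> K * L1_dist p q"
proof -
  obtain K where K: "K \<ge> 0"
    "\<And>p q. p \<in> step_paths \<Longrightarrow> q \<in> step_paths \<Longrightarrow> \<bar>psi_step p - psi_step q\<bar> \<le> K * L1_dist p q"
    using psi_step_lipschitz by blast
  have close: "\<bar>psi_step p - psi_circ q\<bar> \<le> K * L1_dist p q" if p: "p \<in> step_paths" and q: "q \<in> monotone_paths" for p q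
  proof -
    obtain r where r: "\<And>n. r n \<in> step_paths" "(\<lambda>n. L1_dist (r n) q) \<longlonglongrightarrow> 0"
      using step_paths_dense[OF q] by blast
    have "Cauchy (\<lambda>n. psi_step (r n))"
    proof (rule metric_CauchyI)
      fix e :: real assume e: "e > 0"
      then have "e / (2 * (K + 1)) > 0" using K by simp
      then obtain M where M: "\<And>n. n \<ge> M \<Longrightarrow> L1_dist (r n) q < e / (2 * (K + 1))"
        using order_tendstoD(2)[OF r(2)] by (auto simp: eventually_sequentially)
      show "\<exists>M. \<forall>i\<ge>M. \<forall>j\<ge>M. dist (psi_step (r i)) (psi_step (r j)) < e"
      proof (intro exI[of _ M] allI impI)
        fix i j assume ij: "i \<ge> M" "j \<ge> M"
        have "L1_dist (r i) (r j) \<le> L1_dist (r i) q + L1_dist q (r j)"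
          by (intro L1_dist_triangle step_paths_monotone_paths r q)
        also have "\<dots> < 2 * (e / (2 * (K + 1)))"
          using M[OF ij(1)] M[OF ij(2)] by (simp only: L1_dist_commute[of q])
        also have "\<dots> = e / (K + 1)" using K(1) by (simp add: field_simps)
        finally have "(K + 1) * L1_dist (r i) (r j) < e" using K by (simp add: field_simps)
        moreover have "\<bar>psi_step (r i) - psi_step (r j)\<bar> \<le> K * L1_dist (r i) (r j)" by (intro K r)
        ultimately show "dist (psi_step (r i)) (psi_step (r j)) < e"
          using L1_dist_nonneg[of "r i" "r j"] by (simp add: dist_real_def algebra_simps)
      qed
    qed
    then obtain l where l: "(\<lambda>n. psi_step (r n)) \<longlonglongrightarrow> l"
      using Cauchy_convergent unfolding convergent_def by blast
    have bound: "\<bar>psi_step p - l\<bar> \<le> K * L1_dist p q" if p: "p \<in> step_paths" for p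
    proof (rule tendsto_le[OF sequentially_bot])
      show "(\<lambda>n. K * (L1_dist p q + L1_dist (r n) q)) \<longlonglongrightarrow> K * L1_dist p q"
        using tendsto_mult[OF tendsto_const[of K] tendsto_add[OF tendsto_const[of "L1_dist p q"] r(2)]] by simp
      show "(\<lambda>n. \<bar>psi_step p - psi_step (r n)\<bar>) \<longlonglongrightarrow> \<bar>psi_step p - l\<bar>"
        by (intro tendsto_intros l)
      show "\<forall>\<^sub>F n in sequentially. \<bar>psi_step p - psi_step (r n)\<bar> \<le> K * (L1_dist p q + L1_dist (r n) q)"
      proof (rule always_eventually, rule allI)
        fix n
        have "L1_dist p (r n) \<le> L1_dist p q + L1_dist (r n) q"
          using L1_dist_triangle[of p q "r n"] p q r(1) by (simp add: step_paths_monotone_paths L1_dist_commute[of q])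
        then have "K * L1_dist p (r n) \<le> K * (L1_dist p q + L1_dist (r n) q)"
          using K(1) by (rule mult_left_mono)
        with K(2)[OF p r(1)[of n]] show "\<bar>psi_step p - psi_step (r n)\<bar> \<le> K * (L1_dist p q + L1_dist (r n) q)"
          by linarith
      qed
    qed
    let ?F = "inf (filtercomap (\<lambda>p. L1_dist p q) (nhds 0)) (principal step_paths)"
    have ev: "\<forall>\<^sub>F p in ?F. L1_dist p q < e \<and> p \<in> step_paths" if "e > 0" for e
    proof -
      have "\<forall>\<^sub>F x in nhds 0. x < e"
        using eventually_nhds_in_open[of "{..<e}" 0] that by simp
      then show ?thesis
        unfolding eventually_inf_principal eventually_filtercomap by blast
    qed
    have "?F \<noteq> bot"
    proof
      assume "?F = bot"
      then have "\<forall>\<^sub>F p in ?F. False" by simp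
      then obtain P where P: "eventually P (nhds 0)" "\<And>p. P (L1_dist p q) \<Longrightarrow> p \<in> step_paths \<Longrightarrow> False"
        unfolding eventually_inf_principal eventually_filtercomap by blast
      have "\<forall>\<^sub>F n in sequentially. P (L1_dist (r n) q)"
        using r(2) P(1) by (simp add: filterlim_iff)
      then obtain n where "P (L1_dist (r n) q)" by (auto simp: eventually_sequentially)
      then show False using P(2) r(1) by blast
    qed
    moreover have "(psi_step \<longlongrightarrow> l) ?F"
    proof (rule tendstoI)
      fix e :: real assume e: "e > 0"
      then have "e / (K + 1) > 0" using K by simp
      from ev[OF this] show "\<forall>\<^sub>F p in ?F. dist (psi_step p) l < e"
      proof eventually_elim
        case (elim p)
        then have "(K + 1) * L1_dist p q < e" using K by (simp add: field_simps)
        moreover have "\<bar>psi_step p - l\<bar> \<le> K * L1_dist p q" using bound elim by blast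
        ultimately show ?case using L1_dist_nonneg[of p q] by (simp add: dist_real_def algebra_simps)
      qed
    qed
    ultimately have "psi_circ q = l" unfolding psi_circ_def by (rule tendsto_Lim)
    then show ?thesis using bound[OF p] by simp
  qed
  show thesis using that K(1) close by blast
qed

lemma grid_psi_tendsto_psi_circ:
  assumes q: "q \<in> monotone_paths" and ref: "refining h N"
  shows "(\<lambda>n. grid_psi (h n) (N n) q) \<longlonglongrightarrow> psi_circ q"
proof -
  obtain K1 where K1: "K1 \<ge> 0"
    "\<And>p q. p \<in> step_paths \<Longrightarrow> q \<in> monotone_paths \<Longrightarrow> \<bar>psi_step p - psi_circ q\<bar> \<le> K1 * L1_dist p q"
    using psi_circ_close by blast
  obtain K2 where K2: "K2 \<ge> 0" "\<And>h n p q. 0 < h \<Longrightarrow> h \<le> 1 \<Longrightarrow> p \<in> monotone_paths \<Longrightarrow> q \<in> monotone_paths \<Longrightarrow>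
       \<bar>grid_psi h n p - grid_psi h n q\<bar> \<le> K2 * (L1_dist p q + h)"
    using grid_psi_lipschitz by blast
  define K where "K = K1 + K2"
  have K: "K \<ge> 0" using K1 K2 by (simp add: K_def)
  have close: "\<bar>psi_step p - psi_circ q\<bar> \<le> K * L1_dist p q" if "p \<in> step_paths" for p
    using K1(2)[OF that q] mult_nonneg_nonneg[OF K2(1) L1_dist_nonneg[of p q]]
    unfolding K_def distrib_right by linarith
  have lip: "\<bar>grid_psi h n p - grid_psi h n q\<bar> \<le> K * (L1_dist p q + h)" if "0 < h" "h \<le> 1" "p \<in> monotone_paths" for h n p
  proof -
    have "0 \<le> K1 * (L1_dist p q + h)" using K1(1) L1_dist_nonneg[of p q] that by simp
    then show ?thesis using K2(2)[OF that q, of n] unfolding K_def distrib_right[of K1] by linarith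
  qed
  show ?thesis
  proof (rule LIMSEQ_I)
    fix e :: real assume e: "e > 0"
    obtain r where r: "\<And>n. r n \<in> step_paths" "(\<lambda>n. L1_dist (r n) q) \<longlonglongrightarrow> 0"
      using step_paths_dense[OF q] by blast
    have d: "e / (4 * (K + 1)) > 0" using e K by simp
    obtain i where i: "L1_dist (r i) q < e / (4 * (K + 1))"
      using order_tendstoD(2)[OF r(2) d] by (auto simp: eventually_sequentially)
    have h: "h \<longlonglongrightarrow> 0" "\<And>n. 0 < h n" using ref by (auto simp: refining_def)
    have "\<forall>\<^sub>F n in sequentially. \<bar>grid_psi (h n) (N n) (r i) - psi_step (r i)\<bar> < e / 4"
      using tendstoD[OF grid_psi_tendsto_psi_step[OF r(1)[of i] ref], of "e / 4"] e by (simp add: dist_real_def)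
    moreover have "\<forall>\<^sub>F n in sequentially. h n < e / (4 * (K + 1))" by (rule order_tendstoD(2)[OF h(1) d])
    moreover note refining_eventually_le[OF ref]
    ultimately have "\<forall>\<^sub>F n in sequentially. norm (grid_psi (h n) (N n) q - psi_circ q) < e"
    proof eventually_elim
      case (elim n)
      have "\<bar>grid_psi (h n) (N n) (r i) - grid_psi (h n) (N n) q\<bar> \<le> K * (L1_dist (r i) q + h n)"
        by (intro lip h elim step_paths_monotone_paths r)
      moreover have "\<bar>psi_step (r i) - psi_circ q\<bar> \<le> K * L1_dist (r i) q" by (intro close r)
      moreover have "(K + 1) * L1_dist (r i) q < e / 4" "(K + 1) * h n < e / 4"
        using i elim K by (simp_all add: field_simps)
      moreover have "\<bar>grid_psi (h n) (N n) q - psi_circ q\<bar> \<le> \<bar>grid_psi (h n) (N n) (r i) - grid_psi (h n) (N n) q\<bar>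
          + \<bar>grid_psi (h n) (N n) (r i) - psi_step (r i)\<bar> + \<bar>psi_step (r i) - psi_circ q\<bar>"
        by linarith
      ultimately show ?case
        using elim(1) L1_dist_nonneg[of "r i" q] h(2)[of n] unfolding real_norm_def distrib_left distrib_right
        by linarith
    qed
    then show "\<exists>n0. \<forall>n\<ge>n0. norm (grid_psi (h n) (N n) q - psi_circ q) < e"
      by (simp add: eventually_sequentially)
  qed
qed

section \<open>From translation submodularity to convexity\<close>

lemma psi_circ_lipschitz:
  obtains K where "K \<ge> 0"
    "\<And>p q. p \<in> monotone_paths \<Longrightarrow> q \<in> monotone_paths \<Longrightarrow> \<bar>psi_circ p - psi_circ q\<bar> \<le> K * L1_dist p q"
proof -
  obtain K where K: "K \<ge> 0"
    "\<And>p q. p \<in> step_paths \<Longrightarrow> q \<in> monotone_paths \<Longrightarrow> \<bar>psi_step p - psi_circ q\<bar> \<le> K * L1_dist p q"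
    using psi_circ_close by blast
  have "\<bar>psi_circ p - psi_circ q\<bar> \<le> K * L1_dist p q" if p: "p \<in> monotone_paths" and q: "q \<in> monotone_paths" for p q
  proof -
    obtain r where r: "\<And>n. r n \<in> step_paths" "(\<lambda>n. L1_dist (r n) p) \<longlonglongrightarrow> 0"
      using step_paths_dense[OF p] by blast
    have "\<bar>psi_circ p - psi_circ q\<bar> \<le> K * (2 * L1_dist (r n) p + L1_dist p q)" for n
    proof -
      have "\<bar>psi_step (r n) - psi_circ p\<bar> \<le> K * L1_dist (r n) p" by (intro K r p)
      moreover have "\<bar>psi_step (r n) - psi_circ q\<bar> \<le> K * L1_dist (r n) q" by (intro K r q)
      moreover have "K * L1_dist (r n) q \<le> K * (L1_dist (r n) p + L1_dist p q)"
        using K(1) by (intro mult_left_mono L1_dist_triangle p q step_paths_monotone_paths r)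
      ultimately show ?thesis by (simp add: algebra_simps)
    qed
    moreover have "(\<lambda>n. K * (2 * L1_dist (r n) p + L1_dist p q)) \<longlonglongrightarrow> K * (2 * 0 + L1_dist p q)"
      by (intro tendsto_intros r)
    ultimately show ?thesis using LIMSEQ_le_const[of _ "K * (2 * 0 + L1_dist p q)"] by auto
  qed
  with K(1) show thesis using that by blast
qed

lemma monotone_paths_max_shift:
  assumes "p \<in> monotone_paths" "q \<in> monotone_paths"
  shows "(\<lambda>s. max (p s - \<beta>) (q s)) \<in> monotone_paths"
  unfolding monotone_paths_def
proof (intro CollectI conjI ballI mono_onI)
  fix s t :: real assume "s \<in> {0..<1}" "t \<in> {0..<1}" "s \<le> t"
  then have "p s \<le> p t" "q s \<le> q t"
    using mono_onD[OF monotone_pathsD(1)[OF assms(1)]] mono_onD[OF monotone_pathsD(1)[OF assms(2)]] by auto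
  then show "max (p s - \<beta>) (q s) \<le> max (p t - \<beta>) (q t)" by auto
next
  fix s :: real assume "s \<in> {0..<1}"
  then show "0 \<le> max (p s - \<beta>) (q s)" using monotone_pathsD(2)[OF assms(2), of s] by (simp add: le_max_iff_disj)
next
  have "set_integrable lborel {0..<1} (\<lambda>s. p s - \<beta>)" "set_integrable lborel {0..<1} q"
    by (intro set_integral_diff(1) monotone_pathsD assms integrable_unit_const)+
  then have "integrable lborel (\<lambda>s. max (indicator {0..<1} s *\<^sub>R (p s - \<beta>)) (indicator {0..<1} s *\<^sub>R q s))"
    unfolding set_integrable_def by (rule integrable_max)
  then show "set_integrable lborel {0..<1} (\<lambda>s. max (p s - \<beta>) (q s))"
    unfolding set_integrable_def
    by (rule back_subst[where P = "integrable lborel"]) (auto simp: indicator_def)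
qed

lemma monotone_paths_min_shift:
  assumes "p \<in> monotone_paths" "q \<in> monotone_paths" "0 \<le> \<beta>"
  shows "(\<lambda>s. min (p s) (q s + \<beta>)) \<in> monotone_paths"
  unfolding monotone_paths_def
proof (intro CollectI conjI ballI mono_onI)
  fix s t :: real assume "s \<in> {0..<1}" "t \<in> {0..<1}" "s \<le> t"
  then have "p s \<le> p t" "q s \<le> q t"
    using mono_onD[OF monotone_pathsD(1)[OF assms(1)]] mono_onD[OF monotone_pathsD(1)[OF assms(2)]] by auto
  then show "min (p s) (q s + \<beta>) \<le> min (p t) (q t + \<beta>)" by auto
next
  fix s :: real assume "s \<in> {0..<1}"
  then show "0 \<le> min (p s) (q s + \<beta>)"
    using monotone_pathsD(2)[OF assms(1), of s] monotone_pathsD(2)[OF assms(2), of s] assms(3) by simp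
next
  have "set_integrable lborel {0..<1} p" "set_integrable lborel {0..<1} (\<lambda>s. q s + \<beta>)"
    by (intro set_integral_add(1) monotone_pathsD assms integrable_unit_const)+
  then have "integrable lborel (\<lambda>s. min (indicator {0..<1} s *\<^sub>R p s) (indicator {0..<1} s *\<^sub>R (q s + \<beta>)))"
    unfolding set_integrable_def by (rule integrable_min)
  then show "set_integrable lborel {0..<1} (\<lambda>s. min (p s) (q s + \<beta>))"
    unfolding set_integrable_def
    by (rule back_subst[where P = "integrable lborel"]) (auto simp: indicator_def)
qed

lemma monotone_paths_convex:
  assumes "p \<in> monotone_paths" "q \<in> monotone_paths" "0 \<le> l" "l \<le> 1"
  shows "(\<lambda>s. (1 - l) * p s + l * q s) \<in> monotone_paths"
  unfolding monotone_paths_def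
proof (intro CollectI conjI ballI mono_onI)
  fix s t :: real assume "s \<in> {0..<1}" "t \<in> {0..<1}" "s \<le> t"
  then have "p s \<le> p t" "q s \<le> q t"
    using mono_onD[OF monotone_pathsD(1)[OF assms(1)]] mono_onD[OF monotone_pathsD(1)[OF assms(2)]] by auto
  then show "(1 - l) * p s + l * q s \<le> (1 - l) * p t + l * q t"
    using assms by (intro add_mono mult_left_mono) auto
next
  fix s :: real assume "s \<in> {0..<1}"
  then show "0 \<le> (1 - l) * p s + l * q s"
    using monotone_pathsD(2)[OF assms(1), of s] monotone_pathsD(2)[OF assms(2), of s] assms by simp
next
  show "set_integrable lborel {0..<1} (\<lambda>s. (1 - l) * p s + l * q s)"
    by (intro set_integral_add(1) set_integrable_mult_right monotone_pathsD assms)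
qed

text \<open>The grid inequality in the limit, along meshes of which \<open>\<beta>\<close> is a multiple.\<close>

lemma psi_circ_translation_submodular:
  assumes p: "p \<in> monotone_paths" and q: "q \<in> monotone_paths" and \<beta>: "0 < \<beta>"
  shows "psi_circ (\<lambda>s. max (p s - \<beta>) (q s)) + psi_circ (\<lambda>s. min (p s) (q s + \<beta>)) \<le> psi_circ p + psi_circ q"
proof -
  define h N M where "h n = \<beta> / real (Suc n)" and "N n = Suc n * Suc n" and "M n = Suc n + N n" for n
  have r: "refining h N" "refining h M"
    unfolding h_def N_def M_def using refining_scaled[OF \<beta>] by auto
  let ?U = "\<lambda>s. max (p s - \<beta>) (q s)" and ?V = "\<lambda>s. min (p s) (q s + \<beta>)"
  show ?thesis
  proof (rule LIMSEQ_le)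
    show "(\<lambda>n. grid_psi (h n) (N n) ?U + grid_psi (h n) (M n) ?V) \<longlonglongrightarrow> psi_circ ?U + psi_circ ?V"
      using \<beta> by (intro tendsto_add grid_psi_tendsto_psi_circ r monotone_paths_max_shift monotone_paths_min_shift p q) auto
    show "(\<lambda>n. grid_psi (h n) (M n) p + grid_psi (h n) (N n) q) \<longlonglongrightarrow> psi_circ p + psi_circ q"
      by (intro tendsto_add grid_psi_tendsto_psi_circ r p q)
    have "grid_psi (h n) (N n) ?U + grid_psi (h n) (M n) ?V \<le> grid_psi (h n) (M n) p + grid_psi (h n) (N n) q" for n
      unfolding M_def by (rule grid_psi_translation_submodular[OF p q]) (use \<beta> in \<open>simp_all add: h_def del: of_nat_Suc\<close>)
    then show "\<exists>n0. \<forall>n\<ge>n0. grid_psi (h n) (N n) ?U + grid_psi (h n) (M n) ?V \<le> grid_psi (h n) (M n) p + grid_psi (h n) (N n) q"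
      by blast
  qed
qed

text \<open>
  Let \<open>d = p - q\<close> lie in \<open>[- A, A]\<close>. One application of the submodular inequality with \<open>\<beta> = A / 2\<close>
  replaces \<open>d\<close> by \<open>d - A\<close> where \<open>d \<ge> A / 2\<close>, and by \<open>- d\<close> elsewhere, so the range becomes \<open>[- A / 2, A]\<close>. A second
  one brings it into \<open>[- A / 2, A / 2]\<close>. The sum of the two paths never changes.
\<close>

lemma fold_twice_halves:
  assumes p: "p \<in> monotone_paths" and q: "q \<in> monotone_paths" and A: "0 < A"
    and diff: "\<And>s. s \<in> {0..<1} \<Longrightarrow> \<bar>p s - q s\<bar> \<le> A"
  obtains p' q' where "p' \<in> monotone_paths" "q' \<in> monotone_paths" "\<And>s. p' s + q' s = p s + q s"
    "\<And>s. s \<in> {0..<1} \<Longrightarrow> \<bar>p' s - q' s\<bar> \<le> A / 2"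
    "psi_circ p' + psi_circ q' \<le> psi_circ p + psi_circ q"
proof -
  define up where "up p q = (\<lambda>s. max (p s - A / 2) (q s))" for p q :: "real \<Rightarrow> real"
  define dn where "dn p q = (\<lambda>s. min (p s) (q s + A / 2))" for p q :: "real \<Rightarrow> real"
  have mem: "up p q \<in> monotone_paths" "dn p q \<in> monotone_paths" if "p \<in> monotone_paths" "q \<in> monotone_paths" for p q
    unfolding up_def dn_def using that A by (intro monotone_paths_max_shift monotone_paths_min_shift; simp)+
  have sum: "up p q s + dn p q s = p s + q s" for p q s by (simp add: up_def dn_def max_def min_def)
  have psi: "psi_circ (up p q) + psi_circ (dn p q) \<le> psi_circ p + psi_circ q" if "p \<in> monotone_paths" "q \<in> monotone_paths" for p q
    unfolding up_def dn_def using that A by (intro psi_circ_translation_submodular) auto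
  show thesis
  proof (rule that)
    let ?p = "up (up p q) (dn p q)" and ?q = "dn (up p q) (dn p q)"
    show "?p \<in> monotone_paths" "?q \<in> monotone_paths" by (intro mem p q)+
    show "?p s + ?q s = p s + q s" for s by (simp add: sum)
    show "psi_circ ?p + psi_circ ?q \<le> psi_circ p + psi_circ q"
      using psi[OF mem[OF p q]] psi[OF p q] by linarith
    show "\<bar>?p s - ?q s\<bar> \<le> A / 2" if "s \<in> {0..<1}" for s
      using diff[OF that] A unfolding up_def dn_def by (auto simp: max_def min_def abs_if)
  qed
qed

text \<open>Folding repeatedly drives both paths to the midpoint without increasing the sum of the values.\<close>

lemma psi_circ_midpoint_bounded:
  assumes p: "p \<in> monotone_paths" and q: "q \<in> monotone_paths"
    and diff: "\<And>s. s \<in> {0..<1} \<Longrightarrow> \<bar>p s - q s\<bar> \<le> A"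
  shows "2 * psi_circ (\<lambda>s. (p s + q s) / 2) \<le> psi_circ p + psi_circ q"
proof -
  \<comment> \<open>A strictly positive bound, since a fold needs a positive shift.\<close>
  define B where "B = \<bar>A\<bar> + 1"
  have B: "B > 0" "\<And>s. s \<in> {0..<1} \<Longrightarrow> \<bar>p s - q s\<bar> \<le> B"
    using diff by (fastforce simp: B_def)+
  define mid where "mid = (\<lambda>s. (p s + q s) / 2)"
  have mid: "mid \<in> monotone_paths"
    using monotone_paths_convex[OF p q, of "1/2"] by (simp add: mid_def add_divide_distrib)
  have iter: "\<exists>p' q'. p' \<in> monotone_paths \<and> q' \<in> monotone_paths \<and> (\<forall>s. p' s + q' s = p s + q s) \<and>
      (\<forall>s\<in>{0..<1}. \<bar>p' s - q' s\<bar> \<le> B / 2 ^ n) \<and> psi_circ p' + psi_circ q' \<le> psi_circ p + psi_circ q" for n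
  proof (induction n)
    case 0
    then show ?case using p q B by (intro exI[of _ p] exI[of _ q]) auto
  next
    case (Suc n)
    then obtain p' q' where *: "p' \<in> monotone_paths" "q' \<in> monotone_paths" "\<forall>s. p' s + q' s = p s + q s"
      "\<forall>s\<in>{0..<1}. \<bar>p' s - q' s\<bar> \<le> B / 2 ^ n" "psi_circ p' + psi_circ q' \<le> psi_circ p + psi_circ q"
      by blast
    have "B / 2 ^ n > 0" using B by simp
    from fold_twice_halves[OF *(1,2) this] *(4) obtain p'' q'' where
      "p'' \<in> monotone_paths" "q'' \<in> monotone_paths" "\<And>s. p'' s + q'' s = p' s + q' s"
      "\<And>s. s \<in> {0..<1} \<Longrightarrow> \<bar>p'' s - q'' s\<bar> \<le> B / 2 ^ n / 2"
      "psi_circ p'' + psi_circ q'' \<le> psi_circ p' + psi_circ q'" by blast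
    then show ?case using *(3,5) by (intro exI[of _ p''] exI[of _ q'']) (auto simp: mult.commute)
  qed
  obtain K where K: "K \<ge> 0"
    "\<And>p q. p \<in> monotone_paths \<Longrightarrow> q \<in> monotone_paths \<Longrightarrow> \<bar>psi_circ p - psi_circ q\<bar> \<le> K * L1_dist p q"
    using psi_circ_lipschitz by blast
  have "2 * psi_circ mid \<le> psi_circ p + psi_circ q + 2 * K * (B / 2 ^ n)" for n
  proof -
    obtain p' q' where *: "p' \<in> monotone_paths" "q' \<in> monotone_paths" "\<And>s. p' s + q' s = p s + q s"
      "\<And>s. s \<in> {0..<1} \<Longrightarrow> \<bar>p' s - q' s\<bar> \<le> B / 2 ^ n" "psi_circ p' + psi_circ q' \<le> psi_circ p + psi_circ q"
      using iter[of n] by blast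
    have d: "L1_dist r mid \<le> B / 2 ^ n" if "r \<in> {p', q'}" for r
    proof -
      have "L1_dist r mid \<le> (LINT s:{0..<1::real}|lborel. B / 2 ^ n)"
      proof (rule L1_dist_le)
        show "r \<in> monotone_paths" using that * by auto
        show "set_integrable lborel {0..<1::real} (\<lambda>s. B / 2 ^ n)" by (rule integrable_unit_const)
        fix s :: real assume s: "s \<in> {0..<1}"
        have "mid s = (p' s + q' s) / 2" using *(3)[of s] by (simp add: mid_def)
        then have "r s - mid s = (p' s - q' s) / 2 \<or> r s - mid s = (q' s - p' s) / 2"
          using that by (auto simp: field_simps)
        moreover have "\<bar>v\<bar> \<le> D" if "v = w / 2 \<or> v = - w / 2" "\<bar>w\<bar> \<le> D" for v w D :: real
          using that by linarith
        ultimately show "\<bar>r s - mid s\<bar> \<le> B / 2 ^ n" using *(4)[OF s] by force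
      qed (rule mid)
      also have "\<dots> = B / 2 ^ n" by (simp add: set_lebesgue_integral_def)
      finally show ?thesis .
    qed
    have "\<bar>psi_circ p' - psi_circ mid\<bar> \<le> K * (B / 2 ^ n)" "\<bar>psi_circ q' - psi_circ mid\<bar> \<le> K * (B / 2 ^ n)"
      using K(2)[OF *(1) mid] K(2)[OF *(2) mid] mult_left_mono[OF d[of p'] K(1)] mult_left_mono[OF d[of q'] K(1)]
      by auto
    moreover have "2 * x \<le> z + 2 * D" if "\<bar>u - x\<bar> \<le> D" "\<bar>v - x\<bar> \<le> D" "u + v \<le> z" for u v x z D :: real
      using that by linarith
    ultimately show ?thesis using *(5) unfolding mult.assoc[of 2 K] by blast
  qed
  moreover have "(\<lambda>n. psi_circ p + psi_circ q + 2 * K * (B / 2 ^ n)) \<longlonglongrightarrow> psi_circ p + psi_circ q + 2 * K * 0"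
    by (intro tendsto_intros LIMSEQ_divide_realpow_zero) simp
  ultimately have "2 * psi_circ mid \<le> psi_circ p + psi_circ q + 2 * K * 0"
    by (intro LIMSEQ_le_const) auto
  then show ?thesis by (simp add: mid_def)
qed

text \<open>Step paths are bounded, so their differences are, and they are dense.\<close>

lemma psi_circ_midpoint:
  assumes p: "p \<in> monotone_paths" and q: "q \<in> monotone_paths"
  shows "2 * psi_circ (\<lambda>s. (p s + q s) / 2) \<le> psi_circ p + psi_circ q"
proof -
  obtain K where K: "K \<ge> 0"
    "\<And>p q. p \<in> monotone_paths \<Longrightarrow> q \<in> monotone_paths \<Longrightarrow> \<bar>psi_circ p - psi_circ q\<bar> \<le> K * L1_dist p q"
    using psi_circ_lipschitz by blast
  obtain P where P: "\<And>n. P n \<in> step_paths" "(\<lambda>n. L1_dist (P n) p) \<longlonglongrightarrow> 0"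
    using step_paths_dense[OF p] by blast
  obtain Q where Q: "\<And>n. Q n \<in> step_paths" "(\<lambda>n. L1_dist (Q n) q) \<longlonglongrightarrow> 0"
    using step_paths_dense[OF q] by blast
  have PQ: "P n \<in> monotone_paths" "Q n \<in> monotone_paths" for n using P Q by (auto intro: step_paths_monotone_paths)
  have midm: "(\<lambda>s. (p s + q s) / 2) \<in> monotone_paths" if "p \<in> monotone_paths" "q \<in> monotone_paths" for p q
    using monotone_paths_convex[OF that, of "1/2"] by (simp add: add_divide_distrib)
  have lim: "(\<lambda>n. psi_circ (R n)) \<longlonglongrightarrow> psi_circ r"
    if "\<And>n. R n \<in> monotone_paths" "r \<in> monotone_paths" "(\<lambda>n. L1_dist (R n) r) \<longlonglongrightarrow> 0" for R r
  proof -
    have "(\<lambda>n. K * L1_dist (R n) r) \<longlonglongrightarrow> 0" using tendsto_mult_right_zero[OF that(3)] .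
    then have "(\<lambda>n. psi_circ (R n) - psi_circ r) \<longlonglongrightarrow> 0"
      by (rule Lim_null_comparison[rotated]) (use K that in auto)
    then show ?thesis by (simp add: LIM_zero_iff)
  qed
  have "(\<lambda>n. L1_dist (\<lambda>s. (P n s + Q n s) / 2) (\<lambda>s. (p s + q s) / 2)) \<longlonglongrightarrow> 0"
  proof (rule Lim_null_comparison)
    show "(\<lambda>n. L1_dist (P n) p + L1_dist (Q n) q) \<longlonglongrightarrow> 0" using tendsto_add[OF P(2) Q(2)] by simp
    have "L1_dist (\<lambda>s. (P n s + Q n s) / 2) (\<lambda>s. (p s + q s) / 2) \<le> L1_dist (P n) p + L1_dist (Q n) q" for n
    proof -
      have "L1_dist (\<lambda>s. (P n s + Q n s) / 2) (\<lambda>s. (p s + q s) / 2)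
          \<le> (LINT s:{0..<1}|lborel. \<bar>P n s - p s\<bar> + \<bar>Q n s - q s\<bar>)"
        by (intro L1_dist_le midm PQ p q set_integral_add(1) L1_dist_integrable) (auto simp: abs_if field_simps)
      also have "\<dots> = L1_dist (P n) p + L1_dist (Q n) q"
        unfolding L1_dist_def by (intro set_integral_add(2) L1_dist_integrable PQ p q)
      finally show ?thesis .
    qed
    then show "\<forall>\<^sub>F n in sequentially. norm (L1_dist (\<lambda>s. (P n s + Q n s) / 2) (\<lambda>s. (p s + q s) / 2))
        \<le> L1_dist (P n) p + L1_dist (Q n) q"
      by (simp add: L1_dist_nonneg)
  qed
  then have l1: "(\<lambda>n. 2 * psi_circ (\<lambda>s. (P n s + Q n s) / 2)) \<longlonglongrightarrow> 2 * psi_circ (\<lambda>s. (p s + q s) / 2)"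
    by (intro tendsto_mult tendsto_const lim[where R = "\<lambda>n s. (P n s + Q n s) / 2"] midm PQ p q)
  have l2: "(\<lambda>n. psi_circ (P n) + psi_circ (Q n)) \<longlonglongrightarrow> psi_circ p + psi_circ q"
    by (intro tendsto_add lim PQ p q P Q)
  have "2 * psi_circ (\<lambda>s. (P n s + Q n s) / 2) \<le> psi_circ (P n) + psi_circ (Q n)" for n
  proof -
    obtain A where A: "\<And>s. s \<in> {0..<1} \<Longrightarrow> P n s \<le> A" using step_paths_bounded[OF P(1)] by blast
    obtain B where B: "\<And>s. s \<in> {0..<1} \<Longrightarrow> Q n s \<le> B" using step_paths_bounded[OF Q(1)] by blast
    have "\<bar>P n s - Q n s\<bar> \<le> \<bar>A\<bar> + \<bar>B\<bar>" if "s \<in> {0..<1}" for s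
      using A[OF that] B[OF that] monotone_pathsD(2)[OF PQ(1), of s n] monotone_pathsD(2)[OF PQ(2), of s n] that by auto
    then show ?thesis by (rule psi_circ_midpoint_bounded[OF PQ])
  qed
  then show ?thesis by (intro LIMSEQ_le[OF l1 l2]) auto
qed

text \<open>
  If the excess over the chord had a positive maximum, the leftmost maximiser would be
  interior and the midpoint of two points of which one has strictly smaller excess.
\<close>

lemma midpoint_convex_imp_convex:
  fixes f :: "real \<Rightarrow> real"
  assumes cont: "continuous_on {0..1} f"
    and mid: "\<And>x y. x \<in> {0..1} \<Longrightarrow> y \<in> {0..1} \<Longrightarrow> 2 * f ((x + y) / 2) \<le> f x + f y"
    and l: "l \<in> {0..1}"
  shows "f l \<le> (1 - l) * f 0 + l * f 1"
proof (rule ccontr)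
  assume contra: "\<not> ?thesis"
  define g where "g x = f x - ((1 - x) * f 0 + x * f 1)" for x
  have g_cont: "continuous_on {0..1} g" unfolding g_def by (intro continuous_intros cont)
  have g_mid: "2 * g ((x + y) / 2) \<le> g x + g y" if "x \<in> {0..1}" "y \<in> {0..1}" for x y
    using mid[OF that] by (simp add: g_def field_simps)
  obtain x where x: "x \<in> {0..1}" "\<And>y. y \<in> {0..1} \<Longrightarrow> g y \<le> g x"
    using continuous_attains_sup[OF _ _ g_cont] by auto
  define S where "S = {y \<in> {0..1}. g y = g x}"
  have "compact S"
  proof -
    have "closed S" unfolding S_def using continuous_closed_preimage_constant[OF g_cont, of "g x"] by simp
    then show ?thesis by (auto simp: S_def compact_eq_bounded_closed intro: bounded_subset[of "{0..1::real}"])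
  qed
  moreover have "S \<noteq> {}" using x by (auto simp: S_def)
  ultimately obtain a where a: "a \<in> S" "\<And>y. y \<in> S \<Longrightarrow> a \<le> y"
    using compact_attains_inf[of S] by blast
  have "g l > 0" using contra by (simp add: g_def)
  then have pos: "g x > 0" using x(2)[OF l] by linarith
  have "g 0 = 0" "g 1 = 0" by (simp_all add: g_def)
  with pos a(1) have "a \<noteq> 0" "a \<noteq> 1" "a \<in> {0..1}" by (auto simp: S_def)
  then have a01: "0 < a" "a < 1" by auto
  define r where "r = min a (1 - a)"
  have r: "0 < r" "a - r \<in> {0..1}" "a + r \<in> {0..1}" using a01 by (auto simp: r_def min_def)
  have "g (a - r) < g x" using x(2)[OF r(2)] a(2)[of "a - r"] r by (force simp: S_def)
  moreover have "g (a + r) \<le> g x" by (rule x(2)[OF r(3)])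
  moreover have "2 * g a \<le> g (a - r) + g (a + r)" using g_mid[OF r(2,3)] by simp
  moreover have "g a = g x" using a(1) by (simp add: S_def)
  ultimately show False by linarith
qed

lemma psi_circ_convex:
  assumes p: "p \<in> monotone_paths" and q: "q \<in> monotone_paths" and l: "l \<in> {0..1}"
  shows "psi_circ (\<lambda>s. (1 - l) * p s + l * q s) \<le> (1 - l) * psi_circ p + l * psi_circ q"
proof -
  define c where "c t = (\<lambda>s. (1 - t) * p s + t * q s)" for t
  have c: "c t \<in> monotone_paths" if "t \<in> {0..1}" for t
    unfolding c_def using that by (intro monotone_paths_convex p q) auto
  obtain K where K: "K \<ge> 0"
    "\<And>p q. p \<in> monotone_paths \<Longrightarrow> q \<in> monotone_paths \<Longrightarrow> \<bar>psi_circ p - psi_circ q\<bar> \<le> K * L1_dist p q"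
    using psi_circ_lipschitz by blast
  have "(K * L1_dist p q)-lipschitz_on {0..1} (\<lambda>t. psi_circ (c t))"
  proof (rule lipschitz_onI)
    fix t u :: real assume tu: "t \<in> {0..1}" "u \<in> {0..1}"
    have "\<bar>c t s - c u s\<bar> = \<bar>t - u\<bar> * \<bar>p s - q s\<bar>" for s
      unfolding c_def abs_mult[symmetric] by (subst abs_minus_commute) (simp add: algebra_simps)
    then have "L1_dist (c t) (c u) = \<bar>t - u\<bar> * L1_dist p q"
      by (simp add: L1_dist_def)
    then show "dist (psi_circ (c t)) (psi_circ (c u)) \<le> K * L1_dist p q * dist t u"
      using K(2)[OF c[OF tu(1)] c[OF tu(2)]] by (simp add: dist_real_def mult_ac)
  qed (simp add: K L1_dist_nonneg)
  then have cont: "continuous_on {0..1} (\<lambda>t. psi_circ (c t))"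
    by (rule lipschitz_on_continuous_on)
  have "psi_circ (c l) \<le> (1 - l) * psi_circ (c 0) + l * psi_circ (c 1)"
  proof (rule midpoint_convex_imp_convex[OF cont _ l])
    fix t u :: real assume tu: "t \<in> {0..1}" "u \<in> {0..1}"
    have "c ((t + u) / 2) = (\<lambda>s. (c t s + c u s) / 2)"
      by (rule ext) (simp add: c_def field_simps)
    then show "2 * psi_circ (c ((t + u) / 2)) \<le> psi_circ (c t) + psi_circ (c u)"
      using psi_circ_midpoint[OF c[OF tu(1)] c[OF tu(2)]] by simp
  qed
  then show ?thesis by (simp add: c_def)
qed

lemma paths1_monotone_paths: "q \<in> paths1 \<Longrightarrow> q \<in> monotone_paths"
  by (auto simp: paths1_def paths_def monotone_paths_def)

theorem proposition2p2:
  fixes q0 q1 :: "real \<Rightarrow> real" and l :: real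
  assumes "q0 \<in> paths1" and "q1 \<in> paths1" and "l \<in> {0..1}"
  shows "psi_circ (\<lambda>s. (1 - l) * q0 s + l * q1 s) \<le> (1 - l) * psi_circ q0 + l * psi_circ q1"
  using psi_circ_convex assms by (simp add: paths1_monotone_paths)

end
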